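(* Let $f:\mathbb{R}\to\mathbb{R}$ be a bounded, piecewise continuous function (i.e., continuous on $\mathbb{R}$ outside a finite set $D_f$, at the points of which it has finite left and right limits) such that $$\lim_{x\to-\infty}f(x)=0,\qquad \lim_{x\to+\infty}f(x)=1.$$ Suppose that the starting point $x\in\mathbb{R}$, as well as the parameters $c>0$ and $\lambda>0$, may depend on $T$ in such a way that $\lambda T\to\infty$ and $(c^2T/\lambda)^{-1/2}\,x\to a\in\mathbb{R}$ as $T\to\infty$, and assume in addition that $c^2T/\lambda\to\infty$ as $T\to\infty$. Then the distribution of $$\eta_T^{\pm}(x;f):=\frac1T\int_0^T f(x+X_t^{\pm})\,dt$$ converges weakly, as $T\to\infty$, to the distribution of $Y_{-a}$ if $a\le0$ and to the distribution of $1-Y_a$ if $a\ge0$.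
   Context: For $\lambda>0$, $c>0$, let $(N_t,\,t\ge0)$ be a homogeneous Poisson process with rate $\lambda$. The conditional telegraph processes are $X_t^{\pm}:=\pm c\int_0^t(-1)^{N_u}\,du$, $t\ge0$. Formulas with $\pm$ combine two cases, one for the upper and one for the lower sign. The arcsine density is $p_{\mathrm{as}}(y):=\frac{1}{\pi\sqrt{y(1-y)}}$, $0<y<1$. For $a>0$ set $q_a(t):=\frac{a}{\sqrt{2\pi t^3}}\exp\left(-\frac{a^2}{2t}\right)$, $t>0$. Let $Y_a$ ($a\ge0$) be random variables with values in $[0,1]$ such that $Y_0$ has the arcsine distribution (density $p_{\mathrm{as}}$), while for $a>0$ $$\mathbb{P}\{Y_a\in dy\}=m_a\,\delta_0(dy)+f_a(y)\,dy,$$ where $\delta_0$ is the Dirac measure at $0$ and $$m_a:=\int_1^\infty q_a(u)\,du,\qquad f_a(y):=\int_0^{1-y}\frac{q_a(u)}{1-u}\,p_{\mathrm{as}}\!\left(\frac{y}{1-u}\right)du .$$ *)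

theory Defs
  imports "HOL-Probability.Probability"
begin

section \<open>Weak convergence along a filter\<close>

text \<open>The library's \<^const>\<open>weak_conv_m\<close> is restricted to sequences; here \<open>T\<close> tends to infinity
  along the reals. For sequences of probability measures on the line the two notions agree.\<close>

definition weak_conv_along :: "('i \<Rightarrow> real measure) \<Rightarrow> real measure \<Rightarrow> 'i filter \<Rightarrow> bool" where
  "weak_conv_along \<mu> \<nu> F \<longleftrightarrow>
     (\<forall>g :: real \<Rightarrow> real. continuous_on UNIV g \<and> bounded (range g) \<longrightarrow>
        ((\<lambda>i. \<integral>y. g y \<partial>(\<mu> i)) \<longlongrightarrow> (\<integral>y. g y \<partial>\<nu>)) F)"

lemma weak_conv_along_sequentially_iff:
  assumes "\<And>n. real_distribution (\<mu> n)" and "real_distribution \<nu>"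
  shows "weak_conv_along \<mu> \<nu> sequentially \<longleftrightarrow> weak_conv_m \<mu> \<nu>"
proof
  assume L: "weak_conv_along \<mu> \<nu> sequentially"
  show "weak_conv_m \<mu> \<nu>"
  proof (rule integral_bdd_continuous_conv_imp_weak_conv[OF assms])
    fix g :: "real \<Rightarrow> real"
    assume "\<And>x. isCont g x" and "\<And>x. \<bar>g x\<bar> \<le> 1"
    then have "continuous_on UNIV g" and "bounded (range g)"
      by (auto simp: continuous_on_eq_continuous_at bounded_iff)
    then show "(\<lambda>n. integral\<^sup>L (\<mu> n) g) \<longlonglongrightarrow> integral\<^sup>L \<nu> g"
      using L by (auto simp: weak_conv_along_def)
  qed
next
  assume R: "weak_conv_m \<mu> \<nu>"
  show "weak_conv_along \<mu> \<nu> sequentially"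
    unfolding weak_conv_along_def
  proof (intro allI impI)
    fix g :: "real \<Rightarrow> real"
    assume g: "continuous_on UNIV g \<and> bounded (range g)"
    then obtain B where "\<And>x. norm (g x) \<le> B" by (auto simp: bounded_iff)
    moreover have "\<And>x. isCont g x" using g by (simp add: continuous_on_eq_continuous_at)
    ultimately show "(\<lambda>n. \<integral>y. g y \<partial>(\<mu> n)) \<longlonglongrightarrow> (\<integral>y. g y \<partial>\<nu>)"
      using weak_conv_imp_integral_bdd_continuous_conv[OF assms R] by blast
  qed
qed


section \<open>The Poisson process and the conditional telegraph processes\<close>

text \<open>Only the values of \<open>N t\<close> at times \<open>t \<ge> 0\<close> are constrained. The paths are assumed to be
  counting paths for every \<open>\<omega>\<close>, not merely almost surely, so that time integrals along the paths
  are random variables even if \<open>M\<close> is not complete. As the paths are nondecreasing, the truncated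
  subtraction on \<^typ>\<open>nat\<close> gives the true increments.\<close>

locale poisson_process = prob_space M
  for M :: "'a measure" and rate :: real and N :: "real \<Rightarrow> 'a \<Rightarrow> nat" +
  assumes rate_pos: "rate > 0"
    and N_measurable: "\<And>t. t \<ge> 0 \<Longrightarrow> N t \<in> measurable M (count_space UNIV)"
    and N_zero: "\<And>\<omega>. \<omega> \<in> space M \<Longrightarrow> N 0 \<omega> = 0"
    and N_mono: "\<And>s t \<omega>. \<omega> \<in> space M \<Longrightarrow> 0 \<le> s \<Longrightarrow> s \<le> t \<Longrightarrow> N s \<omega> \<le> N t \<omega>"
    and N_right_continuous:
      "\<And>t \<omega>. \<omega> \<in> space M \<Longrightarrow> t \<ge> 0 \<Longrightarrow> continuous (at_right t) (\<lambda>s. N s \<omega>)"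
    and N_increment:
      "\<And>s t. 0 \<le> s \<Longrightarrow> s < t \<Longrightarrow>
         distr M (count_space UNIV) (\<lambda>\<omega>. N t \<omega> - N s \<omega>) = measure_pmf (poisson_pmf (rate * (t - s)))"
    and N_indep_increments:
      "\<And>(n :: nat) (t :: nat \<Rightarrow> real). t 0 \<ge> 0 \<Longrightarrow> (\<And>i. i < n \<Longrightarrow> t i \<le> t (Suc i)) \<Longrightarrow>
         indep_vars (\<lambda>_. count_space UNIV) (\<lambda>i \<omega>. N (t (Suc i)) \<omega> - N (t i) \<omega>) {..<n}"

text \<open>The sign \<open>\<sigma> = 1\<close> gives \<open>X\<^sup>+\<close> and \<open>\<sigma> = -1\<close> gives \<open>X\<^sup>-\<close>.\<close>

definition telegraph :: "real \<Rightarrow> real \<Rightarrow> (real \<Rightarrow> 'a \<Rightarrow> nat) \<Rightarrow> real \<Rightarrow> 'a \<Rightarrow> real" where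
  "telegraph \<sigma> c N t \<omega> = \<sigma> * c * (LBINT u:{0..t}. (-1) ^ N u \<omega>)"

definition eta ::
  "real \<Rightarrow> real \<Rightarrow> (real \<Rightarrow> 'a \<Rightarrow> nat) \<Rightarrow> real \<Rightarrow> (real \<Rightarrow> real) \<Rightarrow> real \<Rightarrow> 'a \<Rightarrow> real" where
  "eta \<sigma> c N x f T \<omega> = 1 / T * (LBINT t:{0..T}. f (x + telegraph \<sigma> c N t \<omega>))"


section \<open>Piecewise continuous functions\<close>

definition piecewise_continuous :: "(real \<Rightarrow> real) \<Rightarrow> bool" where
  "piecewise_continuous f \<longleftrightarrow>
     (\<exists>D. finite D \<and> (\<forall>x. x \<notin> D \<longrightarrow> isCont f x) \<and>
        (\<forall>d\<in>D. (\<exists>l. (f \<longlongrightarrow> l) (at_left d)) \<and> (\<exists>r. (f \<longlongrightarrow> r) (at_right d))))"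


section \<open>The limit laws\<close>

definition arcsine_density :: "real \<Rightarrow> real" where
  "arcsine_density y = (if 0 < y \<and> y < 1 then 1 / (pi * sqrt (y * (1 - y))) else 0)"

definition q_density :: "real \<Rightarrow> real \<Rightarrow> real" where
  "q_density a t = a / sqrt (2 * pi * t ^ 3) * exp (- (a\<^sup>2 / (2 * t)))"

definition Y_atom :: "real \<Rightarrow> real" where
  "Y_atom a = (LBINT u:{1<..}. q_density a u)"

text \<open>The density of the absolutely continuous part; it lives on the unit interval.\<close>

definition Y_density :: "real \<Rightarrow> real \<Rightarrow> real" where
  "Y_density a y =
     (if 0 < y \<and> y < 1
      then (LBINT u:{0<..<1 - y}. q_density a u / (1 - u) * arcsine_density (y / (1 - u)))
      else 0)"

text \<open>The distribution of \<open>Y\<^sub>a\<close>, meaningful for \<open>a \<ge> 0\<close>.\<close>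

definition Y_law :: "real \<Rightarrow> real measure" where
  "Y_law a =
     (if a = 0 then density lborel (\<lambda>y. ennreal (arcsine_density y))
      else measure_of UNIV (sets borel)
        (\<lambda>B. ennreal (Y_atom a) * emeasure (return borel 0) B
              + (\<integral>\<^sup>+y\<in>B. ennreal (Y_density a y) \<partial>lborel)))"

lemma sets_Y_law [simp, measurable_cong]: "sets (Y_law a) = sets borel"
proof -
  have "sigma_sets UNIV (sets (borel :: real measure)) = sets borel"
    using sets.sigma_sets_eq[of "borel :: real measure"] by simp
  then show ?thesis by (simp add: Y_law_def)
qed

lemma space_Y_law [simp]: "space (Y_law a) = UNIV"
  using sets_eq_imp_space_eq[OF sets_Y_law] by simp

lemma q_density_measurable [measurable]: "q_density a \<in> borel_measurable borel"
  unfolding q_density_def by measurable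

lemma arcsine_density_measurable [measurable]: "arcsine_density \<in> borel_measurable borel"
  unfolding arcsine_density_def by measurable

lemma Y_density_measurable [measurable]: "Y_density a \<in> borel_measurable borel"
proof -
  have "(\<lambda>y. LBINT u. indicator {p :: real \<times> real. 0 < snd p \<and> snd p < 1 - fst p} (y, u) *\<^sub>R
          (q_density a u / (1 - u) * arcsine_density (y / (1 - u)))) \<in> borel_measurable borel"
    by measurable
  moreover have "indicator {p :: real \<times> real. 0 < snd p \<and> snd p < 1 - fst p} (y, u)
      = (indicator {0<..<1 - y} u :: real)" for y u :: real
    by (simp add: indicator_def)
  ultimately have [measurable]: "(\<lambda>y. LBINT u:{0<..<1 - y}.
      q_density a u / (1 - u) * arcsine_density (y / (1 - u))) \<in> borel_measurable borel"
    by (simp add: set_lebesgue_integral_def)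
  show ?thesis unfolding Y_density_def by measurable
qed

lemma emeasure_Y_law:
  assumes "a \<noteq> 0" and B: "B \<in> sets borel"
  shows "emeasure (Y_law a) B =
    ennreal (Y_atom a) * indicator B 0 + (\<integral>\<^sup>+y\<in>B. ennreal (Y_density a y) \<partial>lborel)"
proof -
  define D where "D = density lborel (\<lambda>y. ennreal (Y_density a y))"
  define S where "S = scale_measure (ennreal (Y_atom a)) (return (borel :: real measure) 0)"
  define \<mu> where "\<mu> = (\<lambda>B. ennreal (Y_atom a) * emeasure (return borel (0::real)) B
              + (\<integral>\<^sup>+y\<in>B. ennreal (Y_density a y) \<partial>lborel))"
  have \<mu>: "\<mu> A = emeasure S A + emeasure D A" if "A \<in> sets borel" for A
    using that by (simp add: \<mu>_def S_def D_def emeasure_density)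
  have "emeasure (Y_law a) B = \<mu> B"
  proof (rule emeasure_measure_of)
    show "Y_law a = measure_of UNIV (sets borel) \<mu>"
      using assms(1) by (simp add: Y_law_def \<mu>_def)
    show "positive (sets (Y_law a)) \<mu>" by (simp add: positive_def \<mu>_def)
    show "countably_additive (sets (Y_law a)) \<mu>"
    proof (rule countably_additiveI)
      fix A :: "nat \<Rightarrow> real set"
      assume A: "range A \<subseteq> sets (Y_law a)" "disjoint_family A" "(\<Union>i. A i) \<in> sets (Y_law a)"
      then have "range A \<subseteq> sets S" "range A \<subseteq> sets D" and m: "\<And>i. A i \<in> sets borel"
        by (auto simp: S_def D_def)
      then have "(\<Sum>i. emeasure S (A i)) = emeasure S (\<Union>i. A i)"
        "(\<Sum>i. emeasure D (A i)) = emeasure D (\<Union>i. A i)"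
        using A(2) by (auto intro!: suminf_emeasure)
      then show "(\<Sum>i. \<mu> (A i)) = \<mu> (\<Union>i. A i)"
        using A m by (simp add: \<mu> suminf_add[symmetric])
    qed
  qed (use B in auto)
  then show ?thesis using B by (simp add: \<mu>_def)
qed

end

theory Submission
  imports Defs
begin

text \<open>
  No Brownian motion is needed. In the variables \<open>z = x / sqrt (c\<^sup>2 T / \<lambda>)\<close> and \<open>s = t / T\<close> the process
  becomes \<open>Z s = z + \<kappa> \<integral>\<^sub>0\<^sup>s (-1)^N\<close> with \<open>\<kappa>\<^sup>2\<close> equal to the jump rate \<open>r\<close> of \<open>N\<close>, and \<open>\<eta>\<close> is close in mean to
  \<open>A 1\<close>, where \<open>A s\<close> is the time spent by \<open>Z\<close> in the positive half-line up to time \<open>s\<close>. Let \<open>h\<close> be the indicator of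
  that half-line. Integrating \<open>exp (- \<alpha> s - \<theta> A s) w (Z s)\<close> along the path, and using that
  \<open>E [F (-1)^N\<^sub>t] = exp (- 2 r (t - s)) E [F (-1)^N\<^sub>s]\<close> for \<open>F\<close> determined by the past of \<open>s\<close>, gives
  \<open>w z = \<integral>\<^sub>0\<^sup>\<infinity> E [exp (- \<alpha> s - \<theta> A s) ((\<alpha> + \<theta> h) w - w'' / 2) (Z s)] ds + O(r\<^bsup>-1/2\<^esup>)\<close>
  for every bounded C1 function \<open>w\<close> whose second derivative is bounded and may jump at 0. Choosing \<open>w\<close> piecewise exponential with
  \<open>(\<alpha> + \<theta> h) w - w'' / 2 = 1\<close> yields the limit of the double Laplace transform of \<open>A\<close>, and it is the transform
  of \<open>max (t - \<tau>) 0 * U\<close> for independent \<open>\<tau>\<close> with density \<open>q\<close> and \<open>U\<close> arcsine, whose law at \<open>t = 1\<close> is that of \<open>Y\<close>.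
  The choice \<open>\<theta> = 0\<close> with right-hand side \<open>h\<close> shows that \<open>Z\<close> spends little time near 0, so that only the limits of \<open>f\<close> at
  infinity matter. The case \<open>a \<ge> 0\<close> follows by reflection.
\<close>

section \<open>Paths and their time integrals\<close>

text \<open>The obstacle is that \<open>Z\<close> alone is not Markov: its velocity belongs to the
  state. For a function \<open>w\<close> of the position, the drift is \<open>\<kappa>\<close> times
  the mean of \<open>path * w'\<close>, a large factor times a small mean. The same integration
  applied to \<open>w'\<close> and multiplied by the sign shows that this mean is damped at rate
  \<open>2 * rate\<close> and driven by \<open>\<kappa> * w''\<close>. As
  \<open>\<kappa>^2 = rate\<close>, the drift turns into \<open>w'' / 2\<close>, and what remains
  carries the factor \<open>\<kappa> / (2 * rate)\<close>, which is the size of the error. The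
  potential \<open>\<alpha> + \<theta> h\<close> jumps at 0, so \<open>w''\<close> has to jump as
  well. This does no harm, because on a bounded time interval a path has only finitely many sign
  changes and zeros. The return from Laplace transforms in \<open>t\<close> to the single time 1
  rests on Lipschitz bounds in \<open>t\<close> that are uniform in \<open>T\<close>. The initial
  sign is put into the sign of \<open>\<kappa>\<close>, which the estimates see only through
  \<open>\<kappa>^2\<close>, so both signs are treated at once.\<close>

definition path_int :: "(real \<Rightarrow> real) \<Rightarrow> real \<Rightarrow> real" where
  "path_int d t = (LBINT u:{0..t}. d u)"

lemma set_integrable_const_Icc: "set_integrable lborel {a..b::real} (\<lambda>_. B :: real)"
  using borel_integrable_atLeastAtMost[of a b "\<lambda>_. B"]
  by (simp add: set_integrable_def indicator_def if_distrib cong: if_cong)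

lemma set_integrable_bounded_Icc:
  fixes d :: "real \<Rightarrow> real"
  assumes [measurable]: "d \<in> borel_measurable borel" and "\<And>u. \<bar>d u\<bar> \<le> B"
  shows "set_integrable lborel {a..b} d"
  using set_integrable_const_Icc[of a b B]
  by (rule set_integrable_bound)
     (auto simp: set_borel_measurable_def intro!: order_trans[OF assms(2) abs_ge_self])

lemma path_int_0 [simp]: "path_int d 0 = 0"
  unfolding path_int_def set_lebesgue_integral_def
  by (rule integral_eq_zero_AE, use AE_lborel_singleton[of "0::real"] in eventually_elim)
     (simp add: indicator_def)

lemma path_int_eq_integral:
  assumes "d \<in> borel_measurable borel" "\<And>u. \<bar>d u\<bar> \<le> B"
  shows "path_int d t = integral {0..t} d"
  by (simp add: path_int_def set_borel_integral_eq_integral(2)[OF set_integrable_bounded_Icc[OF assms]])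

lemma path_int_diff:
  fixes d :: "real \<Rightarrow> real"
  assumes "d \<in> borel_measurable borel" "\<And>u. \<bar>d u\<bar> \<le> B" "0 \<le> s" "s \<le> t"
  shows "path_int d t - path_int d s = (LBINT u:{s..t}. d u)"
proof -
  note I = set_integrable_bounded_Icc[OF assms(1,2)]
  have "integral {0..s} d + integral {s..t} d = integral {0..t} d"
    using assms set_borel_integral_eq_integral(1)[OF I]
    by (intro Henstock_Kurzweil_Integration.integral_combine) auto
  then show ?thesis
    by (simp add: path_int_def set_borel_integral_eq_integral(2)[OF I])
qed

lemma abs_set_integral_Icc_le:
  fixes d :: "real \<Rightarrow> real"
  assumes "d \<in> borel_measurable borel" "\<And>u. \<bar>d u\<bar> \<le> B" "s \<le> t"
  shows "\<bar>LBINT u:{s..t}. d u\<bar> \<le> B * (t - s)"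
proof -
  have "\<bar>LBINT u:{s..t}. d u\<bar> \<le> (LBINT u:{s..t}. \<bar>d u\<bar>)"
    using set_integral_norm_bound[OF set_integrable_bounded_Icc[OF assms(1,2)]] by simp
  also have "\<dots> \<le> (LBINT u:{s..t}. B)"
    by (intro set_integral_mono set_integrable_abs set_integrable_bounded_Icc[OF assms(1,2)]
          set_integrable_const_Icc assms(2))
  also have "\<dots> = B * (t - s)" using assms(3) by (simp add: set_lebesgue_integral_def)
  finally show ?thesis .
qed

lemma path_int_lipschitz:
  fixes d :: "real \<Rightarrow> real"
  assumes "d \<in> borel_measurable borel" "\<And>u. \<bar>d u\<bar> \<le> B" "0 \<le> s" "s \<le> t"
  shows "\<bar>path_int d t - path_int d s\<bar> \<le> B * (t - s)"
  using path_int_diff[OF assms] abs_set_integral_Icc_le[OF assms(1,2,4)] by simp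

lemma path_int_neg: "t \<le> 0 \<Longrightarrow> path_int d t = 0"
  by (cases "t = 0") (simp, simp add: path_int_def set_lebesgue_integral_def)

lemma path_int_continuous:
  fixes d :: "real \<Rightarrow> real"
  assumes "d \<in> borel_measurable borel" "\<And>u. \<bar>d u\<bar> \<le> B"
  shows "continuous_on UNIV (path_int d)"
proof -
  have B: "0 \<le> B" using assms(2)[of 0] by simp
  \<comment> \<open>For negative times the interval of integration is empty, so the Lipschitz bound
    on the half-line extends to the whole line.\<close>
  have m: "path_int d x = path_int d (max 0 x)" for x
    by (cases "x \<le> 0") (simp_all add: path_int_neg max_def)
  have 1: "\<bar>path_int d t - path_int d s\<bar> \<le> B * \<bar>t - s\<bar>" if "s \<le> t" for s t
  proof -
    have "\<bar>path_int d (max 0 t) - path_int d (max 0 s)\<bar> \<le> B * (max 0 t - max 0 s)"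
      using that by (intro path_int_lipschitz[OF assms]) auto
    also have "\<dots> \<le> B * \<bar>t - s\<bar>" using that B by (intro mult_left_mono) auto
    finally show ?thesis using m by metis
  qed
  have "\<bar>path_int d t - path_int d s\<bar> \<le> B * \<bar>t - s\<bar>" for s t
    using 1[of s t] 1[of t s] by (cases "s \<le> t") (simp_all add: abs_minus_commute)
  then have "B-lipschitz_on UNIV (path_int d)"
    using B by (intro lipschitz_onI) (simp_all add: dist_real_def)
  then show ?thesis by (rule lipschitz_on_continuous_on)
qed

text \<open>The upper limit of integration depends on the point, so the interval is read as a
  section of a measurable subset of the product. The parametric integral is then covered by the
  usual measurability of integrals with a parameter.\<close>

lemma path_int_measurable [measurable (raw)]:
  fixes d :: "'a \<Rightarrow> real \<Rightarrow> real" and t :: "'a \<Rightarrow> real"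
  assumes [measurable]: "(\<lambda>(x, s). d x s) \<in> borel_measurable (G \<Otimes>\<^sub>M borel)"
    and [measurable]: "t \<in> borel_measurable G"
  shows "(\<lambda>x. path_int (d x) (t x)) \<in> borel_measurable G"
proof -
  have "{p \<in> space (G \<Otimes>\<^sub>M borel). 0 \<le> snd p \<and> snd p \<le> t (fst p)} \<in> sets (G \<Otimes>\<^sub>M borel)"
    by measurable
  moreover have "indicator {p \<in> space (G \<Otimes>\<^sub>M borel). 0 \<le> snd p \<and> snd p \<le> t (fst p)} (x, u)
     = (indicator {0..t x} u :: real)" if "x \<in> space G" for x u
    using that by (auto simp: indicator_def space_pair_measure)
  moreover have "(\<lambda>x. LBINT u. indicator {p \<in> space (G \<Otimes>\<^sub>M borel). 0 \<le> snd p \<and> snd p \<le> t (fst p)} (x, u) *\<^sub>R d x u)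
     \<in> borel_measurable G" by measurable
  ultimately show ?thesis
    unfolding path_int_def set_lebesgue_integral_def by (simp cong: measurable_cong)
qed

lemma path_int_has_derivative:
  fixes d :: "real \<Rightarrow> real"
  assumes "d \<in> borel_measurable borel" "\<And>u. \<bar>d u\<bar> \<le> B" "0 < r" "isCont d r"
  shows "(path_int d has_real_derivative d r) (at r)"
proof -
  have "((\<lambda>u. integral {0..u} d) has_vector_derivative d r) (at r within ({0..r+1} - {}))"
    by (rule integral_has_vector_derivative_continuous_at)
      (use assms set_borel_integral_eq_integral(1)[OF set_integrable_bounded_Icc[OF assms(1,2)]]
        in \<open>auto intro: continuous_within_subset\<close>)
  then have "((\<lambda>u. integral {0..u} d) has_real_derivative d r) (at r within {0..r+1})"
    by (simp add: has_real_derivative_iff_has_vector_derivative)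
  moreover have "at r within {0..r+1} = at r"
    using assms(3) by (intro at_within_interior) simp
  ultimately show ?thesis
    by (simp add: path_int_eq_integral[OF assms(1,2), abs_def])
qed

text \<open>The rescaled position \<open>Z\<close> of the overview. The sign of
  \<open>\<kappa>\<close> is the initial direction.\<close>

definition pos :: "real \<Rightarrow> real \<Rightarrow> (real \<Rightarrow> real) \<Rightarrow> real \<Rightarrow> real" where
  "pos z \<kappa> d s = z + \<kappa> * path_int d s"

definition occ :: "real \<Rightarrow> real \<Rightarrow> (real \<Rightarrow> real) \<Rightarrow> real \<Rightarrow> real" where
  "occ z \<kappa> d = path_int (\<lambda>s. indicator {0<..} (pos z \<kappa> d s))"

lemma pos_measurable [measurable (raw)]:
  assumes [measurable]: "(\<lambda>(x, s). d x s) \<in> borel_measurable (G \<Otimes>\<^sub>M borel)"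
    and [measurable]: "t \<in> borel_measurable G"
  shows "(\<lambda>x. pos z \<kappa> (d x) (t x)) \<in> borel_measurable G"
  unfolding pos_def by measurable

lemma occ_measurable [measurable (raw)]:
  assumes d [measurable]: "(\<lambda>(x, s). d x s) \<in> borel_measurable (G \<Otimes>\<^sub>M borel)"
    and [measurable]: "t \<in> borel_measurable G"
  shows "(\<lambda>x. occ z \<kappa> (d x) (t x)) \<in> borel_measurable G"
proof -
  \<comment> \<open>\<open>occ\<close> integrates a quantity that is itself a path integral, so the
    family of paths has to be measurable jointly with a second time variable.\<close>
  have [measurable]: "(\<lambda>(x, u). d (fst x) u) \<in> borel_measurable ((G \<Otimes>\<^sub>M borel) \<Otimes>\<^sub>M borel)"
    using measurable_compose[OF _ d, of "\<lambda>p. (fst (fst p), snd p)" "(G \<Otimes>\<^sub>M borel) \<Otimes>\<^sub>M borel"]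
    by (simp add: case_prod_beta)
  have "(\<lambda>(x, s). indicator {0<..} (pos z \<kappa> (d x) s)) \<in> borel_measurable (G \<Otimes>\<^sub>M borel)"
    unfolding case_prod_beta by measurable
  then show ?thesis unfolding occ_def by measurable
qed

lemma occ_nonneg: "0 \<le> occ z \<kappa> d t"
  unfolding occ_def path_int_def set_lebesgue_integral_def by (intro integral_nonneg_AE) auto

text \<open>The prefix \<open>max 0\<close> keeps the path defined on the whole line.\<close>

definition sgn_path :: "(real \<Rightarrow> nat) \<Rightarrow> real \<Rightarrow> real" where
  "sgn_path n s = (- 1) ^ n (max 0 s)"

abbreviation sgn_of :: "(real \<Rightarrow> 'a \<Rightarrow> nat) \<Rightarrow> 'a \<Rightarrow> real \<Rightarrow> real" where
  "sgn_of N \<omega> \<equiv> sgn_path (\<lambda>s. N s \<omega>)"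

text \<open>One fixed path of the Poisson process, so that everything pathwise becomes deterministic
  calculus. Measurability of the sign is supplied later as a section of its joint
  measurability.\<close>

locale counting_path =
  fixes n :: "real \<Rightarrow> nat"
  assumes mono: "0 \<le> s \<Longrightarrow> s \<le> t \<Longrightarrow> n s \<le> n t"
    and right_cont: "0 \<le> t \<Longrightarrow> continuous (at_right t) n"
    and meas [measurable]: "sgn_path n \<in> borel_measurable borel"
begin

abbreviation "d \<equiv> sgn_path n"

lemma abs_d [simp]: "\<bar>d s\<bar> = 1" by (simp add: sgn_path_def power_abs)

lemma abs_d_le: "\<bar>d s\<bar> \<le> 1" by simp

lemma pos_continuous: "continuous_on UNIV (pos z \<kappa> d)"
  unfolding pos_def by (intro continuous_intros path_int_continuous[OF meas abs_d_le])

lemma pos_meas [measurable]: "pos z \<kappa> d \<in> borel_measurable borel"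
  by (intro borel_measurable_continuous_onI pos_continuous)

lemma occ_continuous: "continuous_on UNIV (occ z \<kappa> d)"
  unfolding occ_def by (rule path_int_continuous[where B=1]) (auto simp: indicator_def)

lemma occ_meas [measurable]: "occ z \<kappa> d \<in> borel_measurable borel"
  by (intro borel_measurable_continuous_onI occ_continuous)

text \<open>Up to time \<open>t\<close> the path takes at most \<open>n t + 1\<close> values. On
  each level set the sign is constant, so the position is strictly monotone and has at most one zero
  there. By right continuity only the left end of a level set can be a discontinuity of the
  sign.\<close>

lemma finite_exceptions:
  assumes "\<kappa> \<noteq> 0"
  shows "\<exists>S. finite S \<and> (\<forall>r\<in>{0<..<t} - S. isCont d r \<and> pos z \<kappa> d r \<noteq> 0)"
proof -
  define E where "E k = {r \<in> {0..t}. n r = k}" for k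
  define S where "S = (\<Union>k\<le>n t. insert (Inf (E k)) {r \<in> E k. pos z \<kappa> d r = 0})"
  have zeros: "r = r'" if "r \<in> E k" "r' \<in> E k" "pos z \<kappa> d r = 0" "pos z \<kappa> d r' = 0" "r \<le> r'" for k r r'
  proof (rule ccontr)
    assume "r \<noteq> r'"
    have "path_int d r' - path_int d r = (LBINT u:{r..r'}. d u)"
      using that by (intro path_int_diff[OF meas abs_d_le]) (auto simp: E_def)
    also have "\<dots> = (LBINT u:{r..r'}. (-1)^k)"
    proof (rule set_lebesgue_integral_cong)
      show "\<forall>u. u \<in> {r..r'} \<longrightarrow> d u = (-1) ^ k"
      proof (intro allI impI)
        fix u assume u: "u \<in> {r..r'}"
        then have "n u = k" using mono[of r u] mono[of u r'] that by (auto simp: E_def)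
        then show "d u = (-1)^k" using u that by (simp add: sgn_path_def E_def max_def)
      qed
    qed simp
    also have "\<dots> = (-1)^k * (r' - r)" using that by (simp add: set_lebesgue_integral_def)
    finally have "path_int d r' - path_int d r \<noteq> 0" using \<open>r \<noteq> r'\<close> by simp
    moreover have "\<kappa> * (path_int d r' - path_int d r) = 0"
      using that(3,4) unfolding pos_def right_diff_distrib by linarith
    ultimately show False using assms by simp
  qed
  have "finite {r \<in> E k. pos z \<kappa> d r = 0}" for k
  proof (cases "{r \<in> E k. pos z \<kappa> d r = 0} = {}")
    case False
    then obtain r where r: "r \<in> E k" "pos z \<kappa> d r = 0" by auto
    have "{r \<in> E k. pos z \<kappa> d r = 0} \<subseteq> {r}"
    proof
      fix s assume s: "s \<in> {r \<in> E k. pos z \<kappa> d r = 0}"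
      then show "s \<in> {r}"
        using zeros[of r k s] zeros[of s k r] r linear[of r s] by auto
    qed
    then show ?thesis by (rule finite_subset) simp
  qed (simp only: finite.emptyI)
  then have "finite S" unfolding S_def by (intro finite_UN_I finite_atMost finite.insertI)
  moreover have "isCont d r \<and> pos z \<kappa> d r \<noteq> 0" if r: "r \<in> {0<..<t} - S" for r
  proof -
    have k: "n r \<le> n t" using r by (intro mono) auto
    have rE: "r \<in> E (n r)" using r by (simp add: E_def)
    have ne: "pos z \<kappa> d r \<noteq> 0" "r \<noteq> Inf (E (n r))" using r k rE by (auto simp: S_def)
    have bdd: "bdd_below (E (n r))" by (auto simp: E_def intro: bdd_belowI[of _ 0])
    have "Inf (E (n r)) < r" using cInf_lower[OF rE bdd] ne by simp
    then obtain r1 where r1: "r1 \<in> E (n r)" "r1 < r" using cInf_lessD[of "E (n r)" r] rE by blast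
    \<comment> \<open>For a function with values in a discrete space, right continuity means being
      constant immediately to the right.\<close>
    have "(n \<longlongrightarrow> n r) (at_right r)" using right_cont[of r] r by (simp add: continuous_within)
    then have "eventually (\<lambda>s. n s = n r) (at_right r)" by (simp add: tendsto_discrete)
    then obtain r2 where r2: "r2 > r" "\<And>s. r < s \<Longrightarrow> s < r2 \<Longrightarrow> n s = n r"
      by (auto simp: eventually_at_right_field)
    have c: "d s = d r" if "s \<in> {r1<..<r2}" for s
    proof -
      have "n s = n r"
      proof (cases "s \<le> r")
        case True
        then show ?thesis using mono[of r1 s] mono[of s r] that r1 by (auto simp: E_def)
      qed (use r2 that in auto)
      then show ?thesis using r1 r that by (simp add: sgn_path_def E_def max_def)
    qed
    have "eventually (\<lambda>s. d s = d r) (nhds r)"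
      by (rule eventually_mono[OF eventually_nhds_in_open[of "{r1<..<r2}" r] c])
         (use r1(2) r2(1) in auto)
    then have "isCont d r" by (rule isCont_cong[THEN iffD2]) (rule continuous_const)
    then show ?thesis using ne by simp
  qed
  ultimately show ?thesis by blast
qed

text \<open>The integrand \<open>F\<close> is the derivative of the discounted value of
  \<open>u\<close> along the path. The derivative of \<open>u\<close> may be missing at 0, because
  the lemma is applied to a resolvent \<open>w\<close> and also to its derivative \<open>w'\<close>,
  which has a kink at 0. The exceptional times are finite by
  \<open>finite_exceptions\<close>.\<close>

lemma weighted_path_FTC:
  fixes u u' :: "real \<Rightarrow> real" and z :: real
  assumes \<kappa>: "\<kappa> \<noteq> 0" and t: "0 \<le> t"
    and u: "continuous_on UNIV u" and u': "\<And>y. y \<noteq> 0 \<Longrightarrow> (u has_real_derivative u' y) (at y)"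
    and [measurable]: "u' \<in> borel_measurable borel" and bu': "\<And>y. \<bar>u' y\<bar> \<le> B" and bu: "\<And>y. \<bar>u y\<bar> \<le> B"
    and \<alpha>: "0 \<le> \<alpha>" and \<theta>: "0 \<le> \<theta>"
  defines "E \<equiv> \<lambda>s. exp (- \<alpha> * s - \<theta> * occ z \<kappa> d s)"
  defines "F \<equiv> \<lambda>s. E s * (- (\<alpha> + \<theta> * indicator {0<..} (pos z \<kappa> d s)) * u (pos z \<kappa> d s) + \<kappa> * d s * u' (pos z \<kappa> d s))"
  shows "(LBINT s:{0..t}. F s) = E t * u (pos z \<kappa> d t) - u z"
proof -
  obtain S where S: "finite S" "\<And>r. r \<in> {0<..<t} - S \<Longrightarrow> isCont d r \<and> pos z \<kappa> d r \<noteq> 0"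
    using finite_exceptions[OF \<kappa>, of t z] by (metis (lifting))
  have [measurable]: "u \<in> borel_measurable borel" by (rule borel_measurable_continuous_onI[OF u])
  have "(F has_integral (E t * u (pos z \<kappa> d t) - E 0 * u (pos z \<kappa> d 0))) {0..t}"
  proof (rule fundamental_theorem_of_calculus_interior_strong[OF S(1) t])
    show "continuous_on {0..t} (\<lambda>s. E s * u (pos z \<kappa> d s))"
      unfolding E_def
      by (intro continuous_on_mult continuous_on_exp continuous_on_diff continuous_on_const
          continuous_on_id continuous_on_subset[OF occ_continuous]
          continuous_on_compose2[OF u continuous_on_subset[OF pos_continuous]] subset_UNIV)
    fix r assume r: "r \<in> {0<..<t} - S"
    have D1: "(pos z \<kappa> d has_real_derivative (\<kappa> * d r)) (at r)"
      unfolding pos_def[abs_def] using conjunct1[OF S(2)[OF r]] r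
      by (intro DERIV_add[of "\<lambda>_. z" 0, simplified] DERIV_const DERIV_cmult path_int_has_derivative[OF meas abs_d_le]) simp_all
    have D2: "(occ z \<kappa> d has_real_derivative indicator {0<..} (pos z \<kappa> d r)) (at r)"
      unfolding occ_def
    proof (rule path_int_has_derivative[where B=1])
      \<comment> \<open>At a time when the position is nonzero the indicator of the half-line is
        locally constant, which makes the occupation time differentiable there.\<close>
      have 1: "isCont (indicator {0<..} :: real \<Rightarrow> real) (pos z \<kappa> d r)"
        using S(2)[OF r] by (auto simp: isCont_indicator frontier_def interior_open)
      have 2: "isCont (pos z \<kappa> d) r"
        using pos_continuous by (simp add: continuous_on_eq_continuous_at)
      show "isCont (\<lambda>s. indicator {0<..} (pos z \<kappa> d s) :: real) r"
        by (rule isCont_o2[OF 2 1])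
    qed (use r in \<open>auto simp: indicator_def\<close>)
    have D3: "((\<lambda>s. u (pos z \<kappa> d s)) has_real_derivative (u' (pos z \<kappa> d r) * (\<kappa> * d r))) (at r)"
      using S(2)[OF r] by (intro DERIV_chain2[OF u' D1]) auto
    have "((\<lambda>s. E s * u (pos z \<kappa> d s)) has_real_derivative F r) (at r)"
      unfolding E_def F_def
      by (rule derivative_eq_intros D2 D3 refl)+ (simp add: algebra_simps)
    then show "((\<lambda>s. E s * u (pos z \<kappa> d s)) has_vector_derivative F r) (at r)"
      by (simp add: has_real_derivative_iff_has_vector_derivative)
  qed
  \<comment> \<open>The fundamental theorem gives a gauge integral; boundedness of \<open>F\<close>
    turns it into a Lebesgue integral.\<close>
  moreover have "set_integrable lborel {0..t} F"
  proof -
    have B: "0 \<le> B" using bu[of 0] by simp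
    have "\<bar>F s\<bar> \<le> (\<alpha> + \<theta>) * B + \<bar>\<kappa>\<bar> * B" if "0 \<le> s" for s
    proof -
      have "0 \<le> \<alpha> * s" "0 \<le> \<theta> * occ z \<kappa> d s" using that \<alpha> \<theta> occ_nonneg by simp_all
      then have "- \<alpha> * s - \<theta> * occ z \<kappa> d s \<le> 0" by simp
      then have E: "\<bar>E s\<bar> \<le> 1" by (simp add: E_def)
      have "\<bar>\<alpha> + \<theta> * indicator {0<..} (pos z \<kappa> d s)\<bar> \<le> \<alpha> + \<theta>" using \<alpha> \<theta> by (auto simp: indicator_def)
      then have "\<bar>- (\<alpha> + \<theta> * indicator {0<..} (pos z \<kappa> d s)) * u (pos z \<kappa> d s)\<bar> \<le> (\<alpha> + \<theta>) * B"
        unfolding abs_mult abs_minus_cancel by (rule mult_mono[OF _ bu]) (use \<alpha> \<theta> in auto)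
      moreover have "\<bar>\<kappa> * d s * u' (pos z \<kappa> d s)\<bar> \<le> \<bar>\<kappa>\<bar> * B"
        using bu' by (simp add: abs_mult mult_left_mono)
      ultimately have "\<bar>- (\<alpha> + \<theta> * indicator {0<..} (pos z \<kappa> d s)) * u (pos z \<kappa> d s) + \<kappa> * d s * u' (pos z \<kappa> d s)\<bar>
          \<le> (\<alpha> + \<theta>) * B + \<bar>\<kappa>\<bar> * B" by linarith
      then have "\<bar>F s\<bar> \<le> 1 * ((\<alpha> + \<theta>) * B + \<bar>\<kappa>\<bar> * B)"
        unfolding F_def abs_mult by (intro mult_mono E) simp_all
      then show ?thesis by simp
    qed
    note F_le = this
    have [measurable]: "F \<in> borel_measurable borel" unfolding F_def E_def by measurable
    show ?thesis
      by (rule set_integrable_bound[OF set_integrable_const_Icc[of 0 t "(\<alpha> + \<theta>) * B + \<bar>\<kappa>\<bar> * B"]])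
         (auto simp: set_borel_measurable_def intro!: order_trans[OF F_le abs_ge_self])
  qed
  ultimately have "(LBINT s:{0..t}. F s) = E t * u (pos z \<kappa> d t) - E 0 * u (pos z \<kappa> d 0)"
    using set_borel_integral_eq_integral(2)[of "{0..t}" F] integral_unique[of F _ "{0..t}"] by simp
  then show ?thesis by (simp add: E_def pos_def occ_def)
qed

end

section \<open>Joint measurability and independence of the past\<close>

text \<open>This and the next two lemmas allow a path to be replaced by the path stopped at
  \<open>t\<close>, which is what makes these functionals measurable with respect to the
  past.\<close>

lemma path_int_cong:
  assumes "\<And>u. 0 \<le> u \<Longrightarrow> u \<le> t \<Longrightarrow> d u = d' u"
  shows "path_int d t = path_int d' t"
  unfolding path_int_def by (rule set_lebesgue_integral_cong) (use assms in auto)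

lemma pos_cong:
  assumes "\<And>u. 0 \<le> u \<Longrightarrow> u \<le> t \<Longrightarrow> d u = d' u"
  shows "pos z \<kappa> d t = pos z \<kappa> d' t"
  unfolding pos_def using path_int_cong[OF assms] by simp

lemma occ_cong:
  assumes "\<And>u. 0 \<le> u \<Longrightarrow> u \<le> t \<Longrightarrow> d u = d' u"
  shows "occ z \<kappa> d t = occ z \<kappa> d' t"
  unfolding occ_def
proof (rule path_int_cong)
  fix s assume "0 \<le> s" "s \<le> t"
  then have "pos z \<kappa> d s = pos z \<kappa> d' s" by (intro pos_cong assms) auto
  then show "indicator {0<..} (pos z \<kappa> d s) = (indicator {0<..} (pos z \<kappa> d' s) :: real)" by simp
qed

context poisson_process
begin

abbreviation path :: "'a \<Rightarrow> real \<Rightarrow> real" where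
  "path \<omega> \<equiv> sgn_of N \<omega>"

text \<open>Times are approximated from the right by grid points; right continuity gives
  convergence, and each approximation uses only countably many times. The time change
  \<open>\<tau>\<close> and the sigma-algebra \<open>G\<close> are left free to cover both the full
  path and the path stopped at \<open>s\<close>, the latter with \<open>G\<close> the past of
  \<open>s\<close>.\<close>

lemma sign_jointly_measurable:
  fixes \<tau> :: "real \<Rightarrow> real"
  assumes sp: "space G = space M"
    and N: "\<And>r. N (\<tau> r) \<in> measurable G (count_space UNIV)"
    and \<tau>: "mono \<tau>" "continuous_on UNIV \<tau>" "\<And>r. 0 \<le> \<tau> r"
  shows "(\<lambda>(\<omega>, s). (-1) ^ N (\<tau> s) \<omega> :: real) \<in> borel_measurable (G \<Otimes>\<^sub>M borel)"
proof -
  \<comment> \<open>The grid point of mesh \<open>1 / Suc n\<close> strictly to the right of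
    \<open>s\<close>.\<close>
  define r where "r = (\<lambda>n (s::real). (of_int \<lfloor>s * of_nat (Suc n)\<rfloor> + 1) / real (Suc n))"
  have r_gt: "s < r n s" for n and s :: real
  proof -
    have "s * real (Suc n) < of_int \<lfloor>s * of_nat (Suc n)\<rfloor> + 1" by linarith
    then show ?thesis by (simp add: r_def field_simps)
  qed
  have r_le: "r n s \<le> s + inverse (real (Suc n))" for n and s :: real
  proof -
    have "r n s \<le> (s * real (Suc n) + 1) / real (Suc n)"
      unfolding r_def by (intro divide_right_mono) linarith+
    also have "\<dots> = s + inverse (real (Suc n))" by (simp add: field_simps del: of_nat_Suc)
    finally show ?thesis .
  qed
  have r_lim: "(\<lambda>n. r n s) \<longlonglongrightarrow> s" for s :: real
  proof (rule tendsto_sandwich[of "\<lambda>_. s" _ _ "\<lambda>n. s + inverse (real (Suc n))"])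
    show "(\<lambda>n. s + inverse (real (Suc n))) \<longlonglongrightarrow> s"
      using LIMSEQ_inverse_real_of_nat_add[of s] by simp
  qed (use less_imp_le[OF r_gt] r_le in auto)
  show ?thesis
  proof (rule borel_measurable_LIMSEQ_real)
    fix p assume "p \<in> space (G \<Otimes>\<^sub>M (borel :: real measure))"
    then obtain \<omega> s where p: "p = (\<omega>, s)" "\<omega> \<in> space M" by (auto simp: space_pair_measure sp)
    have "((\<lambda>u. N u \<omega>) \<longlongrightarrow> N (\<tau> s) \<omega>) (at_right (\<tau> s))"
      using N_right_continuous[OF p(2) \<tau>(3)] by (simp add: continuous_within)
    then have "eventually (\<lambda>u. N u \<omega> = N (\<tau> s) \<omega>) (at_right (\<tau> s))" by (simp add: tendsto_discrete)
    then obtain b where b: "b > \<tau> s" "\<And>u. \<tau> s < u \<Longrightarrow> u < b \<Longrightarrow> N u \<omega> = N (\<tau> s) \<omega>"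
      by (auto simp: eventually_at_right_field)
    have "isCont \<tau> s" using \<tau>(2) by (simp add: continuous_on_eq_continuous_at)
    then have "(\<lambda>n. \<tau> (r n s)) \<longlonglongrightarrow> \<tau> s" by (rule isCont_tendsto_compose[OF _ r_lim])
    then have "eventually (\<lambda>n. \<tau> (r n s) < b) sequentially" using b(1) by (rule order_tendstoD)
    then have "eventually (\<lambda>n. (- 1) ^ N (\<tau> (r n s)) \<omega> = ((- 1) ^ N (\<tau> s) \<omega> :: real)) sequentially"
    proof eventually_elim
      case (elim n)
      have "\<tau> s \<le> \<tau> (r n s)" using \<tau>(1) r_gt[of s n] by (auto simp: mono_def)
      \<comment> \<open>Where \<open>\<tau>\<close> is flat the approximating time equals
        \<open>\<tau> s\<close> itself, a case outside the punctured right neighbourhood.\<close>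
      then show ?case using b(2)[OF _ elim] by (cases "\<tau> s = \<tau> (r n s)") auto
    qed
    then show "(\<lambda>n. (\<lambda>(\<omega>, s). (- 1) ^ N (\<tau> (r n s)) \<omega>) p) \<longlonglongrightarrow> (\<lambda>(\<omega>, s). (- 1) ^ N (\<tau> s) \<omega> :: real) p"
      unfolding p by (auto intro: tendsto_eventually)
  next
    fix n
    \<comment> \<open>The approximation depends on time only through an integer-valued measurable
      index, so measurability follows by a countable case distinction.\<close>
    define g where "g = (\<lambda>p :: 'a \<times> real. \<lfloor>snd p * of_nat (Suc n)\<rfloor>)"
    have g: "g \<in> measurable (G \<Otimes>\<^sub>M borel) (count_space UNIV)" unfolding g_def by measurable
    have "(\<lambda>p. (- 1) ^ N (\<tau> ((of_int i + 1) / real (Suc n))) (fst p) :: real) \<in> borel_measurable (G \<Otimes>\<^sub>M borel)" for i :: int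
      using measurable_compose[OF measurable_compose[OF measurable_fst N[of "(of_int i + 1) / real (Suc n)"]],
          where g="\<lambda>k. (-1) ^ k :: real" and L=borel] by simp
    from measurable_compose_countable[OF this g]
    show "(\<lambda>(\<omega>, s). (- 1) ^ N (\<tau> (r n s)) \<omega> :: real) \<in> borel_measurable (G \<Otimes>\<^sub>M borel)"
      by (simp add: g_def r_def case_prod_beta)
  qed
qed

lemma path_measurable [measurable]: "(\<lambda>(\<omega>, s). path \<omega> s) \<in> borel_measurable (M \<Otimes>\<^sub>M borel)"
  unfolding sgn_path_def
  by (rule sign_jointly_measurable) (auto intro!: monoI continuous_intros N_measurable)

lemma path_sections_measurable:
  assumes "\<omega> \<in> space M"
  shows "path \<omega> \<in> borel_measurable borel"
  using measurable_compose[OF measurable_Pair1'[OF assms] path_measurable] by simp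

lemma counting_path: "\<omega> \<in> space M \<Longrightarrow> counting_path (\<lambda>s. N s \<omega>)"
  by (simp add: counting_path_def N_mono N_right_continuous path_sections_measurable)

section \<open>The past of the process and its independence of later increments\<close>

definition cylinder :: "real set \<Rightarrow> (real \<Rightarrow> nat set) \<Rightarrow> 'a set" where
  "cylinder R B = {\<omega> \<in> space M. \<forall>r\<in>R. N r \<omega> \<in> B r}"

definition cylinders :: "real \<Rightarrow> 'a set set" where
  "cylinders s = {cylinder R B | R B. finite R \<and> R \<subseteq> {0..s}}"

lemma cylinder_events: "finite R \<Longrightarrow> R \<subseteq> {0..s} \<Longrightarrow> cylinder R B \<in> events"
proof -
  assume R: "finite R" "R \<subseteq> {0..s}"
  have "{\<omega> \<in> space M. N r \<omega> \<in> B r} \<in> events" if "r \<in> R" for r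
    using measurable_sets[OF N_measurable[of r], of "B r"] that R
    by (auto simp: vimage_def Int_def conj_commute)
  then show "cylinder R B \<in> events"
    unfolding cylinder_def by (intro sets.sets_Collect_finite_All R(1)) auto
qed

lemma Int_stable_cylinders: "Int_stable (cylinders s)"
proof (rule Int_stableI)
  fix a b assume "a \<in> cylinders s" "b \<in> cylinders s"
  then obtain R B R' B' where "a = cylinder R B" "b = cylinder R' B'" "finite R" "finite R'" "R \<subseteq> {0..s}" "R' \<subseteq> {0..s}"
    by (auto simp: cylinders_def)
  moreover have "cylinder R B \<inter> cylinder R' B' =
    cylinder (R \<union> R') (\<lambda>r. {k. (r \<in> R \<longrightarrow> k \<in> B r) \<and> (r \<in> R' \<longrightarrow> k \<in> B' r)})"
    by (auto simp: cylinder_def)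
  ultimately show "a \<inter> b \<in> cylinders s"
    unfolding cylinders_def by (metis (mono_tags, lifting) Un_subset_iff finite_UnI mem_Collect_eq)
qed

text \<open>A cylinder event is an event about the increments between consecutive observation times
  up to \<open>s\<close>. With the increment over \<open>[s, t]\<close> appended as the last one,
  independence of disjoint groups of increments gives the product.\<close>

lemma cylinder_indep_increment:
  assumes st: "0 \<le> s" "s \<le> t" and R: "finite R" "R \<subseteq> {0..s}"
  shows "prob (cylinder R B \<inter> ((\<lambda>\<omega>. N t \<omega> - N s \<omega>) -` C \<inter> space M))
     = prob (cylinder R B) * prob ((\<lambda>\<omega>. N t \<omega> - N s \<omega>) -` C \<inter> space M)"
proof -
  \<comment> \<open>The time 0 makes every value a sum of increments, and the time \<open>s\<close>
    makes the appended increment start at \<open>s\<close>.\<close>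
  define L where "L = sorted_list_of_set (insert 0 (insert s R))"
  have setL: "set L = insert 0 (insert s R)" and sL: "sorted L" using R by (simp_all add: L_def del: sorted_list_of_set_insert_remove)
  define n where "n = length L - 1"
  have len: "length L = Suc n" using setL by (cases L) (auto simp: n_def)
  have Lmono: "L ! i \<le> L ! j" if "i \<le> j" "j \<le> n" for i j
    using sorted_nth_mono[OF sL] that len by simp
  have L0: "L ! 0 = 0"
  proof -
    obtain i where "i \<le> n" "L ! i = 0" using setL len by (metis in_set_conv_nth insertI1 less_Suc_eq_le)
    moreover have "0 \<le> L ! 0" using nth_mem[of 0 L] len setL R st by auto
    ultimately show ?thesis using Lmono[of 0 i] by simp
  qed
  have Ln: "L ! n = s"
  proof -
    obtain i where "i \<le> n" "L ! i = s" using setL len by (metis in_set_conv_nth insertI1 insertI2 less_Suc_eq_le)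
    moreover have "L ! n \<le> s" using nth_mem[of n L] len setL R st by auto
    ultimately show ?thesis using Lmono[of i n] by simp
  qed
  \<comment> \<open>The sorted times occupy the indices up to \<open>n\<close>; all later indices
    are sent to \<open>t\<close>, so that increment number \<open>n\<close> is the one over
    \<open>[s, t]\<close>.\<close>
  define tt where "tt i = (if i \<le> n then L ! i else t)" for i
  have tt_mono: "tt i \<le> tt (Suc i)" if "i < Suc n" for i
  proof (cases "i = n")
    case False then show ?thesis using that Lmono[of i "Suc i"] by (simp add: tt_def)
  qed (use Ln st in \<open>simp add: tt_def\<close>)
  have tt_nonneg: "0 \<le> tt i" for i using Lmono[of 0 i] L0 st by (auto simp: tt_def)
  define I where "I i \<omega> = N (tt (Suc i)) \<omega> - N (tt i) \<omega>" for i \<omega>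
  have ind: "indep_vars (\<lambda>_. count_space UNIV) I {..<Suc n}"
    unfolding I_def using tt_mono tt_nonneg by (intro N_indep_increments) auto
  \<comment> \<open>Monotone paths are used here: the truncated differences telescope only because
    they are true differences.\<close>
  have tele: "N (tt i) \<omega> = (\<Sum>l<i. I l \<omega>)" if "i \<le> n" "\<omega> \<in> space M" for i \<omega>
    using that(1)
  proof (induction i)
    case 0 then show ?case using N_zero that L0 by (simp add: tt_def)
  next
    case (Suc i)
    have "N (tt i) \<omega> \<le> N (tt (Suc i)) \<omega>" using Suc that tt_mono tt_nonneg by (intro N_mono) auto
    then show ?case using Suc by (simp add: I_def)
  qed
  have "\<forall>r\<in>R. \<exists>i\<le>n. r = tt i"
  proof
    fix r assume "r \<in> R"
    then have "r \<in> set L" using setL by simp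
    then show "\<exists>i\<le>n. r = tt i" using len by (auto simp: in_set_conv_nth tt_def less_Suc_eq_le)
  qed
  then obtain idx where idx: "\<And>r. r \<in> R \<Longrightarrow> idx r \<le> n \<and> r = tt (idx r)" by metis
  \<comment> \<open>The two events are rewritten as sets of increment vectors, one over the indices
    below \<open>n\<close> and one over the index \<open>n\<close>.\<close>
  define XA where "XA = {x \<in> PiE {..<n} (\<lambda>_. UNIV). \<forall>r\<in>R. (\<Sum>l<idx r. x l) \<in> B r}"
  define XB where "XB = {x \<in> PiE {n} (\<lambda>_. UNIV). x n \<in> C}"
  let ?P = "\<lambda>A. PiM A (\<lambda>_. count_space UNIV :: nat measure)"
  have "indep_var (?P {..<n}) (\<lambda>\<omega>. \<lambda>i\<in>{..<n}. I i \<omega>) (?P {n}) (\<lambda>\<omega>. \<lambda>i\<in>{n}. I i \<omega>)"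
    by (rule indep_var_restrict[OF ind]) auto
  moreover have "XA \<in> sets (?P {..<n})" "XB \<in> sets (?P {n})"
    by (auto simp: count_space_PiM_finite XA_def XB_def)
  ultimately have "prob ((\<lambda>\<omega>. (\<lambda>i\<in>{..<n}. I i \<omega>, \<lambda>i\<in>{n}. I i \<omega>)) -` (XA \<times> XB) \<inter> space M)
    = prob ((\<lambda>\<omega>. \<lambda>i\<in>{..<n}. I i \<omega>) -` XA \<inter> space M) * prob ((\<lambda>\<omega>. \<lambda>i\<in>{n}. I i \<omega>) -` XB \<inter> space M)"
    by (rule indep_varD)
  moreover have "(\<lambda>\<omega>. \<lambda>i\<in>{..<n}. I i \<omega>) -` XA \<inter> space M = cylinder R B"
  proof -
    have "(\<Sum>l<idx r. (\<lambda>i\<in>{..<n}. I i \<omega>) l) = N r \<omega>" if "r \<in> R" "\<omega> \<in> space M" for r \<omega>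
    proof -
      have "(\<Sum>l<idx r. (\<lambda>i\<in>{..<n}. I i \<omega>) l) = (\<Sum>l<idx r. I l \<omega>)"
        using idx[OF that(1)] by (intro sum.cong) auto
      then show ?thesis using tele[of "idx r" \<omega>] idx[OF that(1)] that(2) by simp
    qed
    then show ?thesis by (auto simp: XA_def cylinder_def)
  qed
  moreover have "(\<lambda>\<omega>. \<lambda>i\<in>{n}. I i \<omega>) -` XB \<inter> space M = (\<lambda>\<omega>. N t \<omega> - N s \<omega>) -` C \<inter> space M"
    using Ln by (auto simp: XB_def I_def tt_def)
  moreover have "(\<lambda>\<omega>. (\<lambda>i\<in>{..<n}. I i \<omega>, \<lambda>i\<in>{n}. I i \<omega>)) -` (XA \<times> XB) \<inter> space M
      = ((\<lambda>\<omega>. \<lambda>i\<in>{..<n}. I i \<omega>) -` XA \<inter> space M) \<inter> ((\<lambda>\<omega>. \<lambda>i\<in>{n}. I i \<omega>) -` XB \<inter> space M)"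
    by auto
  ultimately show ?thesis by simp
qed

definition past :: "real \<Rightarrow> 'a measure" where
  "past s = sigma (space M) (cylinders s)"

lemma cylinders_subset: "cylinders s \<subseteq> Pow (space M)"
  by (auto simp: cylinders_def cylinder_def)

lemma space_past [simp]: "space (past s) = space M"
  by (simp add: past_def cylinders_subset space_measure_of)

lemma sets_past: "sets (past s) = sigma_sets (space M) (cylinders s)"
  by (simp add: past_def cylinders_subset)

lemma N_past_measurable: "0 \<le> r \<Longrightarrow> r \<le> s \<Longrightarrow> N r \<in> measurable (past s) (count_space UNIV)"
proof (rule measurableI)
  fix B assume "0 \<le> r" "r \<le> s"
  then have "cylinder {r} (\<lambda>_. B) \<in> cylinders s" by (auto simp: cylinders_def)
  moreover have "cylinder {r} (\<lambda>_. B) = N r -` B \<inter> space (past s)" by (auto simp: cylinder_def)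
  ultimately show "N r -` B \<inter> space (past s) \<in> sets (past s)"
    by (auto simp: sets_past)
qed simp

lemma past_measurable_events: "F \<in> borel_measurable (past s) \<Longrightarrow> F \<in> borel_measurable M"
proof (rule measurable_from_subalg[of M "past s"])
  have "cylinders s \<subseteq> events" by (auto simp: cylinders_def cylinder_events)
  then have "sigma_sets (space M) (cylinders s) \<subseteq> events" by (rule sets.sigma_sets_subset)
  then show "subalgebra M (past s)" by (simp add: subalgebra_def sets_past)
qed

text \<open>Cylinder events and increment events are both stable under intersection, so their
  independence extends to the generated sigma-algebras.\<close>

lemma past_indep_increment:
  assumes st: "0 \<le> s" "s \<le> t" and F: "F \<in> borel_measurable (past s)"
  shows "indep_var borel F borel (\<lambda>\<omega>. h (N t \<omega> - N s \<omega>))"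
proof -
  let ?I = "\<lambda>\<omega>. N t \<omega> - N s \<omega>"
  let ?C = "{?I -` C \<inter> space M | C. True}"
  have I [measurable]: "?I \<in> measurable M (count_space UNIV)"
    using N_measurable[of s] N_measurable[of t] st by simp
  have "indep_set (cylinders s) ?C"
    unfolding indep_sets2_eq
  proof (intro conjI ballI)
    show "cylinders s \<subseteq> events" by (auto simp: cylinders_def cylinder_events)
    show "?C \<subseteq> events" using measurable_sets[OF I] by auto
    fix a b assume "a \<in> cylinders s" "b \<in> ?C"
    then show "prob (a \<inter> b) = prob a * prob b"
      using cylinder_indep_increment[OF st] by (auto simp: cylinders_def)
  qed
  moreover have "Int_stable ?C"
  proof (rule Int_stableI)
    fix a b assume "a \<in> ?C" "b \<in> ?C"
    then obtain C D where "a = ?I -` C \<inter> space M" "b = ?I -` D \<inter> space M" by auto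
    then have "a \<inter> b = ?I -` (C \<inter> D) \<inter> space M" by auto
    then show "a \<inter> b \<in> ?C" by blast
  qed
  ultimately have ind: "indep_set (sigma_sets (space M) (cylinders s)) (sigma_sets (space M) ?C)"
    using Int_stable_cylinders by (intro indep_set_sigma_sets)
  have F1: "sigma_sets (space M) {F -` A \<inter> space M |A. A \<in> sets borel} \<subseteq> sigma_sets (space M) (cylinders s)"
    using measurable_sets[OF F] by (intro sigma_sets_mono) (auto simp: sets_past)
  have "(\<lambda>\<omega>. h (?I \<omega>)) -` A \<inter> space M = ?I -` (h -` A) \<inter> space M" for A by auto
  then have H1: "sigma_sets (space M) {(\<lambda>\<omega>. h (?I \<omega>)) -` A \<inter> space M |A. A \<in> sets borel} \<subseteq> sigma_sets (space M) ?C"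
    by (intro sigma_sets_mono subsetI sigma_sets.Basic) blast
  have "random_variable borel (\<lambda>\<omega>. h (?I \<omega>))"
    by (rule measurable_compose[OF I]) simp
  with past_measurable_events[OF F] show ?thesis
    unfolding indep_var_eq using ind F1 H1 unfolding indep_sets2_eq by blast
qed

section \<open>Exponential decay of the expected sign\<close>

lemma expectation_alternating_poisson:
  assumes "0 < m"
  shows "measure_pmf.expectation (poisson_pmf m) (\<lambda>k. (-1) ^ k) = exp (- 2 * m)"
proof -
  \<comment> \<open>The alternating sign moves into the base of the power: the weights become the
    exponential series at \<open>- m\<close>, and the normalisation contributes a second factor
    \<open>exp (- m)\<close>.\<close>
  have eq: "(\<lambda>k. pmf (poisson_pmf m) k *\<^sub>R (-1) ^ k) = (\<lambda>k. exp (- m) * ((- m) ^ k /\<^sub>R fact k))"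
    using assms by (auto simp: fun_eq_iff pmf_poisson[OF assms] power_minus' field_simps power_minus[of m])
  have s: "(\<lambda>k. exp (- m) * ((- m) ^ k /\<^sub>R fact k)) sums (exp (- m) * exp (- m))"
    by (intro sums_mult exp_converges)
  have "summable (\<lambda>k. norm (exp (- m) * ((- m) ^ k /\<^sub>R fact k)))"
    unfolding norm_mult by (intro summable_mult summable_norm_exp)
  then have "integrable (count_space UNIV) (\<lambda>k. exp (- m) * ((- m) ^ k /\<^sub>R fact k))"
    by (subst integrable_count_space_nat_iff)
  then have "(\<integral>k. exp (- m) * ((- m) ^ k /\<^sub>R fact k) \<partial>count_space UNIV) = exp (- m) * exp (- m)"
    using sums_integral_count_space_nat s sums_unique2 by blast
  moreover have "measure_pmf.expectation (poisson_pmf m) (\<lambda>k. (-1) ^ k :: real)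
     = (\<integral>k. pmf (poisson_pmf m) k *\<^sub>R (-1) ^ k \<partial>count_space UNIV)"
    unfolding measure_pmf_eq_density by (rule integral_density) auto
  ultimately show ?thesis by (simp only: eq flip: exp_add) simp
qed

lemma expectation_alternating_increment:
  assumes st: "0 \<le> s" "s \<le> t"
  shows "expectation (\<lambda>\<omega>. (-1) ^ (N t \<omega> - N s \<omega>)) = exp (- 2 * rate * (t - s))"
proof (cases "s = t")
  case True
  then show ?thesis by (simp add: prob_space)
next
  case False
  have [measurable]: "(\<lambda>\<omega>. N t \<omega> - N s \<omega>) \<in> measurable M (count_space UNIV)"
    using N_measurable[of s] N_measurable[of t] st by simp
  have "expectation (\<lambda>\<omega>. (-1) ^ (N t \<omega> - N s \<omega>))
      = integral\<^sup>L (distr M (count_space UNIV) (\<lambda>\<omega>. N t \<omega> - N s \<omega>)) (\<lambda>k. (-1) ^ k :: real)"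
    by (rule integral_distr[symmetric]) auto
  also have "\<dots> = exp (- 2 * (rate * (t - s)))"
  proof -
    have "s < t" using False st by simp
    then show ?thesis
      unfolding N_increment[OF st(1) \<open>s < t\<close>]
      by (intro expectation_alternating_poisson) (simp add: rate_pos)
  qed
  finally show ?thesis by (simp add: mult.assoc)
qed

lemma path_past_measurable: "0 \<le> r \<Longrightarrow> r \<le> s \<Longrightarrow> (\<lambda>\<omega>. path \<omega> r) \<in> borel_measurable (past s)"
  unfolding sgn_path_def by (rule measurable_compose[OF N_past_measurable]) (auto simp: max_def)

lemma abs_path [simp]: "\<bar>path \<omega> s\<bar> = 1" by (simp add: sgn_path_def power_abs)

lemma path_sq [simp]: "path \<omega> s * path \<omega> s = 1"
  by (simp add: sgn_path_def flip: power_mult_distrib)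

text \<open>The sign at \<open>t\<close> is the sign at \<open>s\<close> times the parity of the
  increment in between, and that parity is independent of the past of \<open>s\<close>.\<close>

lemma expectation_times_path:
  assumes st: "0 \<le> s" "s \<le> t" and F: "F \<in> borel_measurable (past s)"
    and B: "\<And>\<omega>. \<omega> \<in> space M \<Longrightarrow> \<bar>F \<omega>\<bar> \<le> B"
  shows "expectation (\<lambda>\<omega>. F \<omega> * path \<omega> t) = exp (- 2 * rate * (t - s)) * expectation (\<lambda>\<omega>. F \<omega> * path \<omega> s)"
proof -
  let ?X = "\<lambda>\<omega>. F \<omega> * path \<omega> s" and ?Y = "\<lambda>\<omega>. (-1) ^ (N t \<omega> - N s \<omega>) :: real"
  have X: "?X \<in> borel_measurable (past s)"
    using F path_past_measurable[OF st(1) order_refl] by measurable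
  have ind: "indep_var borel ?X borel ?Y" by (rule past_indep_increment[OF st X])
  have "path \<omega> t = path \<omega> s * ?Y \<omega>" if "\<omega> \<in> space M" for \<omega>
    using N_mono[OF that st] st by (simp add: sgn_path_def flip: power_add)
  then have "expectation (\<lambda>\<omega>. F \<omega> * path \<omega> t) = expectation (\<lambda>\<omega>. ?X \<omega> * ?Y \<omega>)"
    by (intro Bochner_Integration.integral_cong) auto
  also have "\<dots> = expectation ?X * expectation ?Y"
  proof (rule indep_var_lebesgue_integral[OF ind])
    show "integrable M ?X"
      by (rule integrable_const_bound[of _ B])
        (use B past_measurable_events[OF X] in \<open>auto simp: abs_mult\<close>)
    show "integrable M ?Y"
      using indep_var_rv2[OF ind] by (intro integrable_const_bound[of _ 1]) (auto simp: power_abs)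
  qed
  finally show ?thesis by (simp add: expectation_alternating_increment[OF st])
qed

text \<open>\<open>pos\<close> and \<open>occ\<close> take a whole path as argument, and the whole
  path is not determined by the past of \<open>s\<close>. The path frozen at \<open>s\<close> is,
  and it gives the same position and occupation time at \<open>s\<close>.\<close>

lemma stopped_path_measurable:
  assumes "0 \<le> s"
  shows "(\<lambda>(\<omega>, u). path \<omega> (min u s)) \<in> borel_measurable (past s \<Otimes>\<^sub>M borel)"
  unfolding sgn_path_def
  by (rule sign_jointly_measurable)
     (use assms in \<open>auto intro!: monoI continuous_intros N_past_measurable\<close>)

lemma pos_past_measurable:
  assumes "0 \<le> s"
  shows "(\<lambda>\<omega>. pos z \<kappa> (path \<omega>) s) \<in> borel_measurable (past s)"
proof -
  have "(\<lambda>\<omega>. pos z \<kappa> (\<lambda>u. path \<omega> (min u s)) s) \<in> borel_measurable (past s)"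
    by (rule pos_measurable[OF stopped_path_measurable[OF assms]]) simp
  moreover have "pos z \<kappa> (\<lambda>u. path \<omega> (min u s)) s = pos z \<kappa> (path \<omega>) s" for \<omega>
    by (rule pos_cong) simp
  ultimately show ?thesis by simp
qed

lemma occ_past_measurable:
  assumes "0 \<le> s"
  shows "(\<lambda>\<omega>. occ z \<kappa> (path \<omega>) s) \<in> borel_measurable (past s)"
proof -
  have "(\<lambda>\<omega>. occ z \<kappa> (\<lambda>u. path \<omega> (min u s)) s) \<in> borel_measurable (past s)"
    by (rule occ_measurable[OF stopped_path_measurable[OF assms]]) simp
  moreover have "occ z \<kappa> (\<lambda>u. path \<omega> (min u s)) s = occ z \<kappa> (path \<omega>) s" for \<omega>
    by (rule occ_cong) simp
  ultimately show ?thesis by simp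
qed

end

section \<open>Exchanging expectations and time integrals\<close>

text \<open>The lower end is kept general because in \<open>limit_transform_laplace\<close> it is
  the hitting time.\<close>

lemma has_bochner_integral_exp_Ici:
  assumes "0 < (\<alpha>::real)"
  shows "has_bochner_integral lborel (\<lambda>s. indicator {u..} s * exp (- \<alpha> * s)) (exp (- \<alpha> * u) / \<alpha>)"
proof (rule has_bochner_integral_nn_integral)
  have "(\<lambda>s. indicator {u..} s * exp (- \<alpha> * s)) = (\<lambda>s. if s \<in> {u..} then exp (- \<alpha> * s) else 0)"
    by auto
  then have "((\<lambda>s. indicator {u..} s * exp (- \<alpha> * s)) has_integral (exp (- \<alpha> * u) / \<alpha>)) UNIV"
    using has_integral_exp_minus_to_infinity[OF assms, of u] by (simp only: has_integral_restrict_UNIV)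
  then show "(\<integral>\<^sup>+ s. ennreal (indicator {u..} s * exp (- \<alpha> * s)) \<partial>lborel) = ennreal (exp (- \<alpha> * u) / \<alpha>)"
    by (intro nn_integral_has_integral_lborel) auto
qed (use assms in auto)

lemma exp_halfline:
  assumes "0 < (\<alpha>::real)"
  shows "set_integrable lborel {0..} (\<lambda>s. exp (- \<alpha> * s))" "(LBINT s:{0..}. exp (- \<alpha> * s)) = 1 / \<alpha>"
  using has_bochner_integral_exp_Ici[OF assms, of 0]
  by (auto simp: has_bochner_integral_iff set_integrable_def set_lebesgue_integral_def)

lemma set_integrable_exp_bound:
  fixes f :: "real \<Rightarrow> real"
  assumes "0 < \<alpha>" and [measurable]: "f \<in> borel_measurable borel" and "\<And>s. 0 \<le> s \<Longrightarrow> \<bar>f s\<bar> \<le> C * exp (- \<alpha> * s)"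
  shows "set_integrable lborel {0..} f" "\<bar>LBINT s:{0..}. f s\<bar> \<le> C / \<alpha>"
proof -
  have I: "set_integrable lborel {0..} (\<lambda>s. C * exp (- \<alpha> * s))"
    using exp_halfline(1)[OF assms(1)] by simp
  then show f: "set_integrable lborel {0..} f"
    by (rule set_integrable_bound)
       (auto simp: set_borel_measurable_def intro!: order_trans[OF assms(3)])
  have "\<bar>LBINT s:{0..}. f s\<bar> \<le> (LBINT s:{0..}. \<bar>f s\<bar>)"
    using set_integral_norm_bound[OF f] by simp
  also have "\<dots> \<le> (LBINT s:{0..}. C * exp (- \<alpha> * s))"
    by (intro set_integral_mono set_integrable_abs f I assms(3)) auto
  also have "\<dots> = C / \<alpha>" by (simp only: set_integral_mult_right exp_halfline(2)[OF assms(1)]) simp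
  finally show "\<bar>LBINT s:{0..}. f s\<bar> \<le> C / \<alpha>" .
qed

lemma (in prob_space) abs_expectation_le:
  assumes "\<And>\<omega>. \<omega> \<in> space M \<Longrightarrow> \<bar>X \<omega>\<bar> \<le> B" "0 \<le> B"
  shows "\<bar>expectation X\<bar> \<le> (B::real)"
proof (cases "integrable M X")
  case True
  have "\<bar>expectation X\<bar> \<le> expectation (\<lambda>\<omega>. \<bar>X \<omega>\<bar>)" using integral_norm_bound[of M X] by simp
  also have "\<dots> \<le> expectation (\<lambda>_. B)" by (rule integral_mono) (use True assms in auto)
  finally show ?thesis by (simp add: prob_space)
\<comment> \<open>A function that is not integrable has integral 0, so the bound holds without an
  integrability hypothesis.\<close>
qed (use assms in \<open>simp add: not_integrable_integral_eq\<close>)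

lemma (in prob_space) Fubini_halfline:
  fixes f :: "'a \<Rightarrow> real \<Rightarrow> real"
  assumes f [measurable]: "(\<lambda>(\<omega>, s). f \<omega> s) \<in> borel_measurable (M \<Otimes>\<^sub>M borel)" and \<alpha>: "0 < \<alpha>"
    and C: "\<And>\<omega> s. \<omega> \<in> space M \<Longrightarrow> 0 \<le> s \<Longrightarrow> \<bar>f \<omega> s\<bar> \<le> C * exp (- \<alpha> * s)"
  shows "set_integrable lborel {0..} (\<lambda>s. expectation (\<lambda>\<omega>. f \<omega> s))"
    and "(LBINT s:{0..}. expectation (\<lambda>\<omega>. f \<omega> s)) = expectation (\<lambda>\<omega>. LBINT s:{0..}. f \<omega> s)"
    and "\<bar>LBINT s:{0..}. expectation (\<lambda>\<omega>. f \<omega> s)\<bar> \<le> C / \<alpha>"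
proof -
  interpret P: pair_sigma_finite M lborel ..
  define g where "g = (\<lambda>\<omega> s. indicator {0..} s * f \<omega> s)"
  obtain \<omega>0 where "\<omega>0 \<in> space M" using not_empty by auto
  from C[OF this order_refl] have C0: "0 \<le> C" by simp
  have f' [measurable]: "f \<omega> \<in> borel_measurable borel" if "\<omega> \<in> space M" for \<omega>
    using measurable_compose[OF measurable_Pair1'[OF that] f] by simp
  have i1: "set_integrable lborel {0..} (f \<omega>)" if "\<omega> \<in> space M" for \<omega>
    by (rule set_integrable_exp_bound(1)[OF \<alpha> f'[OF that] C[OF that]])
  have i2: "\<bar>LBINT s:{0..}. \<bar>f \<omega> s\<bar>\<bar> \<le> C / \<alpha>" if "\<omega> \<in> space M" for \<omega>
    by (rule set_integrable_exp_bound(2)[OF \<alpha>]) (use C[OF that] f'[OF that] in simp_all)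
  have g: "integrable (M \<Otimes>\<^sub>M lborel) (case_prod g)"
  proof (rule P.Fubini_integrable)
    show [measurable]: "case_prod g \<in> borel_measurable (M \<Otimes>\<^sub>M lborel)" unfolding g_def by measurable
    have "\<bar>LBINT s. norm (case_prod g (\<omega>, s))\<bar> \<le> C / \<alpha>" if "\<omega> \<in> space M" for \<omega>
      using i2[OF that] by (simp add: g_def abs_mult set_lebesgue_integral_def)
    then show "integrable M (\<lambda>\<omega>. LBINT s. norm (case_prod g (\<omega>, s)))"
      by (intro integrable_const_bound[of _ "C / \<alpha>"]) auto
    show "AE \<omega> in M. integrable lborel (\<lambda>s. case_prod g (\<omega>, s))"
      using i1 by (auto simp: g_def set_integrable_def)
  qed
  have eq: "expectation (\<lambda>\<omega>. g \<omega> s) = indicator {0..} s * expectation (\<lambda>\<omega>. f \<omega> s)" for s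
    by (simp add: g_def)
  have "integrable lborel (\<lambda>s. expectation (\<lambda>\<omega>. g \<omega> s))"
    using P.integrable_snd[OF g] .
  then show 1: "set_integrable lborel {0..} (\<lambda>s. expectation (\<lambda>\<omega>. f \<omega> s))"
    by (simp add: eq set_integrable_def)
  have "(LBINT s. expectation (\<lambda>\<omega>. g \<omega> s)) = expectation (\<lambda>\<omega>. LBINT s. g \<omega> s)"
    by (rule P.Fubini_integral[OF g])
  then show 2: "(LBINT s:{0..}. expectation (\<lambda>\<omega>. f \<omega> s)) = expectation (\<lambda>\<omega>. LBINT s:{0..}. f \<omega> s)"
    by (simp add: eq) (simp add: g_def set_lebesgue_integral_def)
  show "\<bar>LBINT s:{0..}. expectation (\<lambda>\<omega>. f \<omega> s)\<bar> \<le> C / \<alpha>"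
    unfolding 2 using set_integrable_exp_bound(2)[OF \<alpha> f' C] C0 \<alpha>
    by (intro abs_expectation_le) auto
qed

lemma (in prob_space) Fubini_Icc:
  fixes f :: "'a \<Rightarrow> real \<Rightarrow> real"
  assumes f [measurable]: "(\<lambda>(\<omega>, s). f \<omega> s) \<in> borel_measurable (M \<Otimes>\<^sub>M borel)"
    and C: "\<And>\<omega> s. \<omega> \<in> space M \<Longrightarrow> 0 \<le> s \<Longrightarrow> \<bar>f \<omega> s\<bar> \<le> C"
  shows "(LBINT s:{0..t}. expectation (\<lambda>\<omega>. f \<omega> s)) = expectation (\<lambda>\<omega>. LBINT s:{0..t}. f \<omega> s)"
proof -
  let ?f = "\<lambda>\<omega> s. indicator {..t} s * f \<omega> s"
  \<comment> \<open>A bounded integrand cut off at \<open>t\<close> is dominated by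
    \<open>C * exp t * exp (- s)\<close>, which reduces a bounded interval to the half-line
    version.\<close>
  have "\<bar>?f \<omega> s\<bar> \<le> C * exp t * exp (- 1 * s)" if "\<omega> \<in> space M" "0 \<le> s" for \<omega> s
  proof (cases "s \<le> t")
    case True
    have "C \<ge> 0" using C[OF that] by linarith
    then have "C * 1 \<le> C * exp (t - s)" using True by (intro mult_left_mono) auto
    moreover have "C * exp t * exp (- 1 * s) = C * exp (t - s)"
      by (simp add: exp_diff exp_minus divide_inverse)
    moreover have "?f \<omega> s = f \<omega> s" using True by simp
    ultimately show ?thesis using C[OF that] by linarith
  next
    case False
    have "C \<ge> 0" using C[OF that] by linarith
    then show ?thesis using False by simp
  qed
  then have "(LBINT s:{0..}. expectation (\<lambda>\<omega>. ?f \<omega> s)) = expectation (\<lambda>\<omega>. LBINT s:{0..}. ?f \<omega> s)"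
    by (intro Fubini_halfline(2)[where \<alpha>=1 and C="C * exp t"]) auto
  moreover have "(LBINT s:{0..}. indicator {..t} s * h s) = (LBINT s:{0..t}. h s)" for h :: "real \<Rightarrow> real"
    unfolding set_lebesgue_integral_def by (rule Bochner_Integration.integral_cong) (auto simp: indicator_def)
  ultimately show ?thesis by simp
qed

text \<open>The inner integral convolves the source \<open>k\<close> with an exponential kernel of
  total mass \<open>1 / \<mu>\<close>; by Fubini the total mass factors out. It is needed for the
  variation of constants formula with \<open>\<mu> = 2 * rate\<close>.\<close>

lemma exp_convolution_integral:
  fixes k :: "real \<Rightarrow> real"
  assumes [measurable]: "k \<in> borel_measurable borel" and k: "set_integrable lborel {0..} k" and \<mu>: "0 < \<mu>"
  shows "set_integrable lborel {0..} (\<lambda>t. LBINT s:{0..t}. exp (- \<mu> * (t - s)) * k s)"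
    and "(LBINT t:{0..}. LBINT s:{0..t}. exp (- \<mu> * (t - s)) * k s) = (LBINT s:{0..}. k s) / \<mu>"
proof -
  define p where "p = (\<lambda>r. indicator {0..} r * exp (- \<mu> * r))"
  define k0 where "k0 = (\<lambda>s. indicator {0..} s * k s)"
  have [measurable]: "p \<in> borel_measurable borel" "k0 \<in> borel_measurable borel"
    unfolding p_def k0_def by measurable
  have pnn: "0 \<le> p r" for r by (simp add: p_def)
  have ip: "integrable lborel p" "(\<integral>r. p r \<partial>lborel) = 1 / \<mu>"
    using has_bochner_integral_exp_Ici[OF \<mu>, of 0] by (auto simp: has_bochner_integral_iff p_def)
  have ip': "integrable lborel (\<lambda>t. p (t - s))" "(\<integral>t. p (t - s) \<partial>lborel) = 1 / \<mu>" for s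
    using lborel_integrable_real_affine[OF ip(1), of 1 "- s"] lborel_integral_real_affine[of 1 p "- s"] ip(2)
    by (simp_all add: algebra_simps)
  have ik: "integrable lborel k0" using k by (simp add: k0_def set_integrable_def)
  have int: "integrable (lborel \<Otimes>\<^sub>M lborel) (\<lambda>(s, t). p (t - s) * k0 s)"
  proof (rule lborel_pair.Fubini_integrable)
    show "(\<lambda>(s, t). p (t - s) * k0 s) \<in> borel_measurable (lborel \<Otimes>\<^sub>M lborel)" by measurable
    show "AE s in lborel. integrable lborel (\<lambda>t. case (s, t) of (s, t) \<Rightarrow> p (t - s) * k0 s)"
      using ip' by simp
    have "(LBINT t. norm (p (t - s) * k0 s)) = \<bar>k0 s\<bar> / \<mu>" for s
      using ip'(2)[of s] pnn by (simp add: abs_mult)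
    then show "integrable lborel (\<lambda>s. LBINT t. norm (case (s, t) of (s, t) \<Rightarrow> p (t - s) * k0 s))"
      using integrable_abs[OF ik] by simp
  qed
  have conv: "(LBINT s. p (t - s) * k0 s) = indicator {0..} t * (LBINT s:{0..t}. exp (- \<mu> * (t - s)) * k s)" for t
  proof (cases "0 \<le> t")
    case True
    then show ?thesis unfolding set_lebesgue_integral_def
      by (auto intro!: Bochner_Integration.integral_cong simp: p_def k0_def indicator_def)
  next
    case False
    then have "(\<lambda>s. p (t - s) * k0 s) = (\<lambda>_. 0)" by (auto simp: p_def k0_def indicator_def)
    then have "(LBINT s. p (t - s) * k0 s) = 0" by simp
    then show ?thesis using False by simp
  qed
  show "set_integrable lborel {0..} (\<lambda>t. LBINT s:{0..t}. exp (- \<mu> * (t - s)) * k s)"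
    using lborel_pair.integrable_snd[OF int] by (simp add: conv set_integrable_def)
  have "(LBINT t. LBINT s. p (t - s) * k0 s) = (LBINT s. LBINT t. p (t - s) * k0 s)"
    using lborel_pair.Fubini_integral[OF int] .
  then show "(LBINT t:{0..}. LBINT s:{0..t}. exp (- \<mu> * (t - s)) * k s) = (LBINT s:{0..}. k s) / \<mu>"
    by (simp add: conv ip') (simp add: k0_def set_lebesgue_integral_def)
qed

section \<open>The resolvent estimate\<close>

definition disc :: "real \<Rightarrow> real \<Rightarrow> real \<Rightarrow> real \<Rightarrow> (real \<Rightarrow> real) \<Rightarrow> real \<Rightarrow> real" where
  "disc \<alpha> \<theta> z \<kappa> d s = exp (- \<alpha> * s - \<theta> * occ z \<kappa> d s)"

lemma disc_le:
  assumes "0 \<le> \<theta>"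
  shows "\<bar>disc \<alpha> \<theta> z \<kappa> d s\<bar> \<le> exp (- \<alpha> * s)"
  using mult_nonneg_nonneg[OF assms occ_nonneg[of z \<kappa> d s]] by (simp add: disc_def)

lemma disc_measurable [measurable (raw)]:
  assumes [measurable]: "(\<lambda>(x, s). d x s) \<in> borel_measurable (G \<Otimes>\<^sub>M borel)" "t \<in> borel_measurable G"
  shows "(\<lambda>x. disc \<alpha> \<theta> z \<kappa> (d x) (t x)) \<in> borel_measurable G"
  unfolding disc_def by measurable

context poisson_process
begin

lemma path_measurable_snd [measurable]:
  "(\<lambda>p. path (fst p) (snd p)) \<in> borel_measurable (M \<Otimes>\<^sub>M borel)"
  using path_measurable by (simp add: case_prod_beta)

lemma path_section_measurable [measurable]: "s \<in> space borel \<Longrightarrow> (\<lambda>\<omega>. path \<omega> s) \<in> borel_measurable M"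
  unfolding sgn_path_def by (rule measurable_compose[OF N_measurable]) auto

lemma disc_expectation:
  fixes b :: "'a \<Rightarrow> real \<Rightarrow> real" and z \<kappa> :: real
  assumes [measurable]: "(\<lambda>(\<omega>, s). b \<omega> s) \<in> borel_measurable (M \<Otimes>\<^sub>M borel)"
    and b: "\<And>\<omega> s. \<bar>b \<omega> s\<bar> \<le> C" and \<alpha>: "0 < \<alpha>" and \<theta>: "0 \<le> \<theta>"
  defines "f \<equiv> \<lambda>\<omega> s. disc \<alpha> \<theta> z \<kappa> (path \<omega>) s * b \<omega> s"
  shows "(\<lambda>(\<omega>, s). f \<omega> s) \<in> borel_measurable (M \<Otimes>\<^sub>M borel)"
    and "\<bar>f \<omega> s\<bar> \<le> C * exp (- \<alpha> * s)"
    and "set_integrable lborel {0..} (\<lambda>s. expectation (\<lambda>\<omega>. f \<omega> s))"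
    and "(LBINT s:{0..}. expectation (\<lambda>\<omega>. f \<omega> s)) = expectation (\<lambda>\<omega>. LBINT s:{0..}. f \<omega> s)"
    and "\<bar>LBINT s:{0..}. expectation (\<lambda>\<omega>. f \<omega> s)\<bar> \<le> C / \<alpha>"
    and "integrable M (\<lambda>\<omega>. f \<omega> s)"
proof -
  show m: "(\<lambda>(\<omega>, s). f \<omega> s) \<in> borel_measurable (M \<Otimes>\<^sub>M borel)"
    unfolding f_def case_prod_beta by measurable
  have le: "\<bar>f \<omega> s\<bar> \<le> C * exp (- \<alpha> * s)" for \<omega> s
    unfolding f_def abs_mult mult.commute[of C] by (intro mult_mono disc_le \<theta> b) auto
  then show "\<bar>f \<omega> s\<bar> \<le> C * exp (- \<alpha> * s)" .
  note F = Fubini_halfline[OF m \<alpha> le]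
  show "set_integrable lborel {0..} (\<lambda>s. expectation (\<lambda>\<omega>. f \<omega> s))"
    "(LBINT s:{0..}. expectation (\<lambda>\<omega>. f \<omega> s)) = expectation (\<lambda>\<omega>. LBINT s:{0..}. f \<omega> s)"
    "\<bar>LBINT s:{0..}. expectation (\<lambda>\<omega>. f \<omega> s)\<bar> \<le> C / \<alpha>"
    by (fact F)+
  have "(\<lambda>\<omega>. f \<omega> s) \<in> borel_measurable M"
    using measurable_compose[OF measurable_Pair2'[of s borel M] m] by simp
  then show "integrable M (\<lambda>\<omega>. f \<omega> s)"
    by (intro integrable_const_bound[of _ "C * exp (- \<alpha> * s)"]) (use le in auto)
qed


lemma path_0: "\<omega> \<in> space M \<Longrightarrow> path \<omega> 0 = 1"
  by (simp add: sgn_path_def N_zero)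

text \<open>The corrector \<open>path \<omega> s * w' (Z s)\<close> turns the first order generator of the telegraph process
  into half the second derivative: its expectation decays at rate \<open>2 * rate\<close>.\<close>

lemma resolvent_estimate:
  fixes w w' w'' :: "real \<Rightarrow> real" and z \<kappa> \<alpha> \<theta> B :: real
  assumes \<alpha>: "0 < \<alpha>" and \<theta>: "0 \<le> \<theta>" and \<kappa>: "\<kappa> ^ 2 = rate"
    and w: "\<And>y. (w has_real_derivative w' y) (at y)"
    and w': "continuous_on UNIV w'" "\<And>y. y \<noteq> 0 \<Longrightarrow> (w' has_real_derivative w'' y) (at y)"
    and w'': "w'' \<in> borel_measurable borel"
    and B: "\<And>y. \<bar>w y\<bar> \<le> B" "\<And>y. \<bar>w' y\<bar> \<le> B" "\<And>y. \<bar>w'' y\<bar> \<le> B"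
  defines "g \<equiv> \<lambda>y. (\<alpha> + \<theta> * indicator {0<..} y) * w y - w'' y / 2"
  shows "\<bar>w z - (LBINT s:{0..}. expectation (\<lambda>\<omega>. disc \<alpha> \<theta> z \<kappa> (path \<omega>) s * g (pos z \<kappa> (path \<omega>) s)))\<bar>
    \<le> (B + (\<alpha> + \<theta>) * B / \<alpha>) / (2 * sqrt rate)"
proof -
  let ?E = "\<lambda>\<omega>. disc \<alpha> \<theta> z \<kappa> (path \<omega>)" and ?Z = "\<lambda>\<omega>. pos z \<kappa> (path \<omega>)"
  let ?v = "\<lambda>y. \<alpha> + \<theta> * indicator {0<..} y"
  have \<kappa>0: "\<kappa> \<noteq> 0" using \<kappa> rate_pos by auto
  have B0: "0 \<le> B" using B(1)[of 0] by linarith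
  have [measurable]: "w'' \<in> borel_measurable borel" by (rule w'')
  have wc: "continuous_on UNIV w"
    using w by (auto intro!: DERIV_isCont simp: continuous_on_eq_continuous_at)
  have [measurable]: "w \<in> borel_measurable borel" "w' \<in> borel_measurable borel"
    by (auto intro: borel_measurable_continuous_onI wc w'(1))
  have v: "\<bar>?v y\<bar> \<le> \<alpha> + \<theta>" for y using \<alpha> \<theta> by (auto simp: indicator_def)
  have vw: "\<bar>?v y * w y\<bar> \<le> (\<alpha> + \<theta>) * B" "\<bar>?v y * w' y\<bar> \<le> (\<alpha> + \<theta>) * B" for y
    unfolding abs_mult by (intro mult_mono v B; use \<alpha> \<theta> in simp)+

  \<comment> \<open>Four bounded factors: \<open>b1\<close> is the potential acting on
    \<open>w\<close>, \<open>b2\<close> the sign times \<open>w'\<close>, \<open>b3\<close> the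
    potential acting on \<open>b2\<close>, and \<open>b4\<close> the second derivative. Two linear
    relations among their discounted integrals, \<open>first\<close> and \<open>second\<close>,
    permit the elimination of \<open>I b2\<close>.\<close>
  define b1 where "b1 \<omega> s = ?v (?Z \<omega> s) * w (?Z \<omega> s)" for \<omega> s
  define b2 where "b2 \<omega> s = path \<omega> s * w' (?Z \<omega> s)" for \<omega> s
  define b3 where "b3 \<omega> s = path \<omega> s * (?v (?Z \<omega> s) * w' (?Z \<omega> s))" for \<omega> s
  define b4 where "b4 \<omega> s = w'' (?Z \<omega> s)" for \<omega> s
  have m [measurable]: "(\<lambda>(\<omega>, s). b1 \<omega> s) \<in> borel_measurable (M \<Otimes>\<^sub>M borel)"
     "(\<lambda>(\<omega>, s). b2 \<omega> s) \<in> borel_measurable (M \<Otimes>\<^sub>M borel)"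
     "(\<lambda>(\<omega>, s). b3 \<omega> s) \<in> borel_measurable (M \<Otimes>\<^sub>M borel)"
     "(\<lambda>(\<omega>, s). b4 \<omega> s) \<in> borel_measurable (M \<Otimes>\<^sub>M borel)"
    unfolding b1_def b2_def b3_def b4_def case_prod_beta by measurable
  have b: "\<bar>b1 \<omega> s\<bar> \<le> (\<alpha> + \<theta>) * B" "\<bar>b2 \<omega> s\<bar> \<le> B" "\<bar>b3 \<omega> s\<bar> \<le> (\<alpha> + \<theta>) * B" "\<bar>b4 \<omega> s\<bar> \<le> B" for \<omega> s
    using vw B by (simp_all add: b1_def b2_def b3_def b4_def abs_mult)
  define I where "I b = (LBINT s:{0..}. expectation (\<lambda>\<omega>. ?E \<omega> s * b \<omega> s))" for b
  note D1 = disc_expectation[OF m(1) b(1) \<alpha> \<theta>, of z \<kappa>]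
  note D2 = disc_expectation[OF m(2) b(2) \<alpha> \<theta>, of z \<kappa>]
  note D3 = disc_expectation[OF m(3) b(3) \<alpha> \<theta>, of z \<kappa>]
  note D4 = disc_expectation[OF m(4) b(4) \<alpha> \<theta>, of z \<kappa>]

  \<comment> \<open>Integrate the derivative of the discounted \<open>w\<close> along the path and
    let the time tend to infinity; the discount kills the boundary term there and only
    \<open>- w z\<close> survives.\<close>
  have first: "\<kappa> * I b2 - I b1 = - w z"
  proof -
    have mf: "(\<lambda>(\<omega>, s). \<kappa> * b2 \<omega> s - b1 \<omega> s) \<in> borel_measurable (M \<Otimes>\<^sub>M borel)"
      using m(1,2) by (simp add: case_prod_beta)
    have bf: "\<bar>\<kappa> * b2 \<omega> s - b1 \<omega> s\<bar> \<le> \<bar>\<kappa>\<bar> * B + (\<alpha> + \<theta>) * B" for \<omega> s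
      using b(1)[of \<omega> s] mult_left_mono[OF b(2)[of \<omega> s] abs_ge_zero[of \<kappa>]]
        abs_triangle_ineq4[of "\<kappa> * b2 \<omega> s" "b1 \<omega> s"] by (simp only: abs_mult)
    note D = disc_expectation[OF mf bf \<alpha> \<theta>, of z \<kappa>]
    have "(LBINT s:{0..}. ?E \<omega> s * (\<kappa> * b2 \<omega> s - b1 \<omega> s)) = - w z" if \<omega>: "\<omega> \<in> space M" for \<omega>
    proof -
      interpret cp: counting_path "\<lambda>s. N s \<omega>" by (rule counting_path[OF \<omega>])
      let ?f = "\<lambda>s. ?E \<omega> s * (\<kappa> * b2 \<omega> s - b1 \<omega> s)"
      have fm: "?f \<in> borel_measurable borel"
        using measurable_compose[OF measurable_Pair1'[OF \<omega>] D(1)] by simp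
      have "set_integrable lborel {0..} ?f"
        using set_integrable_exp_bound(1)[OF \<alpha> fm D(2)] .
      then have "((\<lambda>t. LBINT s:{0..t}. ?f s) \<longlongrightarrow> (LBINT s:{0..}. ?f s)) at_top"
        by (intro tendsto_set_lebesgue_integral_at_top) auto
      moreover have "((\<lambda>t. LBINT s:{0..t}. ?f s) \<longlongrightarrow> 0 - w z) at_top"
      proof (rule Lim_transform_eventually)
        show "((\<lambda>t. ?E \<omega> t * w (?Z \<omega> t) - w z) \<longlongrightarrow> 0 - w z) at_top"
        proof (rule tendsto_diff[OF Lim_null_comparison tendsto_const])
          show "\<forall>\<^sub>F t in at_top. norm (?E \<omega> t * w (?Z \<omega> t)) \<le> exp (- \<alpha> * t) * B"
          proof (intro always_eventually allI)
            fix t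
            have "\<bar>?E \<omega> t\<bar> * \<bar>w (?Z \<omega> t)\<bar> \<le> exp (- \<alpha> * t) * B" by (intro mult_mono disc_le \<theta> B) auto
            then show "norm (?E \<omega> t * w (?Z \<omega> t)) \<le> exp (- \<alpha> * t) * B" by (simp add: abs_mult)
          qed
          have "filterlim (\<lambda>t. - \<alpha> * t) at_bot at_top"
            by (rule filterlim_tendsto_neg_mult_at_bot[OF tendsto_const _ filterlim_ident]) (use \<alpha> in simp)
          then have "((\<lambda>t. exp (- \<alpha> * t)) \<longlongrightarrow> 0) at_top"
            by (rule filterlim_compose[OF exp_at_bot])
          then show "((\<lambda>t. exp (- \<alpha> * t) * B) \<longlongrightarrow> 0) at_top" by (rule tendsto_mult_left_zero)
        qed
        show "\<forall>\<^sub>F t in at_top. ?E \<omega> t * w (?Z \<omega> t) - w z = (LBINT s:{0..t}. ?f s)"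
          using eventually_ge_at_top[of 0]
        proof eventually_elim
          case (elim t)
          have "(LBINT s:{0..t}. ?f s) = (LBINT s:{0..t}. exp (- \<alpha> * s - \<theta> * occ z \<kappa> (path \<omega>) s) *
              (- (\<alpha> + \<theta> * indicator {0<..} (?Z \<omega> s)) * w (?Z \<omega> s) + \<kappa> * path \<omega> s * w' (?Z \<omega> s)))"
            by (simp add: disc_def b1_def b2_def algebra_simps)
          also have "\<dots> = ?E \<omega> t * w (?Z \<omega> t) - w z"
            unfolding disc_def
            by (rule cp.weighted_path_FTC[OF \<kappa>0 elim wc w _ B(2) B(1)]) (use \<alpha> \<theta> in auto)
          finally show ?case by simp
        qed
      qed
      ultimately show ?thesis using tendsto_unique[OF trivial_limit_at_top_linorder] by fastforce
    qed
    then have "(LBINT s:{0..}. expectation (\<lambda>\<omega>. ?E \<omega> s * (\<kappa> * b2 \<omega> s - b1 \<omega> s))) = - w z"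
      unfolding D(4) by (simp add: prob_space cong: Bochner_Integration.integral_cong)
    moreover have "expectation (\<lambda>\<omega>. ?E \<omega> s * (\<kappa> * b2 \<omega> s - b1 \<omega> s))
        = \<kappa> * expectation (\<lambda>\<omega>. ?E \<omega> s * b2 \<omega> s) - expectation (\<lambda>\<omega>. ?E \<omega> s * b1 \<omega> s)" for s
      using D1(6)[of s] D2(6)[of s] by (simp add: right_diff_distrib mult.left_commute[of _ \<kappa>])
    moreover have "(LBINT s:{0..}. \<kappa> * expectation (\<lambda>\<omega>. ?E \<omega> s * b2 \<omega> s) - expectation (\<lambda>\<omega>. ?E \<omega> s * b1 \<omega> s))
        = \<kappa> * I b2 - I b1"
      unfolding I_def by (subst set_integral_diff(2)) (use D1(3) D2(3) in auto)
    ultimately show ?thesis by simp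
  qed

  \<comment> \<open>The mean of \<open>b2\<close> satisfies a linear relaxation equation with rate
    \<open>2 * rate\<close>, initial value \<open>w' z\<close> and source \<open>k\<close>; this is
    its integral over all times.\<close>
  have second: "I b2 = (w' z + (\<kappa> * I b4 - I b3)) / (2 * rate)"
  proof -
    let ?F = "\<lambda>\<omega> s. ?E \<omega> s * (\<kappa> * path \<omega> s * w'' (?Z \<omega> s) - ?v (?Z \<omega> s) * w' (?Z \<omega> s))"
    let ?C = "\<bar>\<kappa>\<bar> * B + (\<alpha> + \<theta>) * B"
    have mf: "(\<lambda>(\<omega>, s). \<kappa> * path \<omega> s * w'' (?Z \<omega> s) - ?v (?Z \<omega> s) * w' (?Z \<omega> s)) \<in> borel_measurable (M \<Otimes>\<^sub>M borel)"
      unfolding case_prod_beta by measurable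
    have bf: "\<bar>\<kappa> * path \<omega> s * w'' (?Z \<omega> s) - ?v (?Z \<omega> s) * w' (?Z \<omega> s)\<bar> \<le> ?C" for \<omega> s
    proof -
      have "\<bar>\<kappa> * path \<omega> s * w'' (?Z \<omega> s)\<bar> \<le> \<bar>\<kappa>\<bar> * B"
        using mult_left_mono[OF B(3), of "\<bar>\<kappa>\<bar>"] by (simp add: abs_mult)
      then show ?thesis using vw(2)[of "?Z \<omega> s"] by linarith
    qed
    note D = disc_expectation[OF mf bf \<alpha> \<theta>, of z \<kappa>]
    \<comment> \<open>Multiplying by the sign makes the term with \<open>w''\<close> free of the
      sign, since the sign squares to 1, and turns the other term into \<open>b3\<close>.\<close>
    define k where "k s = expectation (\<lambda>\<omega>. ?F \<omega> s * path \<omega> s)" for s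
    have k: "k s = \<kappa> * expectation (\<lambda>\<omega>. ?E \<omega> s * b4 \<omega> s) - expectation (\<lambda>\<omega>. ?E \<omega> s * b3 \<omega> s)" for s
    proof -
      have "?F \<omega> s * path \<omega> s = \<kappa> * (?E \<omega> s * b4 \<omega> s) - ?E \<omega> s * b3 \<omega> s" for \<omega>
      proof -
        have "?F \<omega> s * path \<omega> s = \<kappa> * (?E \<omega> s * b4 \<omega> s) * (path \<omega> s * path \<omega> s) - ?E \<omega> s * b3 \<omega> s"
          unfolding b3_def b4_def by algebra
        then show ?thesis by simp
      qed
      then show ?thesis unfolding k_def using D3(6)[of s] D4(6)[of s] by simp
    qed
    have kI: "set_integrable lborel {0..} k" "(LBINT s:{0..}. k s) = \<kappa> * I b4 - I b3"
      unfolding k[abs_def] I_def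
      using D3(3) D4(3) by (auto intro!: set_integral_diff)
    have km: "k \<in> borel_measurable borel"
    proof -
      have "(\<lambda>(s, \<omega>). ?F \<omega> s * path \<omega> s) \<in> borel_measurable (borel \<Otimes>\<^sub>M M)"
        using D(1) path_measurable_snd
        by (subst measurable_pair_swap_iff) (simp add: case_prod_beta)
      then show ?thesis unfolding k_def by measurable
    qed
    \<comment> \<open>Variation of constants: \<open>w'\<close> is expanded along the path up to
      \<open>t\<close>, and the factor \<open>path \<omega> t\<close> is replaced by a decaying
      multiple of the sign at the earlier time.\<close>
    have y: "expectation (\<lambda>\<omega>. ?E \<omega> t * b2 \<omega> t)
      = exp (- (2 * rate) * t) * w' z + (LBINT s:{0..t}. exp (- (2 * rate) * (t - s)) * k s)" if t: "0 \<le> t" for t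
    proof -
      have G: "?E \<omega> t * w' (?Z \<omega> t) = w' z + (LBINT s:{0..t}. ?F \<omega> s)" if \<omega>: "\<omega> \<in> space M" for \<omega>
      proof -
        interpret cp: counting_path "\<lambda>s. N s \<omega>" by (rule counting_path[OF \<omega>])
        have "(LBINT s:{0..t}. ?F \<omega> s) = (LBINT s:{0..t}. exp (- \<alpha> * s - \<theta> * occ z \<kappa> (path \<omega>) s) *
              (- (\<alpha> + \<theta> * indicator {0<..} (?Z \<omega> s)) * w' (?Z \<omega> s) + \<kappa> * path \<omega> s * w'' (?Z \<omega> s)))"
          by (simp add: disc_def algebra_simps)
        also have "\<dots> = ?E \<omega> t * w' (?Z \<omega> t) - w' z"
          unfolding disc_def
          by (rule cp.weighted_path_FTC[OF \<kappa>0 t w'(1) w'(2) _ B(3) B(2)]) (use \<alpha> \<theta> in auto)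
        finally show ?thesis by simp
      qed
      have pt: "(\<lambda>\<omega>. path \<omega> t) \<in> borel_measurable M" by simp
      have C0: "0 \<le> ?C" using B0 \<alpha> \<theta> by simp
      have Fle: "\<bar>?F \<omega> s * path \<omega> t\<bar> \<le> ?C" if "0 \<le> s" for \<omega> s
      proof -
        have "\<bar>?F \<omega> s\<bar> \<le> ?C * exp (- \<alpha> * s)" by (rule D(2))
        also have "\<dots> \<le> ?C * 1" using that \<alpha> by (intro mult_left_mono C0) simp
        finally show ?thesis by (simp add: abs_mult)
      qed
      have mF: "(\<lambda>(\<omega>, s). ?F \<omega> s * path \<omega> t) \<in> borel_measurable (M \<Otimes>\<^sub>M borel)"
        using D(1) pt by (simp add: case_prod_beta)
      \<comment> \<open>The sign at \<open>t\<close> is moved under the time integral, because the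
        decay is available only for each fixed earlier time \<open>s\<close>, where
        \<open>?F \<omega> s\<close> is determined by the past.\<close>
      have "expectation (\<lambda>\<omega>. ?E \<omega> t * b2 \<omega> t) = expectation (\<lambda>\<omega>. w' z * path \<omega> t + (LBINT s:{0..t}. ?F \<omega> s * path \<omega> t))"
      proof (rule Bochner_Integration.integral_cong)
        fix \<omega> assume \<omega>: "\<omega> \<in> space M"
        have "?E \<omega> t * b2 \<omega> t = (?E \<omega> t * w' (?Z \<omega> t)) * path \<omega> t" by (simp add: b2_def)
        also have "\<dots> = w' z * path \<omega> t + (LBINT s:{0..t}. ?F \<omega> s) * path \<omega> t"
          unfolding G[OF \<omega>] by (simp add: distrib_right)
        also have "(LBINT s:{0..t}. ?F \<omega> s) * path \<omega> t = (LBINT s:{0..t}. ?F \<omega> s * path \<omega> t)"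
          by (rule set_integral_mult_left[symmetric])
        finally show "?E \<omega> t * b2 \<omega> t = w' z * path \<omega> t + (LBINT s:{0..t}. ?F \<omega> s * path \<omega> t)" .
      qed simp
      also have "\<dots> = expectation (\<lambda>\<omega>. w' z * path \<omega> t) + expectation (\<lambda>\<omega>. LBINT s:{0..t}. ?F \<omega> s * path \<omega> t)"
      proof (rule Bochner_Integration.integral_add)
        show "integrable M (\<lambda>\<omega>. w' z * path \<omega> t)"
          using pt by (intro integrable_const_bound[of _ "\<bar>w' z\<bar>"]) (auto simp: abs_mult)
        have "(\<lambda>\<omega>. path_int (\<lambda>s. ?F \<omega> s * path \<omega> t) t) \<in> borel_measurable M"
          using mF by measurable
        moreover have "\<bar>LBINT s:{0..t}. ?F \<omega> s * path \<omega> t\<bar> \<le> \<bar>?E \<omega> t * w' (?Z \<omega> t) - w' z\<bar>"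
          if "\<omega> \<in> space M" for \<omega>
          using G[OF that] by (simp add: abs_mult)
        moreover have "\<bar>?E \<omega> t * w' (?Z \<omega> t) - w' z\<bar> \<le> 1 * B + B" for \<omega>
        proof -
          have "exp (- \<alpha> * t) \<le> 1" using t \<alpha> by simp
          then have "\<bar>?E \<omega> t\<bar> \<le> 1" using disc_le[OF \<theta>, of \<alpha> z \<kappa> "path \<omega>" t] by linarith
          then have "\<bar>?E \<omega> t * w' (?Z \<omega> t)\<bar> \<le> 1 * B" unfolding abs_mult by (intro mult_mono B) auto
          then show ?thesis using B(2)[of z] by linarith
        qed
        ultimately show "integrable M (\<lambda>\<omega>. LBINT s:{0..t}. ?F \<omega> s * path \<omega> t)"
          unfolding path_int_def
          by (intro integrable_const_bound[of _ "1 * B + B"]) (auto intro!: AE_I2 intro: order_trans)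
      qed
      also have "expectation (\<lambda>\<omega>. w' z * path \<omega> t) = exp (- (2 * rate) * t) * w' z"
      proof -
        have "expectation (\<lambda>\<omega>. w' z * path \<omega> t) = exp (- 2 * rate * (t - 0)) * expectation (\<lambda>\<omega>. w' z * path \<omega> 0)"
          by (rule expectation_times_path[of 0 t "\<lambda>_. w' z" "\<bar>w' z\<bar>"]) (use t in auto)
        also have "expectation (\<lambda>\<omega>. w' z * path \<omega> 0) = expectation (\<lambda>\<omega>. w' z)"
          by (rule Bochner_Integration.integral_cong) (auto simp: path_0)
        finally show ?thesis by (simp add: prob_space)
      qed
      also have "expectation (\<lambda>\<omega>. LBINT s:{0..t}. ?F \<omega> s * path \<omega> t) = (LBINT s:{0..t}. expectation (\<lambda>\<omega>. ?F \<omega> s * path \<omega> t))"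
        by (rule Fubini_Icc[OF mF Fle, symmetric])
      also have "\<dots> = (LBINT s:{0..t}. exp (- (2 * rate) * (t - s)) * k s)"
      proof (rule set_lebesgue_integral_cong)
        show "\<forall>s. s \<in> {0..t} \<longrightarrow> expectation (\<lambda>\<omega>. ?F \<omega> s * path \<omega> t) = exp (- (2 * rate) * (t - s)) * k s"
        proof (intro allI impI)
          fix s assume s: "s \<in> {0..t}"
          have [measurable]: "(\<lambda>\<omega>. path \<omega> s) \<in> borel_measurable (past s)" "(\<lambda>\<omega>. occ z \<kappa> (path \<omega>) s) \<in> borel_measurable (past s)"
            "(\<lambda>\<omega>. ?Z \<omega> s) \<in> borel_measurable (past s)"
            using s by (auto intro: path_past_measurable occ_past_measurable pos_past_measurable)
          have "(\<lambda>\<omega>. ?F \<omega> s) \<in> borel_measurable (past s)" unfolding disc_def by measurable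
          moreover have "\<bar>?F \<omega> s\<bar> \<le> ?C" for \<omega> using Fle[of s \<omega>] s by (simp add: abs_mult)
          ultimately show "expectation (\<lambda>\<omega>. ?F \<omega> s * path \<omega> t) = exp (- (2 * rate) * (t - s)) * k s"
            unfolding k_def using s
            by (subst expectation_times_path[of s t _ ?C]) auto
        qed
      qed simp
      finally show ?thesis by simp
    qed
    have r2: "0 < 2 * rate" using rate_pos by simp
    have "I b2 = (LBINT t:{0..}. exp (- (2 * rate) * t) * w' z + (LBINT s:{0..t}. exp (- (2 * rate) * (t - s)) * k s))"
      unfolding I_def by (rule set_lebesgue_integral_cong) (use y in auto)
    also have "\<dots> = (LBINT t:{0..}. exp (- (2 * rate) * t) * w' z) + (LBINT t:{0..}. LBINT s:{0..t}. exp (- (2 * rate) * (t - s)) * k s)"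
      by (rule set_integral_add) (use exp_halfline(1)[OF r2] exp_convolution_integral(1)[OF km kI(1) r2] in auto)
    also have "\<dots> = w' z / (2 * rate) + (\<kappa> * I b4 - I b3) / (2 * rate)"
      unfolding exp_convolution_integral(2)[OF km kI(1) r2] kI(2) set_integral_mult_left exp_halfline(2)[OF r2] by simp
    finally show ?thesis by (simp add: add_divide_distrib)
  qed

  have Ig: "(LBINT s:{0..}. expectation (\<lambda>\<omega>. ?E \<omega> s * g (?Z \<omega> s))) = I b1 - I b4 / 2"
  proof -
    have "expectation (\<lambda>\<omega>. ?E \<omega> s * g (?Z \<omega> s)) = expectation (\<lambda>\<omega>. ?E \<omega> s * b1 \<omega> s) - expectation (\<lambda>\<omega>. ?E \<omega> s * b4 \<omega> s) / 2" for s
      using D1(6)[of s] D4(6)[of s] by (simp add: g_def b1_def b4_def right_diff_distrib)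
    then show ?thesis unfolding I_def using D1(3) D4(3) by (simp add: set_integral_diff)
  qed
  \<comment> \<open>Here \<open>\<kappa>\<^sup>2 = rate\<close> gives \<open>I b4\<close> the exact
    coefficient 1/2, so that it cancels against the second derivative in \<open>g\<close>. The rest
    has the factor \<open>\<kappa> / (2 * rate)\<close>, of size
    \<open>1 / (2 * sqrt rate)\<close>.\<close>
  have "\<kappa> * I b2 = \<kappa> / (2 * rate) * (w' z - I b3) + I b4 / 2"
    using \<kappa> rate_pos unfolding second by (simp add: field_simps power2_eq_square)
  then have eq: "w z - (LBINT s:{0..}. expectation (\<lambda>\<omega>. ?E \<omega> s * g (?Z \<omega> s))) = - \<kappa> / (2 * rate) * (w' z - I b3)"
    using first Ig by simp
  have "\<bar>\<kappa>\<bar> = sqrt rate" using \<kappa> real_sqrt_abs[of \<kappa>] by simp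
  then have "\<bar>- \<kappa> / (2 * rate)\<bar> = 1 / (2 * sqrt rate)"
    using rate_pos real_sqrt_mult_self[of rate] by (simp add: field_simps)
  moreover have "\<bar>w' z - I b3\<bar> \<le> B + (\<alpha> + \<theta>) * B / \<alpha>"
    using B(2)[of z] D3(5) unfolding I_def by linarith
  ultimately show ?thesis
    unfolding eq abs_mult using rate_pos
    by (simp only: times_divide_eq_left mult_1) (simp add: divide_right_mono)
qed

end

section \<open>Explicit resolvents of step functions\<close>

text \<open>The bounded solution of \<open>(\<alpha> + \<theta> * indicator {0<..} y) * w y - w'' y / 2 = r y\<close>, where \<open>r\<close> equals
  \<open>(\<alpha> + \<theta>) * p\<close> on the positive and \<open>\<alpha> * q\<close> on the negative half-line.\<close>

definition step_resolvent :: "real \<Rightarrow> real \<Rightarrow> real \<Rightarrow> real \<Rightarrow> real \<Rightarrow> real" where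
  "step_resolvent \<alpha> \<theta> p q y =
    (let \<beta> = sqrt (2 * \<alpha>); \<gamma> = sqrt (2 * (\<alpha> + \<theta>)); w0 = (\<gamma> * p + \<beta> * q) / (\<beta> + \<gamma>)
     in if y \<in> {0<..} then p + (w0 - p) * exp (- \<gamma> * y) else q + (w0 - q) * exp (\<beta> * y))"

lemma step_resolvent_derivs:
  assumes \<alpha>: "0 < \<alpha>" and \<theta>: "0 \<le> \<theta>"
  obtains w' w'' B where
    "\<And>y. (step_resolvent \<alpha> \<theta> p q has_real_derivative w' y) (at y)"
    "continuous_on UNIV w'" "\<And>y. y \<noteq> 0 \<Longrightarrow> (w' has_real_derivative w'' y) (at y)"
    "w'' \<in> borel_measurable borel"
    "\<And>y. \<bar>step_resolvent \<alpha> \<theta> p q y\<bar> \<le> B" "\<And>y. \<bar>w' y\<bar> \<le> B" "\<And>y. \<bar>w'' y\<bar> \<le> B"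
    "\<And>y. (\<alpha> + \<theta> * indicator {0<..} y) * step_resolvent \<alpha> \<theta> p q y - w'' y / 2
       = (if 0 < y then (\<alpha> + \<theta>) * p else \<alpha> * q)"
proof -
  define \<beta> where "\<beta> = sqrt (2 * \<alpha>)"
  define \<gamma> where "\<gamma> = sqrt (2 * (\<alpha> + \<theta>))"
  have pos: "0 < \<beta>" "0 < \<gamma>" using \<alpha> \<theta> by (auto simp: \<beta>_def \<gamma>_def)
  have sq: "\<beta>\<^sup>2 = 2 * \<alpha>" "\<gamma>\<^sup>2 = 2 * (\<alpha> + \<theta>)" using \<alpha> \<theta> by (auto simp: \<beta>_def \<gamma>_def)
  define w0 where "w0 = (\<gamma> * p + \<beta> * q) / (\<beta> + \<gamma>)"
  define w where "w y = (if y \<in> {0<..} then p + (w0 - p) * exp (- \<gamma> * y) else q + (w0 - q) * exp (\<beta> * y))" for y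
  define w' where "w' y = (if y \<in> {0<..} then - \<gamma> * (w0 - p) * exp (- \<gamma> * y) else \<beta> * (w0 - q) * exp (\<beta> * y))" for y
  define w'' where "w'' y = (if y \<in> {0<..} then \<gamma>\<^sup>2 * (w0 - p) * exp (- \<gamma> * y) else \<beta>\<^sup>2 * (w0 - q) * exp (\<beta> * y))" for y
  have w: "step_resolvent \<alpha> \<theta> p q = w"
    by (simp add: step_resolvent_def w_def fun_eq_iff Let_def w0_def \<beta>_def \<gamma>_def)
  \<comment> \<open>The value \<open>w0\<close> at the origin is the one for which the two one-sided
    derivatives agree; this is what makes the glued function C1.\<close>
  have match: "- \<gamma> * (w0 - p) = \<beta> * (w0 - q)"
    using pos by (simp add: w0_def field_simps)
  have un: "UNIV = {0<..} \<union> {..0::real}" by auto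
  have Dp: "((\<lambda>y. p + (w0 - p) * exp (- \<gamma> * y)) has_vector_derivative - \<gamma> * (w0 - p) * exp (- \<gamma> * y)) (at y within X)"
    and Dq: "((\<lambda>y. q + (w0 - q) * exp (\<beta> * y)) has_vector_derivative \<beta> * (w0 - q) * exp (\<beta> * y)) (at y within X)" for y X
    unfolding has_real_derivative_iff_has_vector_derivative[symmetric]
    by (auto intro!: derivative_eq_intros)
  have D1: "(w has_real_derivative w' y) (at y)" for y
    unfolding has_real_derivative_iff_has_vector_derivative w_def w'_def
  proof (rule has_vector_derivative_If_within_closures[where T="{..0}" and u=UNIV, OF _ un])
    show "y \<in> {0<..} \<union> {..0}" by auto
    show "- \<gamma> * (w0 - p) * exp (- \<gamma> * y) = \<beta> * (w0 - q) * exp (\<beta> * y)"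
      "p + (w0 - p) * exp (- \<gamma> * y) = q + (w0 - q) * exp (\<beta> * y)"
      if "y \<in> closure {0<..}" "y \<in> closure {..0}" using that match by auto
  qed (rule Dp Dq)+
  have D2: "(w' has_real_derivative w'' y) (at y)" if "y \<noteq> 0" for y
  proof (cases "0 < y")
    case True
    have "((\<lambda>y. - \<gamma> * (w0 - p) * exp (- \<gamma> * y)) has_real_derivative w'' y) (at y)"
      using True by (auto intro!: derivative_eq_intros simp: w''_def power2_eq_square)
    moreover have "eventually (\<lambda>x. w' x = - \<gamma> * (w0 - p) * exp (- \<gamma> * x)) (nhds y)"
      using eventually_nhds_in_open[of "{0<..}" y] True by (auto elim!: eventually_mono simp: w'_def)
    ultimately show ?thesis by (subst DERIV_cong_ev[OF refl _ refl])
  next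
    case False
    have "((\<lambda>y. \<beta> * (w0 - q) * exp (\<beta> * y)) has_real_derivative w'' y) (at y)"
      using False by (auto intro!: derivative_eq_intros simp: w''_def power2_eq_square)
    moreover have "eventually (\<lambda>x. w' x = \<beta> * (w0 - q) * exp (\<beta> * x)) (nhds y)"
      using eventually_nhds_in_open[of "{..<0}" y] False that by (auto elim!: eventually_mono simp: w'_def)
    ultimately show ?thesis by (subst DERIV_cong_ev[OF refl _ refl])
  qed
  have c: "continuous_on UNIV w'"
  proof -
    have "continuous_on ({0..} \<union> {..0}) (\<lambda>y. if y \<in> {0<..} then - \<gamma> * (w0 - p) * exp (- \<gamma> * y) else \<beta> * (w0 - q) * exp (\<beta> * y))"
      by (intro continuous_on_cases continuous_intros) (use match in auto)
    moreover have "{0..} \<union> {..0} = (UNIV :: real set)" by auto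
    ultimately show ?thesis by (simp only: w'_def[abs_def])
  qed
  have e: "exp (- \<gamma> * y) \<le> 1" if "0 < y" for y using that pos by simp
  have e': "exp (\<beta> * y) \<le> 1" if "\<not> 0 < y" for y using that pos by (simp add: mult_le_0_iff)
  have bd: "\<bar>k * exp x\<bar> \<le> \<bar>k\<bar>" if "exp x \<le> 1" for k x :: real
    using mult_left_mono[OF that, of "\<bar>k\<bar>"] by (simp add: abs_mult)
  define A where "A = \<bar>p\<bar> + \<bar>w0 - p\<bar> + \<bar>- \<gamma> * (w0 - p)\<bar> + \<bar>\<gamma>\<^sup>2 * (w0 - p)\<bar>"
  define A' where "A' = \<bar>q\<bar> + \<bar>w0 - q\<bar> + \<bar>\<beta> * (w0 - q)\<bar> + \<bar>\<beta>\<^sup>2 * (w0 - q)\<bar>"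
  have A: "0 \<le> A" "\<bar>p\<bar> + \<bar>w0 - p\<bar> \<le> A" "\<bar>- \<gamma> * (w0 - p)\<bar> \<le> A" "\<bar>\<gamma>\<^sup>2 * (w0 - p)\<bar> \<le> A"
    by (simp_all add: A_def)
  have A': "0 \<le> A'" "\<bar>q\<bar> + \<bar>w0 - q\<bar> \<le> A'" "\<bar>\<beta> * (w0 - q)\<bar> \<le> A'" "\<bar>\<beta>\<^sup>2 * (w0 - q)\<bar> \<le> A'"
    by (simp_all add: A'_def)
  have bA: "\<bar>w y\<bar> \<le> A \<and> \<bar>w' y\<bar> \<le> A \<and> \<bar>w'' y\<bar> \<le> A" if y: "0 < y" for y
  proof -
    have eq: "w y = p + (w0 - p) * exp (- \<gamma> * y)" "w' y = (- \<gamma> * (w0 - p)) * exp (- \<gamma> * y)"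
      "w'' y = (\<gamma>\<^sup>2 * (w0 - p)) * exp (- \<gamma> * y)" using y by (simp_all add: w_def w'_def w''_def)
    have "\<bar>w y\<bar> \<le> \<bar>p\<bar> + \<bar>w0 - p\<bar>"
      unfolding eq by (rule order_trans[OF abs_triangle_ineq add_left_mono[OF bd[OF e[OF y]]]])
    moreover have "\<bar>w' y\<bar> \<le> A" unfolding eq by (rule order_trans[OF bd[OF e[OF y]] A(3)])
    moreover have "\<bar>w'' y\<bar> \<le> A" unfolding eq by (rule order_trans[OF bd[OF e[OF y]] A(4)])
    ultimately show ?thesis using A(2) by simp
  qed
  have bA': "\<bar>w y\<bar> \<le> A' \<and> \<bar>w' y\<bar> \<le> A' \<and> \<bar>w'' y\<bar> \<le> A'" if y: "\<not> 0 < y" for y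
  proof -
    have eq: "w y = q + (w0 - q) * exp (\<beta> * y)" "w' y = (\<beta> * (w0 - q)) * exp (\<beta> * y)"
      "w'' y = (\<beta>\<^sup>2 * (w0 - q)) * exp (\<beta> * y)" using y by (simp_all add: w_def w'_def w''_def)
    have "\<bar>w y\<bar> \<le> \<bar>q\<bar> + \<bar>w0 - q\<bar>"
      unfolding eq by (rule order_trans[OF abs_triangle_ineq add_left_mono[OF bd[OF e'[OF y]]]])
    moreover have "\<bar>w' y\<bar> \<le> A'" unfolding eq by (rule order_trans[OF bd[OF e'[OF y]] A'(3)])
    moreover have "\<bar>w'' y\<bar> \<le> A'" unfolding eq by (rule order_trans[OF bd[OF e'[OF y]] A'(4)])
    ultimately show ?thesis using A'(2) by simp
  qed
  have b: "\<bar>w y\<bar> \<le> A + A' \<and> \<bar>w' y\<bar> \<le> A + A' \<and> \<bar>w'' y\<bar> \<le> A + A'" for y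
    using bA[of y] bA'[of y] A(1) A'(1) by (cases "0 < y") (simp_all add: add_increasing add_increasing2)
  show ?thesis
  proof (rule that[of w' w'' "A + A'"])
    show "w'' \<in> borel_measurable borel" unfolding w''_def by measurable
    fix y
    show "(\<alpha> + \<theta> * indicator {0<..} y) * step_resolvent \<alpha> \<theta> p q y - w'' y / 2
       = (if 0 < y then (\<alpha> + \<theta>) * p else \<alpha> * q)"
      unfolding w by (auto simp: w_def w''_def sq field_simps)
  qed (use D1 D2 c b in \<open>auto simp: w\<close>)
qed

text \<open>The constant \<open>K\<close> precedes the process and the starting point. This
  uniformity is what later permits the probability space, the rate and the start to change with
  \<open>T\<close>.\<close>

lemma resolvent_step:
  assumes "0 < \<alpha>" "0 \<le> \<theta>"
  shows "\<exists>K. \<forall>(M :: 'a measure) rate N \<kappa> z. poisson_process M rate N \<longrightarrow> \<kappa>\<^sup>2 = rate \<longrightarrow>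
    \<bar>step_resolvent \<alpha> \<theta> p q z -
      (LBINT s:{0..}. \<integral>\<omega>. disc \<alpha> \<theta> z \<kappa> (sgn_of N \<omega>) s *
         (if 0 < pos z \<kappa> (sgn_of N \<omega>) s then (\<alpha> + \<theta>) * p else \<alpha> * q) \<partial>M)\<bar> \<le> K / sqrt rate"
proof -
  obtain w' w'' B where w: "\<And>y. (step_resolvent \<alpha> \<theta> p q has_real_derivative w' y) (at y)"
    "continuous_on UNIV w'" "\<And>y. y \<noteq> 0 \<Longrightarrow> (w' has_real_derivative w'' y) (at y)"
    "w'' \<in> borel_measurable borel"
    "\<And>y. \<bar>step_resolvent \<alpha> \<theta> p q y\<bar> \<le> B" "\<And>y. \<bar>w' y\<bar> \<le> B" "\<And>y. \<bar>w'' y\<bar> \<le> B"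
    and eq: "\<And>y. (\<alpha> + \<theta> * indicator {0<..} y) * step_resolvent \<alpha> \<theta> p q y - w'' y / 2
       = (if 0 < y then (\<alpha> + \<theta>) * p else \<alpha> * q)"
    using step_resolvent_derivs[OF assms, of p q] by blast
  show ?thesis
  proof (intro exI[of _ "(B + (\<alpha> + \<theta>) * B / \<alpha>) / 2"] allI impI)
    fix M :: "'a measure" and rate N \<kappa> z
    assume "poisson_process M rate N" and "\<kappa>\<^sup>2 = rate"
    from poisson_process.resolvent_estimate[OF this(1) assms this(2) w, of z]
    show "\<bar>step_resolvent \<alpha> \<theta> p q z -
      (LBINT s:{0..}. \<integral>\<omega>. disc \<alpha> \<theta> z \<kappa> (sgn_of N \<omega>) s *
         (if 0 < pos z \<kappa> (sgn_of N \<omega>) s then (\<alpha> + \<theta>) * p else \<alpha> * q) \<partial>M)\<bar>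
       \<le> (B + (\<alpha> + \<theta>) * B / \<alpha>) / 2 / sqrt rate"
      unfolding eq by (simp add: field_simps)
  qed
qed

text \<open>Used twice: to compare shifted starting points in \<open>small_ball_occupation\<close>,
  and to replace the scaled starting point by its limit.\<close>

lemma step_resolvent_lipschitz:
  assumes "0 < \<alpha>" "0 \<le> \<theta>"
  shows "\<exists>L. \<forall>y z. \<bar>step_resolvent \<alpha> \<theta> p q y - step_resolvent \<alpha> \<theta> p q z\<bar> \<le> L * \<bar>y - z\<bar>"
proof -
  obtain w' w'' B where w: "\<And>y. (step_resolvent \<alpha> \<theta> p q has_real_derivative w' y) (at y)"
    "\<And>y. \<bar>w' y\<bar> \<le> B"
    using step_resolvent_derivs[OF assms, of p q] by metis
  have "norm (step_resolvent \<alpha> \<theta> p q y - step_resolvent \<alpha> \<theta> p q z) \<le> B * norm (y - z)" for y z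
    by (rule field_differentiable_bound[of UNIV _ w']) (use w in auto)
  then show ?thesis by auto
qed

text \<open>Shifting the start shifts the whole path, so the indicator of the window is the
  difference of the half-line indicators for the starts \<open>z + \<delta>\<close> and
  \<open>z - \<delta>\<close>; the window is half-open to make this exact. Without occupation
  discount the resolvent of the half-line is Lipschitz in the start, hence the bound of order
  \<open>\<delta>\<close> plus the approximation error.\<close>

lemma small_ball_occupation:
  "\<exists>K\<ge>0. \<forall>(M :: 'a measure) rate N \<kappa> z \<delta>. poisson_process M rate N \<longrightarrow> \<kappa>\<^sup>2 = rate \<longrightarrow> 0 \<le> \<delta> \<longrightarrow>
    (LBINT s:{0..1}. \<integral>\<omega>. indicator {-\<delta><..\<delta>} (pos z \<kappa> (sgn_of N \<omega>) s) \<partial>M) \<le> K * (\<delta> + 1 / sqrt rate)"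
proof -
  have "\<exists>K. \<forall>(M :: 'a measure) rate N \<kappa> z. poisson_process M rate N \<longrightarrow> \<kappa>\<^sup>2 = rate \<longrightarrow>
    \<bar>step_resolvent 1 0 1 0 z -
      (LBINT s:{0..}. \<integral>\<omega>. disc 1 0 z \<kappa> (sgn_of N \<omega>) s *
         (if 0 < pos z \<kappa> (sgn_of N \<omega>) s then (1 + 0) * 1 else 1 * 0) \<partial>M)\<bar> \<le> K / sqrt rate"
    by (rule resolvent_step) simp_all
  then obtain K where "\<forall>(M :: 'a measure) rate N \<kappa> z. poisson_process M rate N \<longrightarrow> \<kappa>\<^sup>2 = rate \<longrightarrow>
    \<bar>step_resolvent 1 0 1 0 z -
      (LBINT s:{0..}. \<integral>\<omega>. disc 1 0 z \<kappa> (sgn_of N \<omega>) s *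
         (if 0 < pos z \<kappa> (sgn_of N \<omega>) s then (1 + 0) * 1 else 1 * 0) \<partial>M)\<bar> \<le> K / sqrt rate"
    by (rule exE)
  note K = this[rule_format]
  obtain L where L: "\<And>y z. \<bar>step_resolvent 1 0 1 0 y - step_resolvent 1 0 1 0 z\<bar> \<le> L * \<bar>y - z\<bar>"
    using step_resolvent_lipschitz[of 1 0 1 0] by auto
  \<comment> \<open>The factor \<open>exp 1\<close> undoes the discount on the unit interval,
    \<open>2 * \<bar>L\<bar>\<close> comes from the distance \<open>2 * \<delta>\<close> of the two
    starts, and \<open>2 * \<bar>K\<bar>\<close> from two uses of the resolvent estimate.\<close>
  let ?K = "exp 1 * (2 * \<bar>L\<bar> + 2 * \<bar>K\<bar>)"
  have "(LBINT s:{0..1}. \<integral>\<omega>. indicator {-\<delta><..\<delta>} (pos z \<kappa> (sgn_of N \<omega>) s) \<partial>M) \<le> ?K * (\<delta> + 1 / sqrt rate)"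
    if pp: "poisson_process M rate N" and \<kappa>: "\<kappa>\<^sup>2 = rate" and \<delta>: "0 \<le> \<delta>"
    for M :: "'a measure" and rate N \<kappa> z \<delta>
  proof -
    interpret poisson_process M rate N by (rule pp)
    define b0 where "b0 z' \<omega> s = (if 0 < pos z' \<kappa> (path \<omega>) s then (1 + 0) * 1 else 1 * 0 :: real)" for z' \<omega> s
    define b where "b \<omega> s = (indicator {-\<delta><..\<delta>} (pos z \<kappa> (path \<omega>) s) :: real)" for \<omega> s
    have m: "(\<lambda>(\<omega>, s). b0 z' \<omega> s) \<in> borel_measurable (M \<Otimes>\<^sub>M borel)"
      "(\<lambda>(\<omega>, s). b \<omega> s) \<in> borel_measurable (M \<Otimes>\<^sub>M borel)" for z'
      unfolding b0_def b_def case_prod_beta by measurable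
    have le: "\<bar>b0 z' \<omega> s\<bar> \<le> 1" "\<bar>b \<omega> s\<bar> \<le> 1" for z' \<omega> s
      by (auto simp: b0_def b_def indicator_def)
    have d: "disc 1 0 z' \<kappa> (path \<omega>) s = exp (- s)" for z' \<omega> s by (simp add: disc_def)
    note D0 = disc_expectation[OF m(1) le(1), of 1 0 z \<kappa>, unfolded d, simplified]
    note D = disc_expectation[OF m(2) le(2), of 1 0 z \<kappa>, unfolded d, simplified]
    have b: "b \<omega> s = b0 (z + \<delta>) \<omega> s - b0 (z - \<delta>) \<omega> s" for \<omega> s
      using \<delta> by (auto simp: b_def b0_def pos_def indicator_def)
    define X where "X z' = (LBINT s:{0..}. \<integral>\<omega>. exp (- s) * b0 z' \<omega> s \<partial>M)" for z'
    have X: "\<bar>step_resolvent 1 0 1 0 z' - X z'\<bar> \<le> \<bar>K\<bar> / sqrt rate" for z'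
    proof -
      have "\<bar>step_resolvent 1 0 1 0 z' - X z'\<bar> \<le> K / sqrt rate"
        using K[OF pp \<kappa>, of z'] unfolding d X_def b0_def .
      also have "\<dots> \<le> \<bar>K\<bar> / sqrt rate" using rate_pos by (intro divide_right_mono) auto
      finally show ?thesis .
    qed
    have "(LBINT s:{0..}. \<integral>\<omega>. exp (- s) * b \<omega> s \<partial>M) = X (z + \<delta>) - X (z - \<delta>)"
    proof -
      have "(\<integral>\<omega>. exp (- s) * b \<omega> s \<partial>M) = (\<integral>\<omega>. exp (- s) * b0 (z + \<delta>) \<omega> s \<partial>M) - (\<integral>\<omega>. exp (- s) * b0 (z - \<delta>) \<omega> s \<partial>M)" for s
        unfolding b right_diff_distrib
        by (rule Bochner_Integration.integral_diff) (use D0(6) in \<open>simp_all del: integrable_mult_right_iff\<close>)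
      then show ?thesis
        unfolding X_def using set_integral_diff(2)[OF D0(3)[of "z + \<delta>"] D0(3)[of "z - \<delta>"]] by simp
    qed
    also have "\<dots> \<le> \<bar>L\<bar> * (2 * \<delta>) + 2 * (\<bar>K\<bar> / sqrt rate)"
    proof -
      have "L * \<bar>z + \<delta> - (z - \<delta>)\<bar> \<le> \<bar>L\<bar> * (2 * \<delta>)" using \<delta> by (simp add: mult_right_mono)
      then show ?thesis using X[of "z + \<delta>"] X[of "z - \<delta>"] L[of "z + \<delta>" "z - \<delta>"] by linarith
    qed
    also have "\<dots> \<le> (2 * \<bar>L\<bar> + 2 * \<bar>K\<bar>) * (\<delta> + 1 / sqrt rate)"
    proof -
      have "\<bar>L\<bar> * (2 * \<delta>) + 2 * (\<bar>K\<bar> * r) \<le> (2 * \<bar>L\<bar> + 2 * \<bar>K\<bar>) * (\<delta> + r)" if "0 \<le> r" for r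
        using mult_nonneg_nonneg[OF abs_ge_zero[of L] that] mult_nonneg_nonneg[OF abs_ge_zero[of K] \<delta>]
        by (simp add: algebra_simps)
      from this[of "1 / sqrt rate"] show ?thesis using rate_pos by simp
    qed
    finally have le2: "(LBINT s:{0..}. \<integral>\<omega>. exp (- s) * b \<omega> s \<partial>M) \<le> (2 * \<bar>L\<bar> + 2 * \<bar>K\<bar>) * (\<delta> + 1 / sqrt rate)" .
    have bnn: "0 \<le> b \<omega> s" for \<omega> s by (simp add: b_def)
    have "(LBINT s:{0..1}. \<integral>\<omega>. b \<omega> s \<partial>M) \<le> (LBINT s:{0..}. exp 1 * (\<integral>\<omega>. exp (- s) * b \<omega> s \<partial>M))"
      unfolding set_lebesgue_integral_def
    proof (rule integral_mono')
      show "integrable lborel (\<lambda>s. indicat_real {0..} s *\<^sub>R (exp 1 * (\<integral>\<omega>. exp (- s) * b \<omega> s \<partial>M)))"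
        using set_integrable_mult_right[of "exp 1 :: real", OF D(3)] by (simp add: set_integrable_def)
      fix s :: real
      have nn: "0 \<le> (\<integral>\<omega>. b \<omega> s \<partial>M)" using bnn by simp
      show "0 \<le> indicat_real {0..} s *\<^sub>R (exp 1 * (\<integral>\<omega>. exp (- s) * b \<omega> s \<partial>M))"
        using bnn by (intro scaleR_nonneg_nonneg mult_nonneg_nonneg integral_nonneg_AE) auto
      show "indicat_real {0..1} s *\<^sub>R (\<integral>\<omega>. b \<omega> s \<partial>M) \<le> indicat_real {0..} s *\<^sub>R (exp 1 * (\<integral>\<omega>. exp (- s) * b \<omega> s \<partial>M))"
      proof (cases "s \<in> {0..1}")
        case True
        have "1 * (\<integral>\<omega>. b \<omega> s \<partial>M) \<le> exp (1 - s) * (\<integral>\<omega>. b \<omega> s \<partial>M)"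
          using True nn by (intro mult_right_mono) auto
        then show ?thesis using True by (simp add: exp_diff exp_minus divide_inverse mult.assoc)
      next
        case False
        then show ?thesis using nn by (auto simp: indicator_def)
      qed
    qed
    also have "\<dots> = exp 1 * (LBINT s:{0..}. \<integral>\<omega>. exp (- s) * b \<omega> s \<partial>M)"
      by (rule set_integral_mult_right)
    also have "\<dots> \<le> exp 1 * ((2 * \<bar>L\<bar> + 2 * \<bar>K\<bar>) * (\<delta> + 1 / sqrt rate))"
      using le2 by (rule mult_left_mono) simp
    finally show ?thesis by (simp add: b_def mult.assoc)
  qed
  then show ?thesis by (intro exI[of _ ?K]) auto
qed

text \<open>The function \<open>u\<close> will be \<open>f\<close> at a rescaled argument: uniformly
  close to the step outside a small window, merely bounded inside. The time spent in the window is
  then paid for by \<open>small_ball_occupation\<close>.\<close>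

lemma occupation_approximation:
  "\<exists>K\<ge>0. \<forall>(M :: 'a measure) rate N \<kappa> z \<delta> u \<epsilon> C. poisson_process M rate N \<longrightarrow> \<kappa>\<^sup>2 = rate \<longrightarrow> 0 \<le> \<delta> \<longrightarrow> 0 \<le> C \<longrightarrow>
    u \<in> borel_measurable borel \<longrightarrow> (\<forall>y. \<bar>u y - indicator {0<..} y\<bar> \<le> \<epsilon> + C * indicator {-\<delta><..\<delta>} y) \<longrightarrow>
    (\<integral>\<omega>. \<bar>path_int (\<lambda>s. u (pos z \<kappa> (sgn_of N \<omega>) s)) 1 - occ z \<kappa> (sgn_of N \<omega>) 1\<bar> \<partial>M)
      \<le> \<epsilon> + C * (K * (\<delta> + 1 / sqrt rate))"
proof -
  obtain K where K0: "0 \<le> K" and K: "\<And>(M :: 'a measure) rate N \<kappa> z \<delta>. poisson_process M rate N \<Longrightarrow> \<kappa>\<^sup>2 = rate \<Longrightarrow> 0 \<le> \<delta> \<Longrightarrow>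
    (LBINT s:{0..1}. \<integral>\<omega>. indicator {-\<delta><..\<delta>} (pos z \<kappa> (sgn_of N \<omega>) s) \<partial>M) \<le> K * (\<delta> + 1 / sqrt rate)"
    using small_ball_occupation by blast
  have "(\<integral>\<omega>. \<bar>path_int (\<lambda>s. u (pos z \<kappa> (sgn_of N \<omega>) s)) 1 - occ z \<kappa> (sgn_of N \<omega>) 1\<bar> \<partial>M)
      \<le> \<epsilon> + C * (K * (\<delta> + 1 / sqrt rate))"
    if pp: "poisson_process M rate N" and \<kappa>: "\<kappa>\<^sup>2 = rate" and \<delta>: "0 \<le> \<delta>" and C: "0 \<le> C"
      and [measurable]: "u \<in> borel_measurable borel"
      and u: "\<And>y. \<bar>u y - indicator {0<..} y\<bar> \<le> \<epsilon> + C * indicator {-\<delta><..\<delta>} y"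
    for M :: "'a measure" and rate N \<kappa> z \<delta> u \<epsilon> C
  proof -
    interpret poisson_process M rate N by (rule pp)
    define b where "b \<omega> s = (indicator {-\<delta><..\<delta>} (pos z \<kappa> (path \<omega>) s) :: real)" for \<omega> s
    have bm [measurable]: "(\<lambda>(\<omega>, s). b \<omega> s) \<in> borel_measurable (M \<Otimes>\<^sub>M borel)"
      unfolding b_def case_prod_beta by measurable
    have be: "0 \<le> b \<omega> s" "b \<omega> s \<le> 1" for \<omega> s by (auto simp: b_def indicator_def)
    \<comment> \<open>The point \<open>\<delta> + 1\<close> lies outside the window, so the
      hypothesis there bounds an absolute value by \<open>\<epsilon>\<close> alone.\<close>
    have \<epsilon>: "0 \<le> \<epsilon>" using u[of "\<delta> + 1"] \<delta> by simp
    have ubd: "\<bar>u y\<bar> \<le> 1 + \<epsilon> + C" for y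
    proof -
      have "C * indicator {-\<delta><..\<delta>} y \<le> C" "\<bar>indicator {0<..} y :: real\<bar> \<le> 1" using C by (auto simp: indicator_def)
      then show ?thesis using u[of y] by linarith
    qed
    have bint: "(\<lambda>\<omega>. LBINT s:{0..1}. b \<omega> s) \<in> borel_measurable M"
      using path_int_measurable[OF bm, of "\<lambda>_. 1"] by (simp add: path_int_def)
    have bint_le: "\<bar>LBINT s:{0..1}. b \<omega> s\<bar> \<le> 1" if "\<omega> \<in> space M" for \<omega>
    proof -
      have "b \<omega> \<in> borel_measurable borel" using measurable_compose[OF measurable_Pair1'[OF that] bm] by simp
      then show ?thesis using abs_set_integral_Icc_le[of "b \<omega>" 1 0 1] be by (simp add: abs_le_iff)
    qed
    have path_le: "\<bar>path_int (\<lambda>s. u (pos z \<kappa> (path \<omega>) s)) 1 - occ z \<kappa> (path \<omega>) 1\<bar> \<le> \<epsilon> + C * (LBINT s:{0..1}. b \<omega> s)"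
      if \<omega>: "\<omega> \<in> space M" for \<omega>
    proof -
      interpret cp: counting_path "\<lambda>s. N s \<omega>" by (rule counting_path[OF \<omega>])
      let ?Z = "pos z \<kappa> (path \<omega>)"
      have i1: "set_integrable lborel {0..1} (\<lambda>s. u (?Z s))"
        using ubd by (intro set_integrable_bounded_Icc) auto
      have i2: "set_integrable lborel {0..1} (\<lambda>s. indicator {0<..} (?Z s) :: real)"
        by (rule set_integrable_bounded_Icc[where B=1]) (auto simp: indicator_def)
      have i3: "set_integrable lborel {0..1} (\<lambda>s. b \<omega> s)"
        unfolding b_def by (rule set_integrable_bounded_Icc[where B=1]) (auto simp: indicator_def)
      have i4: "set_integrable lborel {0..1} (\<lambda>s. C * b \<omega> s)"
        using i3 by (rule set_integrable_mult_right)
      have eq: "path_int (\<lambda>s. u (?Z s)) 1 - occ z \<kappa> (path \<omega>) 1 = (LBINT s:{0..1}. u (?Z s) - indicator {0<..} (?Z s))"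
        unfolding occ_def path_int_def by (rule set_integral_diff(2)[OF i1 i2, symmetric])
      have "\<bar>path_int (\<lambda>s. u (?Z s)) 1 - occ z \<kappa> (path \<omega>) 1\<bar> \<le> (LBINT s:{0..1}. \<bar>u (?Z s) - indicator {0<..} (?Z s)\<bar>)"
        unfolding eq using set_integral_norm_bound[OF set_integral_diff(1)[OF i1 i2]] by simp
      also have "\<dots> \<le> (LBINT s:{0..1}. \<epsilon> + C * b \<omega> s)"
      proof (rule set_integral_mono)
        show "set_integrable lborel {0..1} (\<lambda>s. \<bar>u (?Z s) - indicator {0<..} (?Z s)\<bar>)"
          by (rule set_integrable_abs[OF set_integral_diff(1)[OF i1 i2]])
        show "set_integrable lborel {0..1} (\<lambda>s. \<epsilon> + C * b \<omega> s)"
          by (rule set_integral_add(1)[OF set_integrable_const_Icc i4])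
      qed (use u in \<open>simp add: b_def\<close>)
      also have "\<dots> = (LBINT s:{0..1::real}. \<epsilon>) + (LBINT s:{0..1}. C * b \<omega> s)"
        by (rule set_integral_add(2)[OF set_integrable_const_Icc i4])
      also have "\<dots> = \<epsilon> + C * (LBINT s:{0..1}. b \<omega> s)"
        by (simp add: set_lebesgue_integral_def)
      finally show ?thesis .
    qed
    have "(\<integral>\<omega>. \<bar>path_int (\<lambda>s. u (pos z \<kappa> (path \<omega>) s)) 1 - occ z \<kappa> (path \<omega>) 1\<bar> \<partial>M)
        \<le> (\<integral>\<omega>. \<epsilon> + C * (LBINT s:{0..1}. b \<omega> s) \<partial>M)"
    proof (rule integral_mono_AE')
      show "integrable M (\<lambda>\<omega>. \<epsilon> + C * (LBINT s:{0..1}. b \<omega> s))"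
        using bint bint_le by (intro Bochner_Integration.integrable_add integrable_mult_right integrable_const integrable_const_bound[of _ 1]) auto
    qed (use path_le order_trans[OF abs_ge_zero path_le] in auto)
    also have "\<dots> = \<epsilon> + C * expectation (\<lambda>\<omega>. LBINT s:{0..1}. b \<omega> s)"
    proof -
      have "integrable M (\<lambda>\<omega>. LBINT s:{0..1}. b \<omega> s)"
        using bint bint_le by (intro integrable_const_bound[of _ 1]) auto
      then show ?thesis by (simp add: prob_space)
    qed
    also have "expectation (\<lambda>\<omega>. LBINT s:{0..1}. b \<omega> s) = (LBINT s:{0..1}. \<integral>\<omega>. b \<omega> s \<partial>M)"
      by (rule Fubini_Icc[OF bm, of 1, symmetric]) (use be in \<open>auto simp: abs_le_iff\<close>)
    also have "\<dots> \<le> K * (\<delta> + 1 / sqrt rate)" unfolding b_def by (rule K[OF pp \<kappa> \<delta>])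
    finally show ?thesis using C by (simp add: mult_left_mono)
  qed
  then show ?thesis using K0 by (intro exI[of _ K]) auto
qed

section \<open>Laplace transforms of the arcsine and the hitting time laws\<close>

text \<open>The substitution \<open>S = sqrt (y / (1 - y))\<close> makes the integrand a multiple of
  \<open>1 / (1 + (r * S)^2)\<close>, whence the arctangent primitive. The case
  \<open>\<alpha> = 1\<close>, \<open>\<theta> = 0\<close> shows that the density has total mass
  1.\<close>

lemma arcsine_transform:
  assumes \<alpha>: "0 < \<alpha>" and \<theta>: "0 \<le> \<theta>"
  shows "has_bochner_integral lborel (\<lambda>y. arcsine_density y * (1 / (\<alpha> + \<theta> * y))) (1 / sqrt (\<alpha> * (\<alpha> + \<theta>)))"
proof -
  define r where "r = sqrt ((\<alpha> + \<theta>) / \<alpha>)"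
  define c where "c = 2 / (pi * sqrt (\<alpha> * (\<alpha> + \<theta>)))"
  define G where "G y = c * arctan (r * sqrt (y / (1 - y)))" for y
  define g where "g y = 1 / (pi * sqrt (y * (1 - y))) * (1 / (\<alpha> + \<theta> * y))" for y
  have r: "0 < r" "r\<^sup>2 = (\<alpha> + \<theta>) / \<alpha>" using \<alpha> \<theta> by (auto simp: r_def)
  have rc: "c * r * \<alpha> = 2 / pi"
  proof -
    have "sqrt (\<alpha> * (\<alpha> + \<theta>)) = r * \<alpha>"
    proof (rule real_sqrt_unique)
      show "(r * \<alpha>)\<^sup>2 = \<alpha> * (\<alpha> + \<theta>)"
        using \<alpha> by (simp only: power_mult_distrib r(2)) (simp add: power2_eq_square)
    qed (use r \<alpha> in simp)
    moreover have "sqrt (\<alpha> * (\<alpha> + \<theta>)) \<noteq> 0" using \<alpha> \<theta> by auto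
    ultimately show ?thesis by (simp add: c_def mult.assoc)
  qed
  have pos: "0 < \<alpha> + \<theta> * y" if "0 < y" for y using \<alpha> \<theta> that by (simp add: add_pos_nonneg)
  have D: "DERIV G y :> g y" if y: "0 < y" "y < 1" for y
  proof -
    define S where "S = sqrt (y / (1 - y))"
    have S: "0 < S" "S\<^sup>2 = y / (1 - y)" using y by (auto simp: S_def)
    have S': "sqrt (y * (1 - y)) = S * (1 - y)"
    proof (rule real_sqrt_unique)
      show "(S * (1 - y))\<^sup>2 = y * (1 - y)" using y by (simp only: power_mult_distrib S(2)) (simp add: power2_eq_square)
    qed (use S y in simp)
    have "((\<lambda>y. y / (1 - y)) has_real_derivative (1 / (1 - y)\<^sup>2)) (at y)"
      using y by (auto intro!: derivative_eq_intros simp: power2_eq_square field_simps)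
    from DERIV_chain2[OF DERIV_real_sqrt this] 
    have "((\<lambda>y. sqrt (y / (1 - y))) has_real_derivative (inverse S / 2 * (1 / (1 - y)\<^sup>2))) (at y)"
      using y by (simp add: S_def)
    then have "(G has_real_derivative c * (inverse (1 + (r * S)\<^sup>2) * (r * (inverse S / 2 * (1 / (1 - y)\<^sup>2))))) (at y)"
      unfolding G_def S_def by (intro DERIV_cmult DERIV_chain2[OF DERIV_arctan])
    moreover have "c * (inverse (1 + (r * S)\<^sup>2) * (r * (inverse S / 2 * (1 / (1 - y)\<^sup>2)))) = g y"
    proof -
      have "1 + (r * S)\<^sup>2 = (\<alpha> + \<theta> * y) / (\<alpha> * (1 - y))"
        using y \<alpha> by (simp only: power_mult_distrib r(2) S(2)) (simp add: field_simps)
      moreover have "c * (inverse (A / (\<alpha> * B)) * (r * (inverse S / 2 * (1 / B\<^sup>2))))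
          = (c * r * \<alpha>) / 2 * (1 / (S * B)) * (1 / A)" if "A \<noteq> 0" "B \<noteq> 0" for A B
        using that S(1) \<alpha> by (simp add: field_simps power2_eq_square)
      ultimately have "c * (inverse (1 + (r * S)\<^sup>2) * (r * (inverse S / 2 * (1 / (1 - y)\<^sup>2))))
          = (c * r * \<alpha>) / 2 * (1 / (S * (1 - y))) * (1 / (\<alpha> + \<theta> * y))"
        using y pos[of y] by simp
      also have "\<dots> = g y" unfolding rc g_def S' by simp
      finally show ?thesis .
    qed
    ultimately show ?thesis by simp
  qed
  have cont: "isCont g y" if "0 < y" "y < 1" for y
  proof -
    have "0 < sqrt (y * (1 - y))" using that by simp
    then show ?thesis using that pos[of y] unfolding g_def by (intro continuous_intros) auto
  qed
  have nn: "0 \<le> g y" if "0 < y" "y < 1" for y using pos[of y] that by (simp add: g_def)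
  have lim0: "(G \<longlongrightarrow> 0) (at_right 0)"
  proof -
    have "isCont G 0" unfolding G_def by (intro continuous_intros) auto
    then show ?thesis by (simp add: G_def isCont_def filterlim_at_split)
  qed
  have lim1: "(G \<longlongrightarrow> 1 / sqrt (\<alpha> * (\<alpha> + \<theta>))) (at_left 1)"
  proof -
    have "filterlim (\<lambda>y. 1 - y) (at_right 0) (at_left (1::real))"
      unfolding filterlim_at by (auto intro!: tendsto_eq_intros eventually_at_leftI[of 0])
    then have "filterlim (\<lambda>y. y / (1 - y)) at_top (at_left (1::real))"
      by (intro filterlim_tendsto_pos_mult_at_top[of "\<lambda>y. y" 1 "at_left 1" "\<lambda>y. inverse (1 - y)", unfolded divide_inverse[symmetric]]
          filterlim_compose[OF filterlim_inverse_at_top_right] tendsto_ident_at) auto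
    then have "filterlim (\<lambda>y. sqrt (y / (1 - y))) at_top (at_left (1::real))"
      by (rule filterlim_compose[OF sqrt_at_top])
    then have "filterlim (\<lambda>y. r * sqrt (y / (1 - y))) at_top (at_left (1::real))"
      by (rule filterlim_tendsto_pos_mult_at_top[OF tendsto_const r(1)])
    then have "((\<lambda>y. arctan (r * sqrt (y / (1 - y)))) \<longlongrightarrow> pi / 2) (at_left 1)"
      by (rule filterlim_compose[OF tendsto_arctan_at_top])
    then have "(G \<longlongrightarrow> c * (pi / 2)) (at_left 1)" unfolding G_def by (rule tendsto_mult_left)
    then show ?thesis by (simp add: c_def)
  qed
  \<comment> \<open>As the integrand is nonnegative, the limits of the primitive at the two singular
    ends yield integrability together with the value.\<close>
  have "set_integrable lborel (einterval (ereal 0) (ereal 1)) g"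
    "(LBINT y=ereal 0..ereal 1. g y) = 1 / sqrt (\<alpha> * (\<alpha> + \<theta>)) - 0"
    by (rule interval_integral_FTC_nonneg[of "ereal 0" "ereal 1" G g 0 "1 / sqrt (\<alpha> * (\<alpha> + \<theta>))"];
        use D cont nn lim0 lim1 in \<open>simp add: ereal_tendsto_simps\<close>)+
  then have "has_bochner_integral lborel (\<lambda>y. indicator {0<..<1} y *\<^sub>R g y) (1 / sqrt (\<alpha> * (\<alpha> + \<theta>)))"
    by (simp add: has_bochner_integral_iff set_integrable_def set_lebesgue_integral_def
        interval_lebesgue_integral_def einterval_eq)
  moreover have "indicator {0<..<1} y *\<^sub>R g y = arcsine_density y * (1 / (\<alpha> + \<theta> * y))" for y
    by (simp add: g_def arcsine_density_def indicator_def)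
  ultimately show ?thesis by simp
qed

lemma arcsine_density_nonneg: "0 \<le> arcsine_density y"
  by (simp add: arcsine_density_def)

text \<open>This is \<open>sqrt pi / 2\<close> times the error function.\<close>

definition gauss_primitive :: "real \<Rightarrow> real" where
  "gauss_primitive x = (LBINT t=ereal 0..ereal x. exp (- t\<^sup>2))"

lemma gauss_primitive_deriv: "(gauss_primitive has_real_derivative exp (- x\<^sup>2)) (at x)"
proof -
  have "(gauss_primitive has_vector_derivative exp (- x\<^sup>2)) (at x within {- \<bar>x\<bar> - 1..\<bar>x\<bar> + 1})"
    unfolding gauss_primitive_def
    by (rule interval_integral_FTC2) (auto intro!: continuous_intros)
  moreover have "at x within {- \<bar>x\<bar> - 1..\<bar>x\<bar> + 1} = at x"
    by (rule at_within_interior) (auto simp: abs_if)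
  ultimately show ?thesis by (simp add: has_real_derivative_iff_has_vector_derivative)
qed

lemma gauss_primitive_0 [simp]: "gauss_primitive 0 = 0"
  by (simp add: gauss_primitive_def)

lemma gauss_primitive_minus: "gauss_primitive (- x) = - gauss_primitive x"
proof -
  have "((\<lambda>x. gauss_primitive x + gauss_primitive (- x)) has_real_derivative 0) (at x)" for x
    by (rule derivative_eq_intros gauss_primitive_deriv DERIV_chain2[OF gauss_primitive_deriv] refl)+ simp
  then have "gauss_primitive x + gauss_primitive (- x) = gauss_primitive 0 + gauss_primitive (- 0)"
    by (intro DERIV_isconst_all) auto
  then show ?thesis by simp
qed

lemma gauss_primitive_at_top: "(gauss_primitive \<longlongrightarrow> sqrt pi / 2) at_top"
proof -
  have I: "set_integrable lborel {0..} (\<lambda>t::real. exp (- t\<^sup>2))" "(LBINT t:{0..}. exp (- t\<^sup>2)) = sqrt pi / 2"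
    using gaussian_moment_0 by (auto simp: has_bochner_integral_iff set_integrable_def set_lebesgue_integral_def)
  have "((\<lambda>x. LBINT t:{0..x}. exp (- t\<^sup>2)) \<longlongrightarrow> sqrt pi / 2) at_top"
    using tendsto_set_lebesgue_integral_at_top[of 0 lborel, OF _ I(1)] I(2) by simp
  then show ?thesis
  proof (rule Lim_transform_eventually)
    show "\<forall>\<^sub>F x in at_top. (LBINT t:{0..x}. exp (- t\<^sup>2)) = gauss_primitive x"
      using eventually_ge_at_top[of 0]
      by eventually_elim (simp add: gauss_primitive_def interval_integral_Icc)
  qed
qed

lemma gauss_primitive_at_bot: "(gauss_primitive \<longlongrightarrow> - (sqrt pi / 2)) at_bot"
proof -
  have "((\<lambda>x. - gauss_primitive (- x)) \<longlongrightarrow> - (sqrt pi / 2)) at_bot"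
    by (intro tendsto_minus filterlim_compose[OF gauss_primitive_at_top] filterlim_uminus_at_top_at_bot)
  then show ?thesis by (simp add: gauss_primitive_minus)
qed

text \<open>The primitive is a combination of two error functions with arguments
  \<open>c * sqrt u - d / sqrt u\<close> and \<open>- c * sqrt u - d / sqrt u\<close>. Completing
  squares, the prefactors \<open>exp (- 2 * c * d)\<close> and \<open>exp (2 * c * d)\<close> make
  both Gaussian factors equal to \<open>exp (- \<alpha> * u - d\<^sup>2 / u)\<close>; the terms with
  \<open>c\<close> cancel and those with \<open>d\<close> add up to the density.\<close>

lemma q_density_transform:
  assumes b: "0 < b" and \<alpha>: "0 \<le> \<alpha>"
  shows "has_bochner_integral lborel (\<lambda>u. indicator {0<..} u * q_density b u * exp (- \<alpha> * u)) (exp (- b * sqrt (2 * \<alpha>)))"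
proof -
  define c where "c = sqrt \<alpha>"
  define d where "d = b / sqrt 2"
  have c: "0 \<le> c" "c\<^sup>2 = \<alpha>" and d: "0 < d" "d\<^sup>2 = b\<^sup>2 / 2" using b \<alpha> by (auto simp: c_def d_def power_divide)
  have bc: "b * sqrt (2 * \<alpha>) = 2 * c * d"
    by (simp add: c_def d_def real_sqrt_mult field_simps)
  let ?e = gauss_primitive
  define x where "x u = c * sqrt u - d / sqrt u" for u
  define y where "y u = - c * sqrt u - d / sqrt u" for u
  define G where "G u = (1 / sqrt pi) * (exp (- 2 * c * d) * (?e (x u) + sqrt pi / 2) + exp (2 * c * d) * (?e (y u) + sqrt pi / 2))" for u
  define g where "g u = q_density b u * exp (- \<alpha> * u)" for u
  have D: "DERIV G u :> g u" if u: "0 < u" for u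
  proof -
    define s where "s = sqrt u"
    have s: "0 < s" "u = s\<^sup>2" using u by (auto simp: s_def)
    have dx: "(x has_real_derivative (c / (2 * s) + d / (2 * s ^ 3))) (at u)"
      unfolding x_def using u s
      by (auto intro!: derivative_eq_intros simp: s_def[symmetric] field_simps power2_eq_square power3_eq_cube)
    have dy: "(y has_real_derivative (- c / (2 * s) + d / (2 * s ^ 3))) (at u)"
      unfolding y_def using u s
      by (auto intro!: derivative_eq_intros simp: s_def[symmetric] field_simps power2_eq_square power3_eq_cube)
    have ex: "((\<lambda>u. ?e (x u) + sqrt pi / 2) has_real_derivative exp (- (x u)\<^sup>2) * (c / (2 * s) + d / (2 * s ^ 3))) (at u)"
      using DERIV_add[OF DERIV_chain2[OF gauss_primitive_deriv dx] DERIV_const] by simp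
    have ey: "((\<lambda>u. ?e (y u) + sqrt pi / 2) has_real_derivative exp (- (y u)\<^sup>2) * (- c / (2 * s) + d / (2 * s ^ 3))) (at u)"
      using DERIV_add[OF DERIV_chain2[OF gauss_primitive_deriv dy] DERIV_const] by simp
    have "(G has_real_derivative (1 / sqrt pi) * (exp (- 2 * c * d) * (exp (- (x u)\<^sup>2) * (c / (2 * s) + d / (2 * s ^ 3)))
       + exp (2 * c * d) * (exp (- (y u)\<^sup>2) * (- c / (2 * s) + d / (2 * s ^ 3))))) (at u)"
      unfolding G_def
      by (intro DERIV_cmult DERIV_add ex ey)
    moreover have "exp (- 2 * c * d) * exp (- (x u)\<^sup>2) = exp (- \<alpha> * u - d\<^sup>2 / u)"
      unfolding exp_add[symmetric] x_def s_def[symmetric] using s c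
      by (intro arg_cong[of _ _ exp]) (simp add: power2_eq_square field_simps)
    moreover have "exp (2 * c * d) * exp (- (y u)\<^sup>2) = exp (- \<alpha> * u - d\<^sup>2 / u)"
      unfolding exp_add[symmetric] y_def s_def[symmetric] using s c
      by (intro arg_cong[of _ _ exp]) (simp add: power2_eq_square field_simps)
    moreover have "(1 / sqrt pi) * (E * (c / (2 * s) + d / (2 * s ^ 3)) + E * (- c / (2 * s) + d / (2 * s ^ 3))) = d / (sqrt pi * s ^ 3) * E" for E
      by (simp add: field_simps)
    moreover have "g u = d / (sqrt pi * s ^ 3) * exp (- \<alpha> * u - d\<^sup>2 / u)"
    proof -
      have e1: "sqrt (2 * pi * u ^ 3) = sqrt 2 * sqrt pi * s ^ 3"
        by (simp add: real_sqrt_mult real_sqrt_power s_def)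
      have e2: "exp (- (b\<^sup>2 / (2 * u))) * exp (- \<alpha> * u) = exp (- \<alpha> * u - d\<^sup>2 / u)"
        unfolding exp_add[symmetric] d(2) by (intro arg_cong[of _ _ exp]) simp
      have e3: "b / (sqrt 2 * sqrt pi * s ^ 3) = d / (sqrt pi * s ^ 3)" by (simp add: d_def)
      have "g u = b / sqrt (2 * pi * u ^ 3) * (exp (- (b\<^sup>2 / (2 * u))) * exp (- \<alpha> * u))"
        by (simp add: g_def q_density_def)
      then show ?thesis unfolding e1 e2 e3 .
    qed
    ultimately show ?thesis by (simp add: mult.assoc[symmetric])
  qed
  have cont: "isCont g u" if "0 < u" for u
    using that unfolding g_def q_density_def by (intro continuous_intros) auto
  have nn: "0 \<le> g u" if "0 < u" for u using that b by (simp add: g_def q_density_def)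
  have sq0: "filterlim (\<lambda>u. sqrt u) (at_right 0) (at_right 0)"
    unfolding filterlim_at by (auto intro!: tendsto_eq_intros eventually_at_rightI[of 0 1])
  have dinf: "filterlim (\<lambda>u. - (d / sqrt u)) at_bot (at_right 0)"
  proof -
    have "filterlim (\<lambda>u. d * inverse (sqrt u)) at_top (at_right 0)"
      by (intro filterlim_tendsto_pos_mult_at_top[OF tendsto_const d(1)] filterlim_compose[OF filterlim_inverse_at_top_right sq0])
    then show ?thesis unfolding filterlim_uminus_at_top by (simp add: divide_inverse)
  qed
  have sqz: "((\<lambda>u. k * sqrt u) \<longlongrightarrow> 0) (at_right 0)" for k by (auto intro!: tendsto_eq_intros)
  have x0: "filterlim x at_bot (at_right 0)" "filterlim y at_bot (at_right 0)"
    unfolding x_def y_def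
    using filterlim_tendsto_add_at_bot_iff[THEN iffD2, OF sqz[of c] dinf]
      filterlim_tendsto_add_at_bot_iff[THEN iffD2, OF sqz[of "- c"] dinf] by simp_all
  have lim0: "(G \<longlongrightarrow> 0) (at_right 0)"
    unfolding G_def using x0
    by (auto intro!: tendsto_eq_intros filterlim_compose[OF gauss_primitive_at_bot])
  have dz: "((\<lambda>u. d / sqrt u) \<longlongrightarrow> 0) at_top"
    by (intro real_tendsto_divide_at_top[OF tendsto_const] sqrt_at_top)
  \<comment> \<open>The case \<open>c = 0\<close>, which gives the total mass of the hitting law, is
    separate: both arguments then tend to 0 instead of to opposite infinities.\<close>
  have lim1: "(G \<longlongrightarrow> exp (- 2 * c * d)) at_top"
  proof (cases "c = 0")
    case True
    have "(x \<longlongrightarrow> 0) at_top" "(y \<longlongrightarrow> 0) at_top"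
      unfolding x_def y_def using True tendsto_minus[OF dz] by simp_all
    then have "((\<lambda>u. ?e (x u)) \<longlongrightarrow> ?e 0) at_top" "((\<lambda>u. ?e (y u)) \<longlongrightarrow> ?e 0) at_top"
      by (simp_all only: isCont_tendsto_compose[OF DERIV_isCont[OF gauss_primitive_deriv]])
    then show ?thesis unfolding G_def using True by (auto intro!: tendsto_eq_intros simp: field_simps)
  next
    case False
    then have c0: "0 < c" using c by simp
    have cs: "filterlim (\<lambda>u. c * sqrt u) at_top at_top"
      by (rule filterlim_tendsto_pos_mult_at_top[OF tendsto_const c0 sqrt_at_top])
    then have "filterlim x at_top at_top"
      using filterlim_tendsto_add_at_top[OF tendsto_minus[OF dz] cs] by (simp add: x_def[abs_def] algebra_simps)
    moreover have "filterlim y at_bot at_top"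
      using filterlim_tendsto_add_at_bot_iff[OF tendsto_minus[OF dz], of "\<lambda>u. - (c * sqrt u)"] cs
      by (simp add: y_def[abs_def] filterlim_uminus_at_top algebra_simps)
    ultimately have "((\<lambda>u. ?e (x u)) \<longlongrightarrow> sqrt pi / 2) at_top" "((\<lambda>u. ?e (y u)) \<longlongrightarrow> - (sqrt pi / 2)) at_top"
      by (auto intro: filterlim_compose[OF gauss_primitive_at_top] filterlim_compose[OF gauss_primitive_at_bot])
    then show ?thesis unfolding G_def by (auto intro!: tendsto_eq_intros)
  qed
  have "set_integrable lborel (einterval (ereal 0) \<infinity>) g"
    "(LBINT u=ereal 0..\<infinity>. g u) = exp (- 2 * c * d) - 0"
    by (rule interval_integral_FTC_nonneg[of "ereal 0" \<infinity> G g 0 "exp (- 2 * c * d)"];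
        use D cont nn lim0 lim1 in \<open>simp add: ereal_tendsto_simps\<close>)+
  moreover have "einterval (ereal 0) \<infinity> = {0<..}" by (auto simp: einterval_def)
  ultimately have "has_bochner_integral lborel (\<lambda>u. indicator {0<..} u *\<^sub>R g u) (exp (- 2 * c * d))"
    by (simp add: has_bochner_integral_iff set_integrable_def set_lebesgue_integral_def
        interval_lebesgue_integral_def)
  then show ?thesis by (simp add: g_def mult.assoc bc)
qed

section \<open>The limit law as a mixture over a hitting time and an arcsine variable\<close>

definition arcsine_law :: "real measure" where
  "arcsine_law = density lborel (\<lambda>y. ennreal (arcsine_density y))"

text \<open>The law of the Brownian hitting time of the level \<open>b\<close>.\<close>

definition hitting_law :: "real \<Rightarrow> real measure" where
  "hitting_law b = (if b = 0 then return borel 0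
     else density lborel (\<lambda>u. ennreal (indicator {0<..} u * q_density b u)))"

lemma sets_arcsine_law [simp, measurable_cong]: "sets arcsine_law = sets borel"
  and space_arcsine_law [simp]: "space arcsine_law = UNIV"
  by (simp_all add: arcsine_law_def)

lemma sets_hitting_law [simp, measurable_cong]: "sets (hitting_law b) = sets borel"
  and space_hitting_law [simp]: "space (hitting_law b) = UNIV"
  by (simp_all add: hitting_law_def)

lemma q_density_nonneg: "0 \<le> b \<Longrightarrow> 0 < u \<Longrightarrow> 0 \<le> q_density b u"
  by (simp add: q_density_def)

lemma prob_space_arcsine: "prob_space arcsine_law"
proof
  have h: "has_bochner_integral lborel arcsine_density 1"
    using arcsine_transform[of 1 0] by simp
  have "emeasure arcsine_law (space arcsine_law) = (\<integral>\<^sup>+y. ennreal (arcsine_density y) \<partial>lborel)"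
    by (simp add: arcsine_law_def emeasure_density)
  also have "\<dots> = ennreal 1"
    using h by (subst nn_integral_eq_integral) (auto simp: has_bochner_integral_iff arcsine_density_nonneg)
  finally show "emeasure arcsine_law (space arcsine_law) = 1" by simp
qed

lemma arcsine_law_transform:
  assumes "0 < \<alpha>" "0 \<le> \<theta>"
  shows "(\<integral>y. 1 / (\<alpha> + \<theta> * y) \<partial>arcsine_law) = 1 / sqrt (\<alpha> * (\<alpha> + \<theta>))"
  using arcsine_transform[OF assms]
  unfolding arcsine_law_def by (subst integral_density) (auto simp: arcsine_density_nonneg has_bochner_integral_iff)

lemma AE_arcsine_law: "AE y in arcsine_law. 0 < y \<and> y < 1"
  unfolding arcsine_law_def by (subst AE_density) (auto simp: arcsine_density_def)

lemma hitting_law_integral: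
  assumes "0 < b" and [measurable]: "h \<in> borel_measurable borel"
  shows "(\<integral>u. h u \<partial>hitting_law b) = (\<integral>u. indicator {0<..} u * q_density b u * h u \<partial>lborel)"
  using assms(1) unfolding hitting_law_def
  by (simp, subst integral_density) (auto simp: indicator_def q_density_nonneg)

lemma prob_space_hitting:
  assumes "0 \<le> b"
  shows "prob_space (hitting_law b)"
proof (cases "b = 0")
  case True
  then show ?thesis by (simp add: hitting_law_def prob_space_return)
next
  case False
  then have h: "has_bochner_integral lborel (\<lambda>u. indicator {0<..} u * q_density b u) 1"
    using q_density_transform[of b 0] assms by simp
  show ?thesis
  proof
    have "emeasure (hitting_law b) (space (hitting_law b)) = (\<integral>\<^sup>+u. ennreal (indicator {0<..} u * q_density b u) \<partial>lborel)"
      using False by (simp add: hitting_law_def emeasure_density)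
    also have "\<dots> = ennreal 1"
      using h assms by (subst nn_integral_eq_integral) (auto simp: has_bochner_integral_iff indicator_def q_density_nonneg)
    finally show "emeasure (hitting_law b) (space (hitting_law b)) = 1" by simp
  qed
qed

lemma hitting_law_transform:
  assumes "0 \<le> b" "0 \<le> \<alpha>"
  shows "(\<integral>u. exp (- \<alpha> * u) \<partial>hitting_law b) = exp (- b * sqrt (2 * \<alpha>))"
proof (cases "b = 0")
  case True
  then show ?thesis by (simp add: hitting_law_def integral_return)
next
  case False
  then show ?thesis
    using q_density_transform[of b \<alpha>] assms
    by (subst hitting_law_integral) (auto simp: has_bochner_integral_iff)
qed

lemma AE_hitting_law: "0 \<le> b \<Longrightarrow> AE u in hitting_law b. 0 \<le> u"
  unfolding hitting_law_def by (auto simp: AE_return AE_density indicator_def intro!: AE_I2)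

text \<open>For Brownian motion started at \<open>- b\<close>: the hitting time of 0 together with
  an independent arcsine variable, the positive fraction of the remaining time.\<close>

definition excursion_law :: "real \<Rightarrow> (real \<times> real) measure" where
  "excursion_law b = hitting_law b \<Otimes>\<^sub>M arcsine_law"

lemma sets_excursion_law [simp, measurable_cong]: "sets (excursion_law b) = sets (borel \<Otimes>\<^sub>M borel)"
  unfolding excursion_law_def by (intro sets_pair_measure_cong) simp_all

lemma space_excursion_law [simp]: "space (excursion_law b) = UNIV"
  by (simp add: excursion_law_def space_pair_measure)

lemma prob_space_excursion: "0 \<le> b \<Longrightarrow> prob_space (excursion_law b)"
  unfolding excursion_law_def
  by (intro prob_space_pair prob_space_hitting prob_space_arcsine)

lemma AE_excursion_law:
  assumes "0 \<le> b"
  shows "AE p in excursion_law b. 0 \<le> fst p \<and> 0 < snd p \<and> snd p < 1"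
proof -
  interpret H: prob_space "hitting_law b" by (rule prob_space_hitting[OF assms])
  interpret A: prob_space arcsine_law by (rule prob_space_arcsine)
  interpret P: pair_sigma_finite "hitting_law b" arcsine_law ..
  have "AE p in hitting_law b \<Otimes>\<^sub>M arcsine_law. 0 \<le> fst p \<and> 0 < snd p \<and> snd p < 1"
  proof (rule P.AE_pair_measure)
    show "{p \<in> space (hitting_law b \<Otimes>\<^sub>M arcsine_law). 0 \<le> fst p \<and> 0 < snd p \<and> snd p < 1} \<in> sets (hitting_law b \<Otimes>\<^sub>M arcsine_law)"
      by measurable
    show "AE u in hitting_law b. AE y in arcsine_law. 0 \<le> fst (u, y) \<and> 0 < snd (u, y) \<and> snd (u, y) < 1"
      using AE_hitting_law[OF assms] by eventually_elim (use AE_arcsine_law in auto)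
  qed
  then show ?thesis unfolding excursion_law_def .
qed

text \<open>Hitting times beyond 1 produce the atom at 0. Given a hitting time \<open>u\<close>
  below 1, the scaled arcsine variable has density
  \<open>arcsine_density (y / (1 - u)) / (1 - u)\<close>, and exchanging the integrals over
  \<open>u\<close> and \<open>y\<close> produces \<open>Y_density\<close>.\<close>

lemma Y_law_eq_distr_pos:
  assumes b: "0 < b"
  shows "Y_law b = distr (excursion_law b) borel (\<lambda>(u, s). max (1 - u) 0 * s)"
proof (rule measure_eqI)
  fix B assume "B \<in> sets (Y_law b)"
  then have B [measurable]: "B \<in> sets borel" by simp
  interpret H: prob_space "hitting_law b" by (rule prob_space_hitting) (use b in simp)
  interpret A: prob_space arcsine_law by (rule prob_space_arcsine)
  interpret P: pair_sigma_finite "hitting_law b" arcsine_law ..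
  let ?q = "\<lambda>u. ennreal (q_density b u)" and ?p = "\<lambda>y. ennreal (arcsine_density y)"
  define k where "k u y = q_density b u / (1 - u) * arcsine_density (y / (1 - u))" for u y
  have knn: "0 \<le> k u y" if "0 < u" "u < 1" for u y
    using that b by (simp add: k_def q_density_nonneg arcsine_density_nonneg)
  have kz: "k u y = 0" if "0 < u" "u < 1" "\<not> (0 < y \<and> u < 1 - y)" for u y
    using that by (auto simp: k_def arcsine_density_def field_simps)
  have [measurable]: "(\<lambda>(u, y). k u y) \<in> borel_measurable (borel \<Otimes>\<^sub>M borel)"
    unfolding k_def by measurable
  define R where "R = (\<integral>\<^sup>+u. indicator {0<..<1} u * (\<integral>\<^sup>+y. ennreal (k u y) * indicator B y \<partial>lborel) \<partial>lborel)"
  have arc1: "(\<integral>\<^sup>+s. ?p s \<partial>lborel) = 1"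
    using A.emeasure_space_1 by (simp add: arcsine_law_def emeasure_density)
  \<comment> \<open>The conditional law given the hitting time \<open>u\<close>: a unit mass at 0
    from time 1 on, and before that an arcsine law stretched by \<open>1 - u\<close>.\<close>
  have inner: "(\<integral>\<^sup>+s. indicator B (max (1 - u) 0 * s) \<partial>arcsine_law) =
     (if 1 \<le> u then indicator B 0 else (\<integral>\<^sup>+y. ennreal (1 / (1 - u) * arcsine_density (y / (1 - u))) * indicator B y \<partial>lborel))"
    if u: "0 < u" for u
  proof -
    have "(\<integral>\<^sup>+s. indicator B (max (1 - u) 0 * s) \<partial>arcsine_law) = (\<integral>\<^sup>+s. ?p s * indicator B (max (1 - u) 0 * s) \<partial>lborel)"
      unfolding arcsine_law_def by (subst nn_integral_density) auto
    also have "\<dots> = (if 1 \<le> u then indicator B 0 else (\<integral>\<^sup>+y. ennreal (1 / (1 - u) * arcsine_density (y / (1 - u))) * indicator B y \<partial>lborel))"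
    proof (cases "1 \<le> u")
      case True
      then show ?thesis using arc1 by (simp add: max_def nn_integral_multc)
    next
      case False
      then have u1: "0 < 1 - u" by simp
      have "(\<integral>\<^sup>+y. ennreal (1 / (1 - u) * arcsine_density (y / (1 - u))) * indicator B y \<partial>lborel)
        = ennreal \<bar>1 - u\<bar> * (\<integral>\<^sup>+s. ennreal (1 / (1 - u) * arcsine_density ((0 + (1 - u) * s) / (1 - u))) * indicator B (0 + (1 - u) * s) \<partial>lborel)"
        by (rule nn_integral_real_affine) (use u1 in auto)
      also have "\<dots> = (\<integral>\<^sup>+s. ennreal (1 - u) * (ennreal (1 / (1 - u) * arcsine_density s) * indicator B ((1 - u) * s)) \<partial>lborel)"
        using u1 by (subst nn_integral_cmult) auto
      also have "\<dots> = (\<integral>\<^sup>+s. ?p s * indicator B ((1 - u) * s) \<partial>lborel)"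
      proof (rule nn_integral_cong)
        fix s
        have "ennreal (1 - u) * ennreal (1 / (1 - u) * arcsine_density s) = ?p s"
          using u1 by (subst ennreal_mult[symmetric]) (auto simp: arcsine_density_nonneg)
        then show "ennreal (1 - u) * (ennreal (1 / (1 - u) * arcsine_density s) * indicator B ((1 - u) * s)) = ?p s * indicator B ((1 - u) * s)"
          by (simp add: mult.assoc[symmetric])
      qed
      finally show ?thesis using u1 by simp
    qed
    finally show ?thesis .
  qed
  have "emeasure (distr (excursion_law b) borel (\<lambda>(u, s). max (1 - u) 0 * s)) B
      = (\<integral>\<^sup>+p. indicator B (max (1 - fst p) 0 * snd p) \<partial>excursion_law b)"
    by (subst nn_integral_indicator[symmetric], simp, subst nn_integral_distr) (auto simp: case_prod_beta)
  also have "\<dots> = (\<integral>\<^sup>+u. \<integral>\<^sup>+s. indicator B (max (1 - u) 0 * s) \<partial>arcsine_law \<partial>hitting_law b)"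
    unfolding excursion_law_def by (subst A.nn_integral_fst[symmetric]) auto
  also have "\<dots> = (\<integral>\<^sup>+u. ennreal (indicator {0<..} u * q_density b u) * (\<integral>\<^sup>+s. indicator B (max (1 - u) 0 * s) \<partial>arcsine_law) \<partial>lborel)"
    using b unfolding hitting_law_def by (simp, subst nn_integral_density) auto
  also have "\<dots> = (\<integral>\<^sup>+u. ennreal (indicator {1..} u * q_density b u) * indicator B 0
      + indicator {0<..<1} u * (\<integral>\<^sup>+y. ennreal (k u y) * indicator B y \<partial>lborel) \<partial>lborel)"
  proof (rule nn_integral_cong)
    fix u :: real
    consider "u \<le> 0" | "0 < u" "u < 1" | "1 \<le> u" by linarith
    then show "ennreal (indicator {0<..} u * q_density b u) * (\<integral>\<^sup>+s. indicator B (max (1 - u) 0 * s) \<partial>arcsine_law)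
      = ennreal (indicator {1..} u * q_density b u) * indicator B 0
      + indicator {0<..<1} u * (\<integral>\<^sup>+y. ennreal (k u y) * indicator B y \<partial>lborel)"
    proof cases
      case 2
      have "?q u * (\<integral>\<^sup>+y. ennreal (1 / (1 - u) * arcsine_density (y / (1 - u))) * indicator B y \<partial>lborel)
        = (\<integral>\<^sup>+y. ?q u * (ennreal (1 / (1 - u) * arcsine_density (y / (1 - u))) * indicator B y) \<partial>lborel)"
        by (subst nn_integral_cmult) auto
      also have "\<dots> = (\<integral>\<^sup>+y. ennreal (k u y) * indicator B y \<partial>lborel)"
      proof (rule nn_integral_cong)
        fix y
        have "?q u * ennreal (1 / (1 - u) * arcsine_density (y / (1 - u))) = ennreal (k u y)"
          using 2 b by (subst ennreal_mult[symmetric]) (auto simp: k_def q_density_nonneg arcsine_density_nonneg)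
        then show "?q u * (ennreal (1 / (1 - u) * arcsine_density (y / (1 - u))) * indicator B y) = ennreal (k u y) * indicator B y"
          by (simp add: mult.assoc[symmetric])
      qed
      finally show ?thesis using 2 inner[of u] by simp
    qed (use inner A.emeasure_space_1 in auto)
  qed
  also have "\<dots> = (\<integral>\<^sup>+u. ennreal (indicator {1..} u * q_density b u) \<partial>lborel) * indicator B 0 + R"
    unfolding R_def by (subst nn_integral_add) (auto simp: nn_integral_multc)
  also have "(\<integral>\<^sup>+u. ennreal (indicator {1..} u * q_density b u) \<partial>lborel) = ennreal (Y_atom b)"
  proof -
    have q: "integrable lborel (\<lambda>u. indicator {0<..} u * q_density b u)"
      using q_density_transform[OF b, of 0] by (simp add: has_bochner_integral_iff)
    \<comment> \<open>\<open>Y_atom\<close> integrates over the open half-line, the mixture over the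
      closed one; the endpoint is a null set.\<close>
    have i: "integrable lborel (\<lambda>u. indicator {1<..} u * q_density b u)"
      by (rule Bochner_Integration.integrable_bound[OF q]) (auto simp: indicator_def)
    have "(\<integral>\<^sup>+u. ennreal (indicator {1..} u * q_density b u) \<partial>lborel) = (\<integral>\<^sup>+u. ennreal (indicator {1<..} u * q_density b u) \<partial>lborel)"
      by (rule nn_integral_cong_AE, use AE_lborel_singleton[of "1::real"] in eventually_elim) (auto simp: indicator_def)
    also have "\<dots> = ennreal (\<integral>u. indicator {1<..} u * q_density b u \<partial>lborel)"
      by (rule nn_integral_eq_integral[OF i]) (use b in \<open>auto simp: indicator_def q_density_nonneg\<close>)
    finally show ?thesis by (simp add: Y_atom_def set_lebesgue_integral_def)
  qed
  also have "R = (\<integral>\<^sup>+y. ennreal (Y_density b y) * indicator B y \<partial>lborel)"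
  proof -
    define L where "L y = (\<integral>\<^sup>+u. indicator {0<..<1} u * ennreal (k u y) \<partial>lborel)" for y
    have [measurable]: "L \<in> borel_measurable borel" unfolding L_def by measurable
    have swap: "(\<integral>\<^sup>+u. indicator {0<..<1} u * (\<integral>\<^sup>+y. ennreal (k u y) * indicator C y \<partial>lborel) \<partial>lborel)
       = (\<integral>\<^sup>+y. L y * indicator C y \<partial>lborel)" if [measurable]: "C \<in> sets borel" for C
    proof -
      have "(\<integral>\<^sup>+u. indicator {0<..<1} u * (\<integral>\<^sup>+y. ennreal (k u y) * indicator C y \<partial>lborel) \<partial>lborel)
        = (\<integral>\<^sup>+u. \<integral>\<^sup>+y. indicator {0<..<1} u * (ennreal (k u y) * indicator C y) \<partial>lborel \<partial>lborel)"
        by (intro nn_integral_cong nn_integral_cmult[symmetric]) measurable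
      also have "\<dots> = (\<integral>\<^sup>+y. \<integral>\<^sup>+u. indicator {0<..<1} u * (ennreal (k u y) * indicator C y) \<partial>lborel \<partial>lborel)"
        by (rule lborel_pair.Fubini') measurable
      also have "\<dots> = (\<integral>\<^sup>+y. L y * indicator C y \<partial>lborel)"
        unfolding L_def by (intro nn_integral_cong) (subst nn_integral_multc[symmetric], auto simp: mult.assoc)
      finally show ?thesis .
    qed
    have "(\<integral>\<^sup>+y. L y \<partial>lborel) \<noteq> \<infinity>"
    proof -
      have "(\<integral>\<^sup>+y. L y \<partial>lborel) = (\<integral>\<^sup>+u. indicator {0<..<1} u * (\<integral>\<^sup>+y. ennreal (k u y) \<partial>lborel) \<partial>lborel)"
        using swap[of UNIV] by simp
      also have "\<dots> \<le> (\<integral>\<^sup>+u. ennreal (indicator {0<..} u * q_density b u) \<partial>lborel)"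
      proof (rule nn_integral_mono)
        fix u :: real
        have "(\<integral>\<^sup>+y. ennreal (k u y) \<partial>lborel) = ?q u" if u: "0 < u" "u < 1"
        proof -
          have "(\<integral>\<^sup>+y. ennreal (k u y) \<partial>lborel) = ennreal \<bar>1 - u\<bar> * (\<integral>\<^sup>+s. ennreal (k u (0 + (1 - u) * s)) \<partial>lborel)"
            by (rule nn_integral_real_affine) (use u in auto)
          also have "\<dots> = ennreal (1 - u) * (\<integral>\<^sup>+s. ennreal (q_density b u / (1 - u)) * ?p s \<partial>lborel)"
            using u b by (simp add: k_def ennreal_mult q_density_nonneg arcsine_density_nonneg flip: ennreal_mult)
          also have "\<dots> = ennreal (1 - u) * ennreal (q_density b u / (1 - u))"
            using arc1 by (subst nn_integral_cmult) auto
          also have "\<dots> = ?q u"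
            using u b by (subst ennreal_mult[symmetric]) (auto simp: q_density_nonneg)
          finally show ?thesis .
        qed
        then show "indicator {0<..<1} u * (\<integral>\<^sup>+y. ennreal (k u y) \<partial>lborel) \<le> ennreal (indicator {0<..} u * q_density b u)"
          by (auto simp: indicator_def)
      qed
      also have "\<dots> = 1"
        using H.emeasure_space_1 b by (simp add: hitting_law_def emeasure_density)
      finally show ?thesis by (auto simp: top_unique)
    qed
    \<comment> \<open>\<open>Y_density\<close> is a Bochner integral and would be 0 at a point of
      divergence, whereas \<open>L\<close> would be infinite there. The finite total mass of
      \<open>L\<close> confines such points to a null set.\<close>
    then have "AE y in lborel. L y \<noteq> \<infinity>" by (intro nn_integral_PInf_AE) auto
    then have "AE y in lborel. L y = ennreal (Y_density b y)"
    proof eventually_elim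
      case (elim y)
      show ?case
      proof (cases "0 < y \<and> y < 1")
        case True
        have "L y = (\<integral>\<^sup>+u. ennreal (indicator {0<..<1 - y} u * k u y) \<partial>lborel)"
          unfolding L_def
        proof (rule nn_integral_cong)
          fix u show "indicator {0<..<1} u * ennreal (k u y) = ennreal (indicator {0<..<1 - y} u * k u y)"
            using True kz[of u y] by (auto simp: indicator_def)
        qed
        moreover have "(\<integral>\<^sup>+u. ennreal (indicator {0<..<1 - y} u * k u y) \<partial>lborel)
            = ennreal (\<integral>u. indicator {0<..<1 - y} u * k u y \<partial>lborel)"
        proof (rule nn_integral_eq_integral)
          show "AE u in lborel. 0 \<le> indicator {0<..<1 - y} u * k u y"
            using True knn by (auto simp: indicator_def)
          show "integrable lborel (\<lambda>u. indicator {0<..<1 - y} u * k u y)"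
          proof (rule integrableI_nonneg)
            show "AE u in lborel. 0 \<le> indicator {0<..<1 - y} u * k u y"
              using True knn by (auto simp: indicator_def)
            show "(\<integral>\<^sup>+u. ennreal (indicator {0<..<1 - y} u * k u y) \<partial>lborel) < \<infinity>"
              using elim calculation by (simp add: top.not_eq_extremum)
          qed measurable
        qed
        ultimately show ?thesis using True by (simp add: Y_density_def set_lebesgue_integral_def k_def)
      next
        case False
        have "L y = (\<integral>\<^sup>+u. 0 \<partial>(lborel :: real measure))" unfolding L_def
          by (rule nn_integral_cong) (use False kz[of _ y] in \<open>auto simp: indicator_def\<close>)
        moreover have "Y_density b y = 0" using False unfolding Y_density_def by (rule if_not_P)
        ultimately show ?thesis by simp
      qed
    qed
    then have "(\<integral>\<^sup>+y. L y * indicator B y \<partial>lborel) = (\<integral>\<^sup>+y. ennreal (Y_density b y) * indicator B y \<partial>lborel)"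
      by (intro nn_integral_cong_AE) auto
    then show ?thesis unfolding R_def using swap[OF B] by simp
  qed
  finally show "emeasure (Y_law b) B = emeasure (distr (excursion_law b) borel (\<lambda>(u, s). max (1 - u) 0 * s)) B"
    using b by (simp add: emeasure_Y_law[OF _ B])
qed simp

lemma Y_law_eq_distr:
  assumes b: "0 \<le> b"
  shows "Y_law b = distr (excursion_law b) borel (\<lambda>(u, s). max (1 - u) 0 * s)"
proof (cases "b = 0")
  case True
  interpret A: prob_space arcsine_law by (rule prob_space_arcsine)
  interpret H: prob_space "hitting_law 0" by (rule prob_space_hitting) simp
  show ?thesis
  proof (rule measure_eqI)
    fix B assume "B \<in> sets (Y_law b)"
    then have B [measurable]: "B \<in> sets borel" by simp
    have "emeasure (distr (excursion_law 0) borel (\<lambda>(u, s). max (1 - u) 0 * s)) B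
      = (\<integral>\<^sup>+p. indicator B (max (1 - fst p) 0 * snd p) \<partial>excursion_law 0)"
      by (subst nn_integral_indicator[symmetric], simp, subst nn_integral_distr) (auto simp: case_prod_beta)
    also have "\<dots> = (\<integral>\<^sup>+u. \<integral>\<^sup>+s. indicator B (max (1 - u) 0 * s) \<partial>arcsine_law \<partial>hitting_law 0)"
      unfolding excursion_law_def by (subst A.nn_integral_fst[symmetric]) auto
    also have "\<dots> = emeasure arcsine_law B"
      unfolding hitting_law_def by (simp, subst nn_integral_return) auto
    finally show "emeasure (Y_law b) B = emeasure (distr (excursion_law b) borel (\<lambda>(u, s). max (1 - u) 0 * s)) B"
      using True by (simp add: Y_law_def arcsine_law_def)
  qed simp
qed (use b in \<open>simp add: Y_law_eq_distr_pos\<close>)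

section \<open>The Laplace transform of the limit law in space and time\<close>

lemma abs_exp_diff_le:
  assumes "0 \<le> x" "0 \<le> (y::real)"
  shows "\<bar>exp (- x) - exp (- y)\<bar> \<le> \<bar>x - y\<bar>"
proof -
  have 1: "exp (- x) - exp (- y) \<le> y - x" if "0 \<le> x" "x \<le> y" for x y :: real
  proof -
    have "exp (- x) - exp (- y) = exp (- x) * (1 - exp (- (y - x)))"
      by (simp add: right_diff_distrib flip: exp_add)
    also have "\<dots> \<le> 1 * (y - x)"
    proof (rule mult_mono)
      show "1 - exp (- (y - x)) \<le> y - x" using exp_ge_add_one_self[of "- (y - x)"] by linarith
    qed (use that in auto)
    finally show ?thesis by simp
  qed
  show ?thesis
    using 1[of x y] 1[of y x] assms by (cases "x \<le> y") auto
qed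

text \<open>The absolute value makes the integrand bounded everywhere, not just almost everywhere.\<close>

definition limit_transform :: "real \<Rightarrow> real \<Rightarrow> real \<Rightarrow> real" where
  "limit_transform b \<theta> t = (\<integral>p. exp (- \<theta> * (max (t - fst p) 0 * \<bar>snd p\<bar>)) \<partial>excursion_law b)"

text \<open>The chosen \<open>p\<close> and \<open>q\<close> make the source identically 1, and then
  the value at 0 is \<open>1 / sqrt (\<alpha> * (\<alpha> + \<theta>))\<close>. The right-hand side
  is split at the hitting time: discounted time before it, and the arcsine contribution after
  it.\<close>

lemma step_resolvent_at_neg:
  assumes \<alpha>: "0 < \<alpha>" and \<theta>: "0 \<le> \<theta>" and b: "0 \<le> b"
  shows "step_resolvent \<alpha> \<theta> (1 / (\<alpha> + \<theta>)) (1 / \<alpha>) (- b)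
    = (1 - exp (- b * sqrt (2 * \<alpha>))) / \<alpha> + exp (- b * sqrt (2 * \<alpha>)) * (1 / sqrt (\<alpha> * (\<alpha> + \<theta>)))"
proof -
  define A where "A = sqrt \<alpha>"
  define C where "C = sqrt (\<alpha> + \<theta>)"
  have AC: "0 < A" "0 < C" "\<alpha> = A * A" "\<alpha> + \<theta> = C * C" using \<alpha> \<theta> by (auto simp: A_def C_def)
  have w0: "(sqrt (2 * (\<alpha> + \<theta>)) * (1 / (\<alpha> + \<theta>)) + sqrt (2 * \<alpha>) * (1 / \<alpha>)) / (sqrt (2 * \<alpha>) + sqrt (2 * (\<alpha> + \<theta>))) = 1 / (A * C)"
  proof -
    have "sqrt (2 * (\<alpha> + \<theta>)) * (1 / (\<alpha> + \<theta>)) + sqrt (2 * \<alpha>) * (1 / \<alpha>) = sqrt 2 * (1 / C + 1 / A)"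
    proof -
      have e1: "sqrt (2 * (\<alpha> + \<theta>)) * (1 / (\<alpha> + \<theta>)) = sqrt 2 * C * (1 / (C * C))"
        by (simp only: real_sqrt_mult C_def[symmetric] AC(4)[symmetric])
      have e2: "sqrt (2 * \<alpha>) * (1 / \<alpha>) = sqrt 2 * A * (1 / (A * A))"
        by (simp only: real_sqrt_mult A_def[symmetric] AC(3)[symmetric])
      show ?thesis unfolding e1 e2 using AC(1,2) by (simp add: field_simps)
    qed
    moreover have "sqrt (2 * \<alpha>) + sqrt (2 * (\<alpha> + \<theta>)) = sqrt 2 * (A + C)"
      by (simp only: A_def C_def real_sqrt_mult distrib_left[of "sqrt 2" "sqrt \<alpha>" "sqrt (\<alpha> + \<theta>)"])
    moreover have "(1 / C + 1 / A) / (A + C) = 1 / (A * C)"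
    proof -
      have "1 / C + 1 / A = (A + C) / (A * C)" using AC(1,2) by (simp add: field_simps)
      then show ?thesis using AC(1,2) by simp
    qed
    ultimately show ?thesis by simp
  qed
  have r: "sqrt (\<alpha> * (\<alpha> + \<theta>)) = A * C" by (simp add: real_sqrt_mult A_def C_def)
  have "step_resolvent \<alpha> \<theta> (1 / (\<alpha> + \<theta>)) (1 / \<alpha>) (- b) = 1 / \<alpha> + (1 / (A * C) - 1 / \<alpha>) * exp (sqrt (2 * \<alpha>) * - b)"
    unfolding step_resolvent_def Let_def w0 using b by simp
  then show ?thesis unfolding r using \<alpha> by (simp add: field_simps)
qed

text \<open>The time integral is taken inside for a fixed hitting time and a fixed fraction. The
  result is a function of the hitting time plus a product of functions of the two coordinates, so
  independence reduces it to the transforms of the hitting and the arcsine law.\<close>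

lemma limit_transform_laplace:
  assumes \<alpha>: "0 < \<alpha>" and \<theta>: "0 \<le> \<theta>" and b: "0 \<le> b"
  shows "set_integrable lborel {0..} (\<lambda>t. exp (- \<alpha> * t) * limit_transform b \<theta> t)"
    and "(LBINT t:{0..}. exp (- \<alpha> * t) * limit_transform b \<theta> t) = step_resolvent \<alpha> \<theta> (1 / (\<alpha> + \<theta>)) (1 / \<alpha>) (- b)"
proof -
  interpret E: prob_space "excursion_law b" by (rule prob_space_excursion[OF b])
  interpret H: prob_space "hitting_law b" by (rule prob_space_hitting[OF b])
  interpret A: prob_space arcsine_law by (rule prob_space_arcsine)
  interpret P: pair_sigma_finite "hitting_law b" arcsine_law ..
  define f where "f p t = exp (- \<alpha> * t) * exp (- \<theta> * (max (t - fst p) 0 * \<bar>snd p\<bar>))" for p :: "real \<times> real" and t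
  have m: "(\<lambda>(p, t). f p t) \<in> borel_measurable (excursion_law b \<Otimes>\<^sub>M borel)"
    unfolding f_def by measurable
  have le: "\<bar>f p t\<bar> \<le> 1 * exp (- \<alpha> * t)" for p t
    using \<theta> by (simp add: f_def)
  have F: "E.expectation (\<lambda>p. f p t) = exp (- \<alpha> * t) * limit_transform b \<theta> t" for t
    by (simp add: f_def limit_transform_def)
  note Fub = E.Fubini_halfline[OF m \<alpha> le, unfolded F]
  show "set_integrable lborel {0..} (\<lambda>t. exp (- \<alpha> * t) * limit_transform b \<theta> t)" by (rule Fub(1))
  \<comment> \<open>The maximum and the absolute value keep both factors bounded everywhere; they
    disappear almost surely.\<close>
  define e where "e u = exp (- \<alpha> * max u 0)" for u
  define g where "g s = 1 / (\<alpha> + \<theta> * \<bar>s\<bar>)" for s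
  have inner: "(LBINT t:{0..}. f (u, s) t) = (1 - e u) / \<alpha> + e u * g s" if u: "0 \<le> u" for u s
  proof -
    let ?\<gamma> = "\<alpha> + \<theta> * \<bar>s\<bar>"
    have \<gamma>: "0 < ?\<gamma>" using \<alpha> \<theta> by (simp add: add_pos_nonneg)
    \<comment> \<open>The exponential at rate \<open>\<alpha>\<close> over the time before
      \<open>u\<close>, plus an exponential at the larger rate \<open>?\<gamma>\<close> after
      \<open>u\<close>, scaled so that the two agree at \<open>u\<close>.\<close>
    have "has_bochner_integral lborel (\<lambda>t. indicator {0..} t * exp (- \<alpha> * t) - indicator {u..} t * exp (- \<alpha> * t)
        + exp (\<theta> * \<bar>s\<bar> * u) * (indicator {u..} t * exp (- ?\<gamma> * t)))
      (exp (- \<alpha> * 0) / \<alpha> - exp (- \<alpha> * u) / \<alpha> + exp (\<theta> * \<bar>s\<bar> * u) * (exp (- ?\<gamma> * u) / ?\<gamma>))"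
      by (intro has_bochner_integral_add has_bochner_integral_diff has_bochner_integral_mult_right
          has_bochner_integral_exp_Ici \<alpha> \<gamma>)
    moreover have "indicator {0..} t * exp (- \<alpha> * t) - indicator {u..} t * exp (- \<alpha> * t)
        + exp (\<theta> * \<bar>s\<bar> * u) * (indicator {u..} t * exp (- ?\<gamma> * t)) = indicator {0..} t * f (u, s) t" for t
    proof (cases "u \<le> t")
      case True
      have "exp (\<theta> * \<bar>s\<bar> * u) * exp (- ?\<gamma> * t) = f (u, s) t"
        using True unfolding f_def exp_add[symmetric] by (intro arg_cong[of _ _ exp]) (simp add: algebra_simps)
      then show ?thesis using True u by simp
    qed (simp add: f_def)
    moreover have "exp (\<theta> * \<bar>s\<bar> * u) * (exp (- ?\<gamma> * u) / ?\<gamma>) = e u * g s"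
    proof -
      have "exp (\<theta> * \<bar>s\<bar> * u) * exp (- ?\<gamma> * u) = e u"
        unfolding e_def exp_add[symmetric] using u by (intro arg_cong[of _ _ exp]) (simp add: algebra_simps)
      then show ?thesis by (simp add: g_def)
    qed
    ultimately have "has_bochner_integral lborel (\<lambda>t. indicator {0..} t * f (u, s) t) (1 / \<alpha> - e u / \<alpha> + e u * g s)"
      using u by (simp add: e_def)
    then show ?thesis by (simp add: has_bochner_integral_iff set_lebesgue_integral_def diff_divide_distrib)
  qed
  have eb: "\<bar>e u\<bar> \<le> 1" for u using \<alpha> by (simp add: e_def)
  have gb: "\<bar>g s\<bar> \<le> 1 / \<alpha>" for s
    using \<alpha> \<theta> unfolding g_def by (auto intro!: divide_left_mono mult_pos_pos add_pos_nonneg simp: abs_of_nonneg)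
  have [measurable]: "e \<in> borel_measurable borel" "g \<in> borel_measurable borel"
    unfolding e_def g_def by measurable
  have ie': "integrable (excursion_law b) (\<lambda>p. e (fst p))"
    by (rule E.integrable_const_bound[of _ 1]) (use eb in auto)
  have ieg: "integrable (excursion_law b) (\<lambda>p. e (fst p) * g (snd p))"
  proof (rule E.integrable_const_bound[of _ "1 * (1 / \<alpha>)"])
    have "\<bar>e (fst p) * g (snd p)\<bar> \<le> 1 * (1 / \<alpha>)" for p
      unfolding abs_mult by (intro mult_mono eb gb) auto
    then show "AE p in excursion_law b. norm (e (fst p) * g (snd p)) \<le> 1 * (1 / \<alpha>)" by simp
  qed measurable
  have prod: "(\<integral>p. h (fst p) * k (snd p) \<partial>excursion_law b) = (\<integral>u. h u \<partial>hitting_law b) * (\<integral>s. k s \<partial>arcsine_law)"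
    if "integrable (excursion_law b) (\<lambda>p. h (fst p) * k (snd p))" for h k :: "real \<Rightarrow> real"
    using P.integral_fst'[of "\<lambda>p. h (fst p) * k (snd p)"] that by (simp add: excursion_law_def)
  have Ee: "(\<integral>u. e u \<partial>hitting_law b) = exp (- b * sqrt (2 * \<alpha>))"
  proof -
    have "(\<integral>u. e u \<partial>hitting_law b) = (\<integral>u. exp (- \<alpha> * u) \<partial>hitting_law b)"
      by (rule integral_cong_AE, measurable, use AE_hitting_law[OF b] in eventually_elim) (simp add: e_def)
    then show ?thesis using hitting_law_transform[OF b, of \<alpha>] \<alpha> by simp
  qed
  have Eg: "(\<integral>s. g s \<partial>arcsine_law) = 1 / sqrt (\<alpha> * (\<alpha> + \<theta>))"
  proof -
    have "(\<integral>s. g s \<partial>arcsine_law) = (\<integral>s. 1 / (\<alpha> + \<theta> * s) \<partial>arcsine_law)"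
      by (rule integral_cong_AE, measurable, use AE_arcsine_law in eventually_elim) (simp add: g_def)
    then show ?thesis using arcsine_law_transform[OF \<alpha> \<theta>] by simp
  qed
  have "(LBINT t:{0..}. exp (- \<alpha> * t) * limit_transform b \<theta> t) = E.expectation (\<lambda>p. LBINT t:{0..}. f p t)"
    by (rule Fub(2))
  also have "\<dots> = E.expectation (\<lambda>p. (1 - e (fst p)) / \<alpha> + e (fst p) * g (snd p))"
  proof (rule integral_cong_AE)
    show "(\<lambda>p. LBINT t:{0..}. f p t) \<in> borel_measurable (excursion_law b)"
      using m unfolding set_lebesgue_integral_def by measurable
    show "AE p in excursion_law b. (LBINT t:{0..}. f p t) = (1 - e (fst p)) / \<alpha> + e (fst p) * g (snd p)"
      using AE_excursion_law[OF b] by eventually_elim (use inner in \<open>metis prod.collapse\<close>)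
  qed measurable
  also have "\<dots> = (1 - E.expectation (\<lambda>p. e (fst p))) / \<alpha> + E.expectation (\<lambda>p. e (fst p) * g (snd p))"
    using ie' ieg E.prob_space by (simp add: diff_divide_distrib)
  also have "E.expectation (\<lambda>p. e (fst p) * g (snd p)) = exp (- b * sqrt (2 * \<alpha>)) * (1 / sqrt (\<alpha> * (\<alpha> + \<theta>)))"
    unfolding prod[OF ieg] Ee Eg ..
  also have "E.expectation (\<lambda>p. e (fst p)) = exp (- b * sqrt (2 * \<alpha>))"
    using prod[of e "\<lambda>_. 1"] ie' Ee A.prob_space by simp
  finally show "(LBINT t:{0..}. exp (- \<alpha> * t) * limit_transform b \<theta> t) = step_resolvent \<alpha> \<theta> (1 / (\<alpha> + \<theta>)) (1 / \<alpha>) (- b)"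
    by (simp add: step_resolvent_at_neg[OF \<alpha> \<theta> b])
qed

lemma limit_transform_measurable [measurable]: "limit_transform b \<theta> \<in> borel_measurable borel"
  if "0 \<le> b"
proof -
  interpret E: prob_space "excursion_law b" by (rule prob_space_excursion[OF that])
  show ?thesis unfolding limit_transform_def by measurable
qed

lemma limit_transform_bounded:
  assumes "0 \<le> b" "0 \<le> \<theta>"
  shows "\<bar>limit_transform b \<theta> t\<bar> \<le> 1"
proof -
  interpret E: prob_space "excursion_law b" by (rule prob_space_excursion[OF assms(1)])
  show ?thesis unfolding limit_transform_def using assms(2) by (intro E.abs_expectation_le) auto
qed

lemma limit_transform_lipschitz:
  assumes b: "0 \<le> b" and \<theta>: "0 \<le> \<theta>"
  shows "\<bar>limit_transform b \<theta> t - limit_transform b \<theta> t'\<bar> \<le> \<theta> * \<bar>t - t'\<bar>"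
proof -
  interpret E: prob_space "excursion_law b" by (rule prob_space_excursion[OF b])
  let ?h = "\<lambda>t p. exp (- \<theta> * (max (t - fst p) 0 * \<bar>snd p\<bar>)) :: real"
  have i: "integrable (excursion_law b) (?h t)" for t
    by (rule E.integrable_const_bound[of _ 1]) (use \<theta> in auto)
  have "AE p in excursion_law b. \<bar>?h t p - ?h t' p\<bar> \<le> \<theta> * \<bar>t - t'\<bar>"
    using AE_excursion_law[OF b]
  proof eventually_elim
    case (elim p)
    have "\<bar>?h t p - ?h t' p\<bar> \<le> \<bar>\<theta> * (max (t - fst p) 0 * \<bar>snd p\<bar>) - \<theta> * (max (t' - fst p) 0 * \<bar>snd p\<bar>)\<bar>"
      using abs_exp_diff_le[of "\<theta> * (max (t - fst p) 0 * \<bar>snd p\<bar>)" "\<theta> * (max (t' - fst p) 0 * \<bar>snd p\<bar>)"] \<theta> by simp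
    also have "\<dots> = \<theta> * (\<bar>max (t - fst p) 0 - max (t' - fst p) 0\<bar> * \<bar>snd p\<bar>)"
      using \<theta> by (simp add: abs_mult flip: right_diff_distrib left_diff_distrib)
    also have "\<dots> \<le> \<theta> * (\<bar>t - t'\<bar> * 1)"
      using elim \<theta> by (intro mult_left_mono mult_mono) auto
    finally show ?case by simp
  qed
  then have "E.expectation (\<lambda>p. \<bar>?h t p - ?h t' p\<bar>) \<le> E.expectation (\<lambda>p. \<theta> * \<bar>t - t'\<bar>)"
    using i by (intro integral_mono_AE) auto
  moreover have "\<bar>limit_transform b \<theta> t - limit_transform b \<theta> t'\<bar> \<le> E.expectation (\<lambda>p. \<bar>?h t p - ?h t' p\<bar>)"
  proof -
    have "limit_transform b \<theta> t - limit_transform b \<theta> t' = E.expectation (\<lambda>p. ?h t p - ?h t' p)"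
      unfolding limit_transform_def by (rule Bochner_Integration.integral_diff[OF i i, symmetric])
    then show ?thesis
      using integral_norm_bound[of "excursion_law b" "\<lambda>p. ?h t p - ?h t' p"] by (simp only: real_norm_def)
  qed
  ultimately show ?thesis using E.prob_space by simp
qed

lemma Y_law_transform:
  assumes b: "0 \<le> b"
  shows "(\<integral>y. exp (- \<theta> * y) \<partial>Y_law b) = limit_transform b \<theta> 1"
proof -
  have "(\<integral>y. exp (- \<theta> * y) \<partial>Y_law b) = (\<integral>p. exp (- \<theta> * (max (1 - fst p) 0 * snd p)) \<partial>excursion_law b)"
    unfolding Y_law_eq_distr[OF b] by (subst integral_distr) (auto simp: case_prod_beta)
  also have "\<dots> = limit_transform b \<theta> 1"
    unfolding limit_transform_def
    by (rule integral_cong_AE, measurable, use AE_excursion_law[OF b] in eventually_elim) simp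
  finally show ?thesis .
qed

lemma prob_space_Y_law: "0 \<le> b \<Longrightarrow> prob_space (Y_law b)"
  unfolding Y_law_eq_distr
  by (rule prob_space.prob_space_distr[OF prob_space_excursion]) auto

lemma AE_Y_law:
  assumes b: "0 \<le> b"
  shows "AE y in Y_law b. 0 \<le> y \<and> y \<le> 1"
  unfolding Y_law_eq_distr[OF b]
proof (subst AE_distr_iff)
  show "AE p in excursion_law b. 0 \<le> (case p of (u, s) \<Rightarrow> max (1 - u) 0 * s) \<and> (case p of (u, s) \<Rightarrow> max (1 - u) 0 * s) \<le> 1"
    using AE_excursion_law[OF b]
  proof eventually_elim
    case (elim p)
    then have "max (1 - fst p) 0 * snd p \<le> 1 * 1" by (intro mult_mono) auto
    then show ?case using elim by (auto simp: case_prod_beta)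
  qed
qed auto

section \<open>Convergence from Laplace transforms\<close>

text \<open>Weierstrass approximation with explicit coefficients: substituting
  \<open>exp (- t)\<close> turns monomials into exponentials with integer rates, so transforms at
  integers suffice below.\<close>

lemma polynomial_approximation:
  fixes G :: "real \<Rightarrow> real"
  assumes "continuous_on {a..b} G" "0 < \<epsilon>"
  obtains c :: "nat \<Rightarrow> real" and n where "\<And>v. v \<in> {a..b} \<Longrightarrow> \<bar>G v - (\<Sum>k\<le>n. c k * v ^ k)\<bar> < \<epsilon>"
proof -
  obtain p where p: "real_polynomial_function p" "\<And>v. v \<in> {a..b} \<Longrightarrow> \<bar>G v - p v\<bar> < \<epsilon>"
    using Stone_Weierstrass_real_polynomial_function[of "{a..b}" G \<epsilon>] assms by auto
  then obtain c n where "p = (\<lambda>v. \<Sum>k\<le>n. c k * v ^ k)"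
    unfolding real_polynomial_function_iff_sum by blast
  then show ?thesis using that p(2) by auto
qed

text \<open>Testing against a bump around \<open>1\<close> that is a continuous function of \<open>exp (- t)\<close>, hence nearly a polynomial
  in it.\<close>

lemma tendsto_0_of_laplace:
  fixes u :: "'i \<Rightarrow> real \<Rightarrow> real"
  assumes ev: "\<forall>\<^sub>F i in F. u i \<in> borel_measurable borel \<and> (\<forall>t\<ge>0. \<bar>u i t\<bar> \<le> B) \<and>
      (\<forall>t\<ge>0. \<bar>u i t - u i 1\<bar> \<le> L * \<bar>t - 1\<bar>)"
    and lap: "\<And>n. 1 \<le> n \<Longrightarrow> ((\<lambda>i. LBINT t:{0..}. exp (- real n * t) * u i t) \<longlongrightarrow> 0) F"
  shows "((\<lambda>i. u i 1) \<longlongrightarrow> 0) F"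
proof (rule tendstoI)
  fix \<epsilon> :: real assume \<epsilon>: "0 < \<epsilon>"
  \<comment> \<open>Strictly positive majorants of \<open>L\<close> and \<open>B\<close>, because
    both occur as divisors in the choice of \<open>\<delta>\<close> and
    \<open>\<eta>\<close>.\<close>
  define L' where "L' = \<bar>L\<bar> + 1"
  define B' where "B' = \<bar>B\<bar> + 1"
  have L'0: "0 < L'" and B'0: "0 < B'" by (auto simp: L'_def B'_def)
  define \<delta> where "\<delta> = min 1 (\<epsilon> / (4 * L'))"
  have \<delta>: "0 < \<delta>" "\<delta> \<le> 1" "L' * \<delta> \<le> \<epsilon> / 4"
  proof -
    have "L' * \<delta> \<le> L' * (\<epsilon> / (4 * L'))" using L'0 unfolding \<delta>_def by (intro mult_left_mono) auto
    then show "L' * \<delta> \<le> \<epsilon> / 4" using L'0 by simp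
  qed (use \<epsilon> L'0 in \<open>auto simp: \<delta>_def\<close>)
  define h where "h t = max 0 (1 - \<bar>t - 1\<bar> / \<delta>)" for t :: real
  have h01: "0 \<le> h t" "h t \<le> 1" for t using \<delta> by (auto simp: h_def)
  have h_supp: "h t = 0" if "\<delta> \<le> \<bar>t - 1\<bar>" for t using that \<delta> by (auto simp: h_def field_simps)
  have [measurable]: "h \<in> borel_measurable borel" unfolding h_def by measurable
  have I1: "set_integrable lborel {0..} (\<lambda>t. exp (- 1 * t) * k t)"
    "\<bar>LBINT t:{0..}. exp (- 1 * t) * k t\<bar> \<le> C"
    if "k \<in> borel_measurable borel" "\<And>t. 0 \<le> t \<Longrightarrow> \<bar>k t\<bar> \<le> C" for k :: "real \<Rightarrow> real" and C
  proof -
    have "(\<lambda>t. exp (- 1 * t) * k t) \<in> borel_measurable borel" using that(1) by measurable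
    moreover have "\<bar>exp (- 1 * t) * k t\<bar> \<le> C * exp (- 1 * t)" if "0 \<le> t" for t
      using \<open>\<And>t. 0 \<le> t \<Longrightarrow> \<bar>k t\<bar> \<le> C\<close>[OF that] by (simp add: abs_mult)
    ultimately show "set_integrable lborel {0..} (\<lambda>t. exp (- 1 * t) * k t)"
      "\<bar>LBINT t:{0..}. exp (- 1 * t) * k t\<bar> \<le> C"
      using set_integrable_exp_bound[of 1 "\<lambda>t. exp (- 1 * t) * k t" C] by simp_all
  qed
  define c0 where "c0 = (LBINT t:{0..}. exp (- 1 * t) * h t)"
  have c0: "0 < c0"
  proof -
    \<comment> \<open>On the middle half of the bump \<open>h\<close> is at least 1/2, and
      \<open>\<delta> \<le> 1\<close> keeps \<open>t\<close> below 2 there, so the exponential is at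
      least \<open>exp (- 2)\<close>.\<close>
    have "exp (- 2) / 2 * \<delta> = (LBINT t:{1 - \<delta>/2..1 + \<delta>/2}. exp (- 2) / 2)"
      using \<delta> by (simp add: set_lebesgue_integral_def)
    also have "\<dots> \<le> (LBINT t:{0..}. exp (- 1 * t) * h t)"
      unfolding set_lebesgue_integral_def
    proof (rule integral_mono')
      show "integrable lborel (\<lambda>t. indicat_real {0..} t *\<^sub>R (exp (- 1 * t) * h t))"
        using I1(1)[of h 1] h01 by (simp add: set_integrable_def abs_of_nonneg)
      fix t :: real
      show "0 \<le> indicat_real {0..} t *\<^sub>R (exp (- 1 * t) * h t)" using h01 by simp
      show "indicat_real {1 - \<delta>/2..1 + \<delta>/2} t *\<^sub>R (exp (- 2) / 2) \<le> indicat_real {0..} t *\<^sub>R (exp (- 1 * t) * h t)"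
      proof (cases "t \<in> {1 - \<delta>/2..1 + \<delta>/2}")
        case True
        then have "t - 1 \<le> \<delta> / 2" "- (t - 1) \<le> \<delta> / 2" by auto
        then have "\<bar>t - 1\<bar> \<le> \<delta> / 2" by (rule abs_leI)
        then have "\<bar>t - 1\<bar> / \<delta> \<le> 1 / 2" using \<delta>(1) by (simp add: field_simps)
        then have "1 / 2 \<le> h t" unfolding h_def by linarith
        moreover have "exp (- 2) \<le> exp (- 1 * t)" "0 \<le> t" using True \<delta> by auto
        ultimately have "exp (- 2) * (1 / 2) \<le> exp (- 1 * t) * h t" by (intro mult_mono) auto
        then show ?thesis using True \<open>0 \<le> t\<close> by simp
      qed (use h01 in simp)
    qed
    finally show ?thesis unfolding c0_def using \<delta>(1) by (smt (verit) exp_gt_zero mult_pos_pos zero_less_divide_iff)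
  qed
  \<comment> \<open>Since \<open>\<delta> \<le> 1\<close>, the bump vanishes from time 2 on. Cutting
    the logarithm off at time 3 therefore changes nothing, and it makes \<open>G\<close> continuous
    at 0.\<close>
  define G where "G v = h (- ln (max v (exp (- 3))))" for v
  have "continuous_on {0..1} G"
    unfolding G_def h_def using \<delta>(1)
    by (intro continuous_intros) (auto simp: max_def not_le intro: order_less_le_trans[OF exp_gt_zero])
  moreover define \<eta> where "\<eta> = c0 * \<epsilon> / (4 * B')"
  have \<eta>: "0 < \<eta>" "\<eta> * B' = c0 * \<epsilon> / 4" using c0 \<epsilon> B'0 by (auto simp: \<eta>_def)
  ultimately obtain c n where P: "\<And>v. v \<in> {0..1} \<Longrightarrow> \<bar>G v - (\<Sum>k\<le>n. c k * v ^ k)\<bar> < \<eta>"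
    using polynomial_approximation by blast
  define p where "p t = (\<Sum>k\<le>n. c k * exp (- t) ^ k)" for t
  have hp: "\<bar>h t - p t\<bar> \<le> \<eta>" if "0 \<le> t" for t
  proof -
    have "G (exp (- t)) = h t"
    proof (cases "t \<le> 3")
      case False
      then have "max (exp (- t)) (exp (- 3)) = exp (- 3)" by simp
      then show ?thesis using False \<delta> h_supp[of t] h_supp[of 3] by (simp add: G_def)
    qed (simp add: G_def max_def)
    then show ?thesis using P[of "exp (- t)"] that by (simp add: p_def)
  qed
  have [measurable]: "p \<in> borel_measurable borel" unfolding p_def by measurable
  \<comment> \<open>The extra weight \<open>exp (- t)\<close> raises each rate by one, so that even
    the constant term of the polynomial falls under the hypothesis for rates at least 1.\<close>
  have "((\<lambda>i. \<Sum>k\<le>n. c k * (LBINT t:{0..}. exp (- real (Suc k) * t) * u i t)) \<longlongrightarrow> (\<Sum>k\<le>n. c k * 0)) F"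
    by (intro tendsto_sum tendsto_mult tendsto_const lap) simp
  then have "((\<lambda>i. \<Sum>k\<le>n. c k * (LBINT t:{0..}. exp (- real (Suc k) * t) * u i t)) \<longlongrightarrow> 0) F"
    by (simp only: mult_zero_right sum.neutral_const)
  from tendstoD[OF this, of "c0 * \<epsilon> / 4"]
  have "\<forall>\<^sub>F i in F. \<bar>\<Sum>k\<le>n. c k * (LBINT t:{0..}. exp (- real (Suc k) * t) * u i t)\<bar> < c0 * \<epsilon> / 4"
    using c0 \<epsilon> by (simp only: dist_real_def diff_zero) simp
  with ev show "\<forall>\<^sub>F i in F. dist (u i 1) 0 < \<epsilon>"
  proof eventually_elim
    case (elim i)
    then have [measurable]: "u i \<in> borel_measurable borel" and uB: "\<And>t. 0 \<le> t \<Longrightarrow> \<bar>u i t\<bar> \<le> B"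
      and uL: "\<And>t. 0 \<le> t \<Longrightarrow> \<bar>u i t - u i 1\<bar> \<le> L * \<bar>t - 1\<bar>" by auto
    have uB': "\<bar>u i t\<bar> \<le> B'" if "0 \<le> t" for t using uB[OF that] by (simp add: B'_def)
    have Ip: "(LBINT t:{0..}. exp (- 1 * t) * (p t * u i t)) = (\<Sum>k\<le>n. c k * (LBINT t:{0..}. exp (- real (Suc k) * t) * u i t))"
    proof -
      have Ik: "set_integrable lborel {0..} (\<lambda>t. exp (- real (Suc k) * t) * u i t)" for k
      proof (rule set_integrable_exp_bound(1)[of "real (Suc k)" _ B'])
        fix t :: real assume "0 \<le> t"
        then show "\<bar>exp (- real (Suc k) * t) * u i t\<bar> \<le> B' * exp (- real (Suc k) * t)"
          using uB'[of t] by (simp add: abs_mult)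
      qed simp_all
      have "(LBINT t:{0..}. exp (- 1 * t) * (p t * u i t)) = (LBINT t:{0..}. \<Sum>k\<le>n. c k * (exp (- real (Suc k) * t) * u i t))"
      proof (rule set_lebesgue_integral_cong)
        have "exp (- 1 * t) * (p t * u i t) = (\<Sum>k\<le>n. c k * (exp (- real (Suc k) * t) * u i t))" for t
        proof -
          have "exp (- real (Suc k) * t) = exp (- 1 * t) * exp (- t) ^ k" for k
            by (simp add: exp_of_nat_mult[symmetric] exp_add[symmetric] algebra_simps)
          then show ?thesis by (simp add: p_def sum_distrib_left sum_distrib_right mult_ac)
        qed
        then show "\<forall>t. t \<in> {0..} \<longrightarrow> exp (- 1 * t) * (p t * u i t) = (\<Sum>k\<le>n. c k * (exp (- real (Suc k) * t) * u i t))" by blast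
      qed simp
      also have "\<dots> = (\<Sum>k\<le>n. LBINT t:{0..}. c k * (exp (- real (Suc k) * t) * u i t))"
        unfolding set_lebesgue_integral_def scaleR_sum_right
        by (rule Bochner_Integration.integral_sum) (use Ik in \<open>auto simp: set_integrable_def mult.left_commute\<close>)
      finally show ?thesis by simp
    qed
    have e1: "\<bar>LBINT t:{0..}. exp (- 1 * t) * ((h t - p t) * u i t)\<bar> \<le> \<eta> * B'"
    proof (rule I1(2))
      fix t :: real assume "0 \<le> t"
      then show "\<bar>(h t - p t) * u i t\<bar> \<le> \<eta> * B'"
        unfolding abs_mult using hp uB' B'0 \<eta> by (intro mult_mono) auto
    qed measurable
    have hL: "\<bar>h t * (u i 1 - u i t)\<bar> \<le> h t * (\<epsilon> / 4)" if "0 \<le> t" for t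
    proof (cases "\<delta> \<le> \<bar>t - 1\<bar>")
      case False
      have "\<bar>u i 1 - u i t\<bar> \<le> L * \<bar>t - 1\<bar>" using uL[OF that] by (simp add: abs_minus_commute)
      also have "\<dots> \<le> L' * \<delta>" using False L'0 by (intro mult_mono) (auto simp: L'_def)
      also have "\<dots> \<le> \<epsilon> / 4" by (rule \<delta>(3))
      finally have "h t * \<bar>u i 1 - u i t\<bar> \<le> h t * (\<epsilon> / 4)" using h01(1) by (rule mult_left_mono)
      then show ?thesis unfolding abs_mult using h01(1)[of t] by (simp only: abs_of_nonneg)
    qed (simp add: h_supp)
    have ih: "set_integrable lborel {0..} (\<lambda>t. exp (- 1 * t) * h t)"
      by (rule I1(1)[of h 1]) (use h01 in \<open>auto simp: abs_of_nonneg\<close>)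
    have ihu: "set_integrable lborel {0..} (\<lambda>t. exp (- 1 * t) * (h t * u i t))"
    proof (rule I1(1))
      fix t :: real assume "0 \<le> t"
      then have "\<bar>h t\<bar> * \<bar>u i t\<bar> \<le> 1 * B'" using uB' h01 by (intro mult_mono) auto
      then show "\<bar>h t * u i t\<bar> \<le> B'" by (simp add: abs_mult)
    qed measurable
    have ipu: "set_integrable lborel {0..} (\<lambda>t. exp (- 1 * t) * (p t * u i t))"
    proof (rule I1(1))
      fix t :: real assume t: "0 \<le> t"
      have "\<bar>p t\<bar> \<le> 1 + \<eta>" using hp[OF t] h01[of t] by linarith
      then have "\<bar>p t\<bar> * \<bar>u i t\<bar> \<le> (1 + \<eta>) * B'" using uB'[OF t] \<eta> by (intro mult_mono) auto
      then show "\<bar>p t * u i t\<bar> \<le> (1 + \<eta>) * B'" by (simp add: abs_mult)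
    qed measurable
    have e2: "\<bar>LBINT t:{0..}. exp (- 1 * t) * (h t * (u i 1 - u i t))\<bar> \<le> \<epsilon> / 4 * c0"
    proof -
      have eq: "exp (- 1 * t) * (h t * (u i 1 - u i t)) = u i 1 * (exp (- 1 * t) * h t) - exp (- 1 * t) * (h t * u i t)" for t
        by (simp add: algebra_simps)
      have i: "set_integrable lborel {0..} (\<lambda>t. exp (- 1 * t) * (h t * (u i 1 - u i t)))"
        unfolding eq by (rule set_integral_diff(1)[OF set_integrable_mult_right[OF ih] ihu])
      have "\<bar>LBINT t:{0..}. exp (- 1 * t) * (h t * (u i 1 - u i t))\<bar>
          \<le> (LBINT t:{0..}. \<bar>exp (- 1 * t) * (h t * (u i 1 - u i t))\<bar>)"
        using set_integral_norm_bound[OF i] by simp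
      also have "\<dots> \<le> (LBINT t:{0..}. \<epsilon> / 4 * (exp (- 1 * t) * h t))"
      proof (rule set_integral_mono)
        show "set_integrable lborel {0..} (\<lambda>t. \<bar>exp (- 1 * t) * (h t * (u i 1 - u i t))\<bar>)"
          by (rule set_integrable_abs[OF i])
        show "set_integrable lborel {0..} (\<lambda>t. \<epsilon> / 4 * (exp (- 1 * t) * h t))"
          by (rule set_integrable_mult_right[OF ih])
        fix t :: real assume "t \<in> {0..}"
        then have "exp (- 1 * t) * \<bar>h t * (u i 1 - u i t)\<bar> \<le> exp (- 1 * t) * (h t * (\<epsilon> / 4))"
          using hL[of t] by (intro mult_left_mono) auto
        then show "\<bar>exp (- 1 * t) * (h t * (u i 1 - u i t))\<bar> \<le> \<epsilon> / 4 * (exp (- 1 * t) * h t)"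
          by (simp add: abs_mult mult_ac)
      qed
      also have "\<dots> = \<epsilon> / 4 * c0" unfolding c0_def by (rule set_integral_mult_right)
      finally show ?thesis .
    qed
    have "(LBINT t:{0..}. exp (- 1 * t) * (h t * (u i 1 - u i t))) = u i 1 * c0 - (LBINT t:{0..}. exp (- 1 * t) * (h t * u i t))"
    proof -
      have eq: "exp (- 1 * t) * (h t * (u i 1 - u i t)) = u i 1 * (exp (- 1 * t) * h t) - exp (- 1 * t) * (h t * u i t)" for t
        by (simp add: algebra_simps)
      show ?thesis unfolding eq c0_def
        by (subst set_integral_diff(2)[OF set_integrable_mult_right[OF ih] ihu]) (simp only: set_integral_mult_right)
    qed
    moreover have "(LBINT t:{0..}. exp (- 1 * t) * ((h t - p t) * u i t))
        = (LBINT t:{0..}. exp (- 1 * t) * (h t * u i t)) - (LBINT t:{0..}. exp (- 1 * t) * (p t * u i t))"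
    proof -
      have eq: "exp (- 1 * t) * ((h t - p t) * u i t) = exp (- 1 * t) * (h t * u i t) - exp (- 1 * t) * (p t * u i t)" for t
        by (simp add: algebra_simps)
      show ?thesis unfolding eq by (rule set_integral_diff(2)[OF ihu ipu])
    qed
    \<comment> \<open>Three errors of \<open>c0 * \<epsilon> / 4\<close> each: the variation of
      \<open>u i\<close> over the bump, the polynomial approximation of the bump, and the finitely
      many Laplace transforms.\<close>
    ultimately have "\<bar>u i 1 * c0\<bar> < \<epsilon> / 4 * c0 + \<eta> * B' + c0 * \<epsilon> / 4"
      using e1 e2 elim(2) Ip by linarith
    also have "\<dots> = (3 / 4 * \<epsilon>) * c0" using \<eta>(2) by simp
    finally have "\<bar>u i 1\<bar> * c0 < (3 / 4 * \<epsilon>) * c0" using c0 by (simp add: abs_mult)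
    then have "\<bar>u i 1\<bar> < 3 / 4 * \<epsilon>" using c0 by (simp only: mult_less_cancel_right_pos)
    then show ?case using \<epsilon> by simp
  qed
qed

text \<open>All the laws live on \<open>[- B, B]\<close>, where every continuous test function is
  uniformly close to a polynomial in \<open>exp (- y)\<close>; no separate tightness argument is
  involved.\<close>

lemma weak_conv_along_of_transforms:
  fixes X :: "'i \<Rightarrow> 'a \<Rightarrow> real" and M :: "'i \<Rightarrow> 'a measure"
  assumes ev: "\<forall>\<^sub>F i in F. prob_space (M i) \<and> X i \<in> borel_measurable (M i) \<and> (\<forall>\<omega>\<in>space (M i). \<bar>X i \<omega>\<bar> \<le> B)"
    and \<nu>: "prob_space \<nu>" "sets \<nu> = sets borel" "AE y in \<nu>. \<bar>y\<bar> \<le> B"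
    and conv: "\<And>n. ((\<lambda>i. \<integral>\<omega>. exp (- real n * X i \<omega>) \<partial>M i) \<longlongrightarrow> (\<integral>y. exp (- real n * y) \<partial>\<nu>)) F"
  shows "weak_conv_along (\<lambda>i. distr (M i) borel (X i)) \<nu> F"
  unfolding weak_conv_along_def
proof (intro allI impI)
  fix g :: "real \<Rightarrow> real" assume g: "continuous_on UNIV g \<and> bounded (range g)"
  interpret \<nu>: prob_space \<nu> by (rule \<nu>(1))
  have gm: "g \<in> borel_measurable borel" using g by (auto intro: borel_measurable_continuous_onI)
  obtain C where C: "\<And>y. \<bar>g y\<bar> \<le> C" using g by (auto simp: bounded_iff)
  show "((\<lambda>i. \<integral>y. g y \<partial>distr (M i) borel (X i)) \<longlongrightarrow> (\<integral>y. g y \<partial>\<nu>)) F"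
  proof (rule tendstoI)
    fix \<epsilon> :: real assume \<epsilon>: "0 < \<epsilon>"
    have "continuous_on {exp (- B)..exp B} (\<lambda>v. g (- ln v))"
      by (rule continuous_on_compose2[OF conjunct1[OF g]])
        (auto intro!: continuous_intros dest: order_less_le_trans[OF exp_gt_zero])
    then obtain c n where P: "\<And>v. v \<in> {exp (- B)..exp B} \<Longrightarrow> \<bar>g (- ln v) - (\<Sum>k\<le>n. c k * v ^ k)\<bar> < \<epsilon> / 4"
      using polynomial_approximation[of "exp (- B)" "exp B" "\<lambda>v. g (- ln v)" "\<epsilon> / 4"] \<epsilon> by auto
    define p where "p y = (\<Sum>k\<le>n. c k * exp (- real k * y))" for y
    have gp: "\<bar>g y - p y\<bar> \<le> \<epsilon> / 4" if "\<bar>y\<bar> \<le> B" for y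
    proof -
      have "exp (- y) ^ k = exp (- real k * y)" for k
        by (simp flip: exp_of_nat_mult)
      moreover have "exp (- y) \<in> {exp (- B)..exp B}" using that by auto
      ultimately show ?thesis using P[of "exp (- y)"] by (simp add: p_def)
    qed
    \<comment> \<open>Stated for an arbitrary probability space, because it is used both for the
      spaces \<open>M i\<close> and for the limit law with the identity as random variable.\<close>
    have close: "\<bar>(\<integral>\<omega>. g (Z \<omega>) \<partial>Q) - (\<Sum>k\<le>n. c k * (\<integral>\<omega>. exp (- real k * Z \<omega>) \<partial>Q))\<bar> \<le> \<epsilon> / 4"
      if Q: "prob_space Q" and Z [measurable]: "Z \<in> borel_measurable Q" and ZB: "AE \<omega> in Q. \<bar>Z \<omega>\<bar> \<le> B"
      for Q :: "'b measure" and Z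
    proof -
      interpret Q: prob_space Q by (rule Q)
      have ik: "integrable Q (\<lambda>\<omega>. exp (- real k * Z \<omega>))" for k
      proof (rule Q.integrable_const_bound[of _ "exp (real k * B)"])
        show "AE \<omega> in Q. norm (exp (- real k * Z \<omega>)) \<le> exp (real k * B)"
          using ZB
        proof eventually_elim
          case (elim \<omega>)
          have "real k * - Z \<omega> \<le> real k * B" using elim by (intro mult_left_mono) auto
          then show ?case by simp
        qed
      qed measurable
      have ig: "integrable Q (\<lambda>\<omega>. g (Z \<omega>))"
        by (rule Q.integrable_const_bound[of _ C]) (use C gm in auto)
      have ip: "integrable Q (\<lambda>\<omega>. p (Z \<omega>))" unfolding p_def using ik by simp
      have "(\<Sum>k\<le>n. c k * (\<integral>\<omega>. exp (- real k * Z \<omega>) \<partial>Q)) = (\<integral>\<omega>. p (Z \<omega>) \<partial>Q)"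
        unfolding p_def using ik by (subst Bochner_Integration.integral_sum) auto
      then have "(\<integral>\<omega>. g (Z \<omega>) \<partial>Q) - (\<Sum>k\<le>n. c k * (\<integral>\<omega>. exp (- real k * Z \<omega>) \<partial>Q)) = (\<integral>\<omega>. g (Z \<omega>) - p (Z \<omega>) \<partial>Q)"
        using ig ip by simp
      also have "\<bar>(\<integral>\<omega>. g (Z \<omega>) - p (Z \<omega>) \<partial>Q)\<bar> \<le> (\<integral>\<omega>. \<bar>g (Z \<omega>) - p (Z \<omega>)\<bar> \<partial>Q)"
        using integral_norm_bound[of Q "\<lambda>\<omega>. g (Z \<omega>) - p (Z \<omega>)"] by simp
      also have "\<dots> \<le> (\<integral>\<omega>. \<epsilon> / 4 \<partial>Q)"
        using ig ip ZB by (intro integral_mono_AE integrable_abs) (auto elim!: eventually_mono dest: gp)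
      finally show ?thesis by (simp add: Q.prob_space)
    qed
    have "((\<lambda>i. \<Sum>k\<le>n. c k * (\<integral>\<omega>. exp (- real k * X i \<omega>) \<partial>M i)) \<longlongrightarrow> (\<Sum>k\<le>n. c k * (\<integral>y. exp (- real k * y) \<partial>\<nu>))) F"
      by (intro tendsto_sum tendsto_mult tendsto_const conv)
    then have "\<forall>\<^sub>F i in F. dist (\<Sum>k\<le>n. c k * (\<integral>\<omega>. exp (- real k * X i \<omega>) \<partial>M i)) (\<Sum>k\<le>n. c k * (\<integral>y. exp (- real k * y) \<partial>\<nu>)) < \<epsilon> / 4"
      by (rule tendstoD) (use \<epsilon> in simp)
    with ev show "\<forall>\<^sub>F i in F. dist (\<integral>y. g y \<partial>distr (M i) borel (X i)) (\<integral>y. g y \<partial>\<nu>) < \<epsilon>"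
    proof eventually_elim
      case (elim i)
      have "(\<integral>y. g y \<partial>distr (M i) borel (X i)) = (\<integral>\<omega>. g (X i \<omega>) \<partial>M i)"
        using elim gm by (subst integral_distr) auto
      moreover have "\<bar>(\<integral>\<omega>. g (X i \<omega>) \<partial>M i) - (\<Sum>k\<le>n. c k * (\<integral>\<omega>. exp (- real k * X i \<omega>) \<partial>M i))\<bar> \<le> \<epsilon> / 4"
        using elim by (intro close) auto
      moreover have "\<bar>(\<integral>y. g y \<partial>\<nu>) - (\<Sum>k\<le>n. c k * (\<integral>y. exp (- real k * y) \<partial>\<nu>))\<bar> \<le> \<epsilon> / 4"
        using \<nu> by (intro close) (auto simp: measurable_ident_sets)
      ultimately show ?case using elim(2) \<epsilon> unfolding dist_real_def by linarith
    qed
  qed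
qed

section \<open>Convergence of occupation times\<close>

abbreviation scaled_functional :: "(real \<Rightarrow> real) \<Rightarrow> real \<Rightarrow> real \<Rightarrow> real \<Rightarrow> (real \<Rightarrow> real) \<Rightarrow> real" where
  "scaled_functional f S z \<kappa> d \<equiv> path_int (\<lambda>s. f (S * pos z \<kappa> d s)) 1"

section \<open>Rescaling of time and space\<close>

lemma poisson_process_rescale:
  assumes pp: "poisson_process M rate N" and T: "0 < T"
  shows "poisson_process M (rate * T) (\<lambda>s. N (T * s))"
proof -
  interpret poisson_process M rate N by (rule pp)
  show ?thesis
  proof
    show "0 < rate * T" using rate_pos T by simp
    show "N (T * t) \<in> measurable M (count_space UNIV)" if "0 \<le> t" for t
      using that T by (intro N_measurable) simp
    show "N (T * 0) \<omega> = 0" if "\<omega> \<in> space M" for \<omega> using N_zero[OF that] by simp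
    show "N (T * s) \<omega> \<le> N (T * t) \<omega>" if "\<omega> \<in> space M" "0 \<le> s" "s \<le> t" for s t \<omega>
      using that T by (intro N_mono) auto
    show "continuous (at_right t) (\<lambda>s. N (T * s) \<omega>)" if "\<omega> \<in> space M" "0 \<le> t" for t \<omega>
    proof -
      have "((\<lambda>s. N s \<omega>) \<longlongrightarrow> N (T * t) \<omega>) (at_right (T * t))"
        using N_right_continuous[OF that(1), of "T * t"] that(2) T by (simp add: continuous_within)
      moreover have "filterlim (\<lambda>s. T * s) (at_right (T * t)) (at_right t)"
        using T by (intro filterlim_times_pos[OF filterlim_ident]) auto
      ultimately show ?thesis
        unfolding continuous_within by (rule filterlim_compose)
    qed
    show "distr M (count_space UNIV) (\<lambda>\<omega>. N (T * t) \<omega> - N (T * s) \<omega>) = measure_pmf (poisson_pmf (rate * T * (t - s)))"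
      if "0 \<le> s" "s < t" for s t
      using N_increment[of "T * s" "T * t"] that T by (simp add: algebra_simps)
    show "indep_vars (\<lambda>_. count_space UNIV) (\<lambda>i \<omega>. N (T * t (Suc i)) \<omega> - N (T * t i) \<omega>) {..<n}"
      if "0 \<le> t 0" "\<And>i. i < n \<Longrightarrow> t i \<le> t (Suc i)" for n and t :: "nat \<Rightarrow> real"
      using N_indep_increments[of "\<lambda>i. T * t i" n] that T by simp
  qed
qed

lemma set_integral_rescale:
  fixes h :: "real \<Rightarrow> real"
  assumes "0 < T"
  shows "(LBINT u:{0..T * s}. h u) = T * (LBINT v:{0..s}. h (T * v))"
proof -
  have "indicator {0..T * s} (T * v) = (indicator {0..s} v :: real)" for v
    using assms by (auto simp: indicator_def zero_le_mult_iff)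
  then show ?thesis
    using lborel_integral_real_affine[of T "\<lambda>u. indicator {0..T * s} u *\<^sub>R h u" 0] assms
    by (simp add: set_lebesgue_integral_def)
qed

text \<open>Time is measured in units of \<open>T\<close> and space in units of \<open>S\<close>. In
  these units the speed is \<open>\<sigma> * c * T / S\<close>, which is the condition imposed on
  \<open>\<kappa>\<close>.\<close>

lemma eta_rescale:
  assumes T: "0 < T" and S: "S \<noteq> 0" and \<kappa>: "S * \<kappa> = \<sigma> * c * T"
  shows "eta \<sigma> c N x f T \<omega> = scaled_functional f S (x / S) \<kappa> (sgn_path (\<lambda>s. N (T * s) \<omega>))"
proof -
  have tele: "x + telegraph \<sigma> c N (T * s) \<omega> = S * pos (x / S) \<kappa> (sgn_path (\<lambda>s. N (T * s) \<omega>)) s" for s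
  proof -
    have "(LBINT v:{0..s}. (- 1) ^ N (T * v) \<omega>) = path_int (sgn_path (\<lambda>s. N (T * s) \<omega>)) s"
      unfolding path_int_def by (rule set_lebesgue_integral_cong) (auto simp: sgn_path_def max_def)
    then have "telegraph \<sigma> c N (T * s) \<omega> = \<sigma> * c * T * path_int (sgn_path (\<lambda>s. N (T * s) \<omega>)) s"
      unfolding telegraph_def set_integral_rescale[OF T] by simp
    then show ?thesis using S by (simp add: pos_def distrib_left flip: \<kappa>)
  qed
  have "eta \<sigma> c N x f T \<omega> = (LBINT s:{0..1}. f (x + telegraph \<sigma> c N (T * s) \<omega>))"
    using set_integral_rescale[OF T, of 1 "\<lambda>t. f (x + telegraph \<sigma> c N t \<omega>)"] T by (simp add: eta_def)
  then show ?thesis by (simp only: tele path_int_def)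
qed

context poisson_process
begin

lemma occ_integrable:
  assumes "0 \<le> \<theta>"
  shows "integrable M (\<lambda>\<omega>. exp (- \<theta> * occ z \<kappa> (path \<omega>) t))"
proof (rule integrable_const_bound[of _ 1])
  show "(\<lambda>\<omega>. exp (- \<theta> * occ z \<kappa> (path \<omega>) t)) \<in> borel_measurable M"
    using path_measurable by measurable
qed (use assms occ_nonneg in auto)

lemma occ_lipschitz:
  assumes \<omega>: "\<omega> \<in> space M" and "0 \<le> s" "s \<le> t"
  shows "\<bar>occ z \<kappa> (path \<omega>) t - occ z \<kappa> (path \<omega>) s\<bar> \<le> t - s"
proof -
  interpret cp: counting_path "\<lambda>s. N s \<omega>" by (rule counting_path[OF \<omega>])
  show ?thesis
    using path_int_lipschitz[of "\<lambda>s. indicator {0<..} (pos z \<kappa> (path \<omega>) s)" 1 s t] assms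
    by (simp add: occ_def)
qed

text \<open>The bound and the Lipschitz constant are independent of the rate and of the start; this
  is the equicontinuity in time required by \<open>tendsto_0_of_laplace\<close>.\<close>

lemma occ_transform:
  fixes z \<kappa> \<theta> :: real
  assumes \<theta>: "0 \<le> \<theta>"
  defines "\<Phi> \<equiv> \<lambda>t. expectation (\<lambda>\<omega>. exp (- \<theta> * occ z \<kappa> (path \<omega>) t))"
  shows "\<Phi> \<in> borel_measurable borel" "\<bar>\<Phi> t\<bar> \<le> 1"
    and "0 \<le> t \<Longrightarrow> 0 \<le> t' \<Longrightarrow> \<bar>\<Phi> t - \<Phi> t'\<bar> \<le> \<theta> * \<bar>t - t'\<bar>"
proof -
  have "(\<lambda>(t, \<omega>). exp (- \<theta> * occ z \<kappa> (path \<omega>) t)) \<in> borel_measurable (borel \<Otimes>\<^sub>M M)"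
    by (subst measurable_pair_swap_iff) (simp add: case_prod_beta)
  then show "\<Phi> \<in> borel_measurable borel" unfolding \<Phi>_def by measurable
  show "\<bar>\<Phi> t\<bar> \<le> 1" unfolding \<Phi>_def using \<theta> occ_nonneg by (intro abs_expectation_le) auto
  have lip: "\<bar>\<Phi> t - \<Phi> t'\<bar> \<le> \<theta> * (t' - t)" if t: "0 \<le> t" "t \<le> t'" for t t'
  proof -
    have "\<Phi> t - \<Phi> t' = expectation (\<lambda>\<omega>. exp (- \<theta> * occ z \<kappa> (path \<omega>) t) - exp (- \<theta> * occ z \<kappa> (path \<omega>) t'))"
      unfolding \<Phi>_def by (rule Bochner_Integration.integral_diff[symmetric, OF occ_integrable[OF \<theta>] occ_integrable[OF \<theta>]])
    also have "\<bar>\<dots>\<bar> \<le> \<theta> * (t' - t)"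
    proof (rule abs_expectation_le)
      fix \<omega> assume \<omega>: "\<omega> \<in> space M"
      have "\<bar>exp (- \<theta> * occ z \<kappa> (path \<omega>) t) - exp (- \<theta> * occ z \<kappa> (path \<omega>) t')\<bar>
          \<le> \<bar>\<theta> * occ z \<kappa> (path \<omega>) t - \<theta> * occ z \<kappa> (path \<omega>) t'\<bar>"
        using abs_exp_diff_le[of "\<theta> * occ z \<kappa> (path \<omega>) t" "\<theta> * occ z \<kappa> (path \<omega>) t'"] \<theta> occ_nonneg by simp
      also have "\<dots> = \<theta> * \<bar>occ z \<kappa> (path \<omega>) t' - occ z \<kappa> (path \<omega>) t\<bar>"
        using \<theta> by (simp add: abs_mult abs_minus_commute flip: right_diff_distrib)
      also have "\<dots> \<le> \<theta> * (t' - t)" by (intro mult_left_mono occ_lipschitz \<omega> t \<theta>)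
      finally show "\<bar>exp (- \<theta> * occ z \<kappa> (path \<omega>) t) - exp (- \<theta> * occ z \<kappa> (path \<omega>) t')\<bar> \<le> \<theta> * (t' - t)" .
    qed (use \<theta> t in simp)
    finally show ?thesis .
  qed
  show "\<bar>\<Phi> t - \<Phi> t'\<bar> \<le> \<theta> * \<bar>t - t'\<bar>" if "0 \<le> t" "0 \<le> t'"
    using lip[of t t'] lip[of t' t] that by (cases "t \<le> t'") (simp_all add: abs_minus_commute)
qed

lemma scaled_functional_bounded:
  fixes f :: "real \<Rightarrow> real" and S z \<kappa> :: real
  assumes [measurable]: "f \<in> borel_measurable borel" and B: "\<And>y. \<bar>f y\<bar> \<le> B"
  defines "X \<equiv> \<lambda>\<omega>. scaled_functional f S z \<kappa> (path \<omega>)"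
  shows "X \<in> borel_measurable M" "\<omega> \<in> space M \<Longrightarrow> \<bar>X \<omega>\<bar> \<le> B"
proof -
  have "(\<lambda>(\<omega>, s). f (S * pos z \<kappa> (path \<omega>) s)) \<in> borel_measurable (M \<Otimes>\<^sub>M borel)"
    unfolding case_prod_beta by measurable
  then show "X \<in> borel_measurable M" unfolding X_def by measurable
  assume \<omega>: "\<omega> \<in> space M"
  interpret cp: counting_path "\<lambda>s. N s \<omega>" by (rule counting_path[OF \<omega>])
  have "(\<lambda>s. f (S * pos z \<kappa> (path \<omega>) s)) \<in> borel_measurable borel" by measurable
  then show "\<bar>X \<omega>\<bar> \<le> B"
    using path_int_lipschitz[of "\<lambda>s. f (S * pos z \<kappa> (path \<omega>) s)" B 0 1] B by (simp add: X_def)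
qed

end

text \<open>The Laplace transforms in time are compared at positive integers. For the occupation
  time it is the resolvent at \<open>z T\<close> up to an error of order
  \<open>1 / sqrt (rate T)\<close>; for the limit it is the same resolvent at \<open>a\<close>, and
  the resolvent is Lipschitz.\<close>

lemma occ_transform_tendsto:
  fixes M :: "real \<Rightarrow> 'a measure" and a \<theta> :: real
  assumes pp: "\<forall>\<^sub>F T in F. poisson_process (M T) (rate T) (N T) \<and> (\<kappa> T)\<^sup>2 = rate T"
    and rate: "filterlim rate at_top F" and z: "(z \<longlongrightarrow> a) F" and a: "a \<le> 0" and \<theta>: "0 \<le> \<theta>"
  shows "((\<lambda>T. \<integral>\<omega>. exp (- \<theta> * occ (z T) (\<kappa> T) (sgn_of (N T) \<omega>) 1) \<partial>M T) \<longlongrightarrow> limit_transform (- a) \<theta> 1) F"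
proof -
  define \<Phi> where "\<Phi> T t = (\<integral>\<omega>. exp (- \<theta> * occ (z T) (\<kappa> T) (sgn_of (N T) \<omega>) t) \<partial>M T)" for T t
  define u where "u T t = \<Phi> T t - limit_transform (- a) \<theta> t" for T t
  have b: "0 \<le> - a" using a by simp
  have inv_rate: "((\<lambda>T. C / sqrt (rate T)) \<longlongrightarrow> 0) F" for C
    by (intro real_tendsto_divide_at_top[OF tendsto_const] filterlim_compose[OF sqrt_at_top rate])
  have "((\<lambda>T. u T 1) \<longlongrightarrow> 0) F"
  proof (rule tendsto_0_of_laplace)
    show "\<forall>\<^sub>F T in F. u T \<in> borel_measurable borel \<and> (\<forall>t\<ge>0. \<bar>u T t\<bar> \<le> 2) \<and>
      (\<forall>t\<ge>0. \<bar>u T t - u T 1\<bar> \<le> (2 * \<theta>) * \<bar>t - 1\<bar>)"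
      using pp
    proof eventually_elim
      case (elim T)
      then interpret poisson_process "M T" "rate T" "N T" by simp
      note o = occ_transform[OF \<theta>, where z="z T" and \<kappa>="\<kappa> T", folded \<Phi>_def]
      have "u T \<in> borel_measurable borel"
        unfolding u_def using o(1) limit_transform_measurable[OF b] by measurable
      moreover have "\<bar>u T t\<bar> \<le> 2" for t
        using o(2)[of t] limit_transform_bounded[OF b \<theta>, of t] by (simp add: u_def)
      moreover have "\<bar>u T t - u T 1\<bar> \<le> (2 * \<theta>) * \<bar>t - 1\<bar>" if "0 \<le> t" for t
        using o(3)[of t 1] that limit_transform_lipschitz[OF b \<theta>, of t 1] unfolding u_def by simp
      ultimately show ?case by blast
    qed
    fix n :: nat assume n: "1 \<le> n"
    define \<alpha> where "\<alpha> = real n"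
    have \<alpha>: "0 < \<alpha>" using n by (simp add: \<alpha>_def)
    let ?w = "step_resolvent \<alpha> \<theta> (1 / (\<alpha> + \<theta>)) (1 / \<alpha>)"
    \<comment> \<open>With this choice of \<open>p\<close> and \<open>q\<close> the source is
      constantly 1, so the discounted integral is just the Laplace transform of
      \<open>\<Phi> T\<close>.\<close>
    have one: "(if P then (\<alpha> + \<theta>) * (1 / (\<alpha> + \<theta>)) else \<alpha> * (1 / \<alpha>)) = 1" for P
      using \<alpha> \<theta> by auto
    obtain K where K: "\<forall>(M :: 'a measure) rate N \<kappa> z. poisson_process M rate N \<longrightarrow> \<kappa>\<^sup>2 = rate \<longrightarrow>
      \<bar>?w z - (LBINT s:{0..}. \<integral>\<omega>. disc \<alpha> \<theta> z \<kappa> (sgn_of N \<omega>) s *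
         (if 0 < pos z \<kappa> (sgn_of N \<omega>) s then (\<alpha> + \<theta>) * (1 / (\<alpha> + \<theta>)) else \<alpha> * (1 / \<alpha>)) \<partial>M)\<bar> \<le> K / sqrt rate"
      using resolvent_step[OF \<alpha> \<theta>] by (rule exE)
    obtain L where L: "\<And>y z. \<bar>?w y - ?w z\<bar> \<le> L * \<bar>y - z\<bar>"
      using step_resolvent_lipschitz[OF \<alpha> \<theta>] by blast
    have "((\<lambda>T. L * \<bar>z T - a\<bar> + K / sqrt (rate T)) \<longlongrightarrow> L * \<bar>a - a\<bar> + 0) F"
      by (intro tendsto_add tendsto_mult tendsto_const tendsto_rabs tendsto_diff z inv_rate)
    then have lim: "((\<lambda>T. L * \<bar>z T - a\<bar> + K / sqrt (rate T)) \<longlongrightarrow> 0) F" by simp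
    have "\<forall>\<^sub>F T in F. norm (LBINT t:{0..}. exp (- \<alpha> * t) * u T t) \<le> L * \<bar>z T - a\<bar> + K / sqrt (rate T)"
      using pp
    proof eventually_elim
      case (elim T)
      then interpret poisson_process "M T" "rate T" "N T" by simp
      note o = occ_transform[OF \<theta>, where z="z T" and \<kappa>="\<kappa> T", folded \<Phi>_def]
      have d: "(\<integral>\<omega>. disc \<alpha> \<theta> (z T) (\<kappa> T) (path \<omega>) s * 1 \<partial>M T) = exp (- \<alpha> * s) * \<Phi> T s" for s
        by (simp add: disc_def \<Phi>_def exp_diff exp_minus divide_inverse)
      have r: "\<bar>?w (z T) - (LBINT t:{0..}. exp (- \<alpha> * t) * \<Phi> T t)\<bar> \<le> K / sqrt (rate T)"
        using K[rule_format, of "M T" "rate T" "N T" "\<kappa> T" "z T", unfolded one d] elim by blast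
      have i: "set_integrable lborel {0..} (\<lambda>t. exp (- \<alpha> * t) * \<Phi> T t)"
      proof (rule set_integrable_exp_bound(1)[OF \<alpha>, of _ 1])
        show "(\<lambda>t. exp (- \<alpha> * t) * \<Phi> T t) \<in> borel_measurable borel" using o(1) by measurable
        show "\<bar>exp (- \<alpha> * t) * \<Phi> T t\<bar> \<le> 1 * exp (- \<alpha> * t)" for t
          using o(2)[of t] by (simp add: abs_mult)
      qed
      have "(LBINT t:{0..}. exp (- \<alpha> * t) * u T t) = (LBINT t:{0..}. exp (- \<alpha> * t) * \<Phi> T t) - ?w a"
        unfolding u_def right_diff_distrib
        using set_integral_diff(2)[OF i limit_transform_laplace(1)[OF \<alpha> \<theta> b]] limit_transform_laplace(2)[OF \<alpha> \<theta> b] by simp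
      then show ?case using r L[of "z T" a] unfolding real_norm_def by linarith
    qed
    from Lim_null_comparison[OF this lim]
    show "((\<lambda>T. LBINT t:{0..}. exp (- real n * t) * u T t) \<longlongrightarrow> 0) F" by (simp add: \<alpha>_def)
  qed
  then have "((\<lambda>T. u T 1 + limit_transform (- a) \<theta> 1) \<longlongrightarrow> 0 + limit_transform (- a) \<theta> 1) F"
    by (intro tendsto_add tendsto_const)
  then show ?thesis by (simp add: u_def \<Phi>_def)
qed

text \<open>The functional of \<open>f\<close> may be negative; a shift by \<open>B\<close> reduces
  to nonnegative exponents, at the price of the factor \<open>exp (\<theta> * B)\<close>.\<close>

lemma exp_diff_le_on_bounded:
  fixes x y B \<theta> :: real
  assumes "\<bar>x\<bar> \<le> B" "\<bar>y\<bar> \<le> B" "0 \<le> \<theta>"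
  shows "\<bar>exp (- \<theta> * x) - exp (- \<theta> * y)\<bar> \<le> exp (\<theta> * B) * \<theta> * \<bar>x - y\<bar>"
proof -
  have eq: "exp (- \<theta> * v) = exp (\<theta> * B) * exp (- (\<theta> * (v + B)))" for v
    unfolding exp_add[symmetric] by (intro arg_cong[of _ _ exp]) (simp add: algebra_simps)
  have "\<bar>exp (- (\<theta> * (x + B))) - exp (- (\<theta> * (y + B)))\<bar> \<le> \<bar>\<theta> * (x + B) - \<theta> * (y + B)\<bar>"
    using assms by (intro abs_exp_diff_le mult_nonneg_nonneg) auto
  also have "\<theta> * (x + B) - \<theta> * (y + B) = \<theta> * (x - y)" by (simp add: algebra_simps)
  finally have "\<bar>exp (- (\<theta> * (x + B))) - exp (- (\<theta> * (y + B)))\<bar> \<le> \<theta> * \<bar>x - y\<bar>"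
    using assms(3) by (simp add: abs_mult)
  then have "exp (\<theta> * B) * \<bar>exp (- (\<theta> * (x + B))) - exp (- (\<theta> * (y + B)))\<bar> \<le> exp (\<theta> * B) * (\<theta> * \<bar>x - y\<bar>)"
    by (rule mult_left_mono) simp
  then show ?thesis unfolding eq[of x] eq[of y] right_diff_distrib[symmetric] abs_mult by (simp add: mult.assoc)
qed

text \<open>Where \<open>f\<close> is not yet close to its limits, the unscaled argument is bounded
  by some \<open>R\<close>. In the rescaled coordinate this is a window of half-width
  \<open>R / S T\<close>, which shrinks to 0.\<close>

lemma occupation_approximation_tendsto:
  fixes M :: "real \<Rightarrow> 'a measure" and f :: "real \<Rightarrow> real"
  assumes pp: "\<forall>\<^sub>F T in F. poisson_process (M T) (rate T) (N T) \<and> (\<kappa> T)\<^sup>2 = rate T"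
    and rate: "filterlim rate at_top F" and S: "filterlim S at_top F"
    and f [measurable]: "f \<in> borel_measurable borel" and B: "\<And>y. \<bar>f y\<bar> \<le> B"
    and bot: "(f \<longlongrightarrow> 0) at_bot" and top: "(f \<longlongrightarrow> 1) at_top"
  shows "((\<lambda>T. \<integral>\<omega>. \<bar>scaled_functional f (S T) (z T) (\<kappa> T) (sgn_of (N T) \<omega>)
      - occ (z T) (\<kappa> T) (sgn_of (N T) \<omega>) 1\<bar> \<partial>M T) \<longlongrightarrow> 0) F" (is "(?I \<longlongrightarrow> 0) F")
proof (rule tendstoI)
  fix \<epsilon> :: real assume \<epsilon>: "0 < \<epsilon>"
  obtain K where K: "\<forall>(M :: 'a measure) rate N \<kappa> z \<delta> u \<epsilon> C. poisson_process M rate N \<longrightarrow> \<kappa>\<^sup>2 = rate \<longrightarrow> 0 \<le> \<delta> \<longrightarrow> 0 \<le> C \<longrightarrow>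
    u \<in> borel_measurable borel \<longrightarrow> (\<forall>y. \<bar>u y - indicator {0<..} y\<bar> \<le> \<epsilon> + C * indicator {-\<delta><..\<delta>} y) \<longrightarrow>
    (\<integral>\<omega>. \<bar>path_int (\<lambda>s. u (pos z \<kappa> (sgn_of N \<omega>) s)) 1 - occ z \<kappa> (sgn_of N \<omega>) 1\<bar> \<partial>M)
      \<le> \<epsilon> + C * (K * (\<delta> + 1 / sqrt rate))"
    using occupation_approximation[where 'a='a] by (elim exE conjE)
  have "\<forall>\<^sub>F y in at_top. \<bar>f y - 1\<bar> < \<epsilon> / 2"
    using tendstoD[OF top, of "\<epsilon> / 2"] \<epsilon> by (simp add: dist_real_def)
  then obtain R1 where R1: "\<And>y. R1 \<le> y \<Longrightarrow> \<bar>f y - 1\<bar> < \<epsilon> / 2" by (auto simp: eventually_at_top_linorder)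
  have "\<forall>\<^sub>F y in at_bot. \<bar>f y - 0\<bar> < \<epsilon> / 2"
    using tendstoD[OF bot, of "\<epsilon> / 2"] \<epsilon> by (simp add: dist_real_def)
  then obtain R2 where R2: "\<And>y. y \<le> R2 \<Longrightarrow> \<bar>f y - 0\<bar> < \<epsilon> / 2" by (auto simp: eventually_at_bot_linorder)
  \<comment> \<open>A single nonnegative threshold for both tails, so that the window is
    symmetric.\<close>
  define R where "R = max 0 (max R1 (- R2))"
  define C where "C = B + 1"
  have C0: "0 \<le> C" using B[of 0] by (simp add: C_def)
  have "((\<lambda>T. C * (K * (R / S T + 1 / sqrt (rate T)))) \<longlongrightarrow> C * (K * (0 + 0))) F"
    by (intro tendsto_mult tendsto_add tendsto_const real_tendsto_divide_at_top[OF tendsto_const] S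
        filterlim_compose[OF sqrt_at_top rate])
  then have "((\<lambda>T. C * (K * (R / S T + 1 / sqrt (rate T)))) \<longlongrightarrow> 0) F" by simp
  from tendstoD[OF this, of "\<epsilon> / 2"]
  have "\<forall>\<^sub>F T in F. \<bar>C * (K * (R / S T + 1 / sqrt (rate T)))\<bar> < \<epsilon> / 2"
    using \<epsilon> by (simp add: dist_real_def)
  moreover have "\<forall>\<^sub>F T in F. 0 < S T" using S by (simp add: filterlim_at_top_dense)
  ultimately show "\<forall>\<^sub>F T in F. dist (?I T) 0 < \<epsilon>"
    using pp
  proof eventually_elim
    case (elim T)
    let ?\<delta> = "R / S T"
    have "\<bar>f (S T * y) - indicator {0<..} y\<bar> \<le> \<epsilon> / 2 + C * indicator {-?\<delta><..?\<delta>} y" for y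
    proof -
      consider "y \<le> - ?\<delta>" | "- ?\<delta> < y" "y \<le> ?\<delta>" | "?\<delta> < y" by linarith
      then show ?thesis
      proof cases
        case 1
        then have "S T * y \<le> - R" using elim(2) by (simp add: field_simps)
        then have "\<bar>f (S T * y) - 0\<bar> < \<epsilon> / 2" by (intro R2) (simp add: R_def)
        moreover have "0 \<le> ?\<delta>" using elim(2) by (simp add: R_def)
        ultimately show ?thesis using 1 by simp
      next
        case 2
        have "\<bar>f (S T * y) - indicator {0<..} y\<bar> \<le> C"
          using B[of "S T * y"] by (auto simp: C_def indicator_def)
        then show ?thesis using 2 \<epsilon> by simp
      next
        case 3
        then have "R < S T * y" using elim(2) by (simp add: field_simps)
        then have "\<bar>f (S T * y) - 1\<bar> < \<epsilon> / 2" by (intro R1) (simp add: R_def)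
        moreover have "0 \<le> ?\<delta>" using elim(2) by (simp add: R_def)
        ultimately show ?thesis using 3 by simp
      qed
    qed
    moreover have "(\<lambda>y. f (S T * y)) \<in> borel_measurable borel" by measurable
    moreover have "0 \<le> ?\<delta>" using elim(2) by (simp add: R_def)
    ultimately have "?I T \<le> \<epsilon> / 2 + C * (K * (?\<delta> + 1 / sqrt (rate T)))"
      using K[rule_format, of "M T" "rate T" "N T" "\<kappa> T" ?\<delta> C "\<lambda>y. f (S T * y)" "\<epsilon> / 2" "z T"] elim(3) C0 by blast
    moreover have "0 \<le> ?I T" by simp
    ultimately show ?case using elim(1) unfolding dist_real_def by linarith
  qed
qed

text \<open>On a bounded set \<open>exp (- n * v)\<close> is Lipschitz in \<open>v\<close>, so
  closeness in mean of the functional to the occupation time gives their transforms the same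
  limit.\<close>

lemma occupation_functional_weak_conv:
  fixes M :: "real \<Rightarrow> 'a measure" and f :: "real \<Rightarrow> real" and a :: real
  assumes pp: "\<forall>\<^sub>F T in F. poisson_process (M T) (rate T) (N T) \<and> (\<kappa> T)\<^sup>2 = rate T"
    and rate: "filterlim rate at_top F" and S: "filterlim S at_top F"
    and z: "(z \<longlongrightarrow> a) F" and a: "a \<le> 0"
    and f [measurable]: "f \<in> borel_measurable borel" and B: "\<And>y. \<bar>f y\<bar> \<le> B"
    and bot: "(f \<longlongrightarrow> 0) at_bot" and top: "(f \<longlongrightarrow> 1) at_top"
  shows "weak_conv_along (\<lambda>T. distr (M T) borel (\<lambda>\<omega>. scaled_functional f (S T) (z T) (\<kappa> T) (sgn_of (N T) \<omega>)))
    (Y_law (- a)) F"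
\<comment> \<open>The bound has to cover the functional, which is at most \<open>B\<close>, as well
  as the occupation time and the limit law, which lie in the unit interval.\<close>
proof (rule weak_conv_along_of_transforms[where B="max B 1"])
  let ?X = "\<lambda>T \<omega>. scaled_functional f (S T) (z T) (\<kappa> T) (sgn_of (N T) \<omega>)"
  let ?A = "\<lambda>T \<omega>. occ (z T) (\<kappa> T) (sgn_of (N T) \<omega>) 1"
  have b: "0 \<le> - a" using a by simp
  show "\<forall>\<^sub>F T in F. prob_space (M T) \<and> ?X T \<in> borel_measurable (M T) \<and> (\<forall>\<omega>\<in>space (M T). \<bar>?X T \<omega>\<bar> \<le> max B 1)"
    using pp
  proof eventually_elim
    case (elim T)
    then interpret poisson_process "M T" "rate T" "N T" by simp
    have "\<bar>?X T \<omega>\<bar> \<le> max B 1" if "\<omega> \<in> space (M T)" for \<omega>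
      using scaled_functional_bounded(2)[OF f B that, of "S T" "z T" "\<kappa> T"] by simp
    then show ?case using scaled_functional_bounded(1)[OF f B] prob_space_axioms by blast
  qed
  show "prob_space (Y_law (- a))" by (rule prob_space_Y_law[OF b])
  show "AE y in Y_law (- a). \<bar>y\<bar> \<le> max B 1" using AE_Y_law[OF b] by eventually_elim auto
  fix n :: nat
  let ?C = "exp (real n * max B 1) * real n"
  have conv: "((\<lambda>T. \<integral>\<omega>. exp (- real n * ?A T \<omega>) \<partial>M T) \<longlongrightarrow> (\<integral>y. exp (- real n * y) \<partial>Y_law (- a))) F"
    unfolding Y_law_transform[OF b] by (rule occ_transform_tendsto[OF pp rate z a]) simp
  have "((\<lambda>T. ?C * (\<integral>\<omega>. \<bar>?X T \<omega> - ?A T \<omega>\<bar> \<partial>M T)) \<longlongrightarrow> ?C * 0) F"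
    by (intro tendsto_mult tendsto_const occupation_approximation_tendsto[OF pp rate S f B bot top])
  then have lim: "((\<lambda>T. ?C * (\<integral>\<omega>. \<bar>?X T \<omega> - ?A T \<omega>\<bar> \<partial>M T)) \<longlongrightarrow> 0) F" by simp
  have "\<forall>\<^sub>F T in F. norm ((\<integral>\<omega>. exp (- real n * ?X T \<omega>) \<partial>M T) - (\<integral>\<omega>. exp (- real n * ?A T \<omega>) \<partial>M T))
      \<le> ?C * (\<integral>\<omega>. \<bar>?X T \<omega> - ?A T \<omega>\<bar> \<partial>M T)"
    using pp
  proof eventually_elim
    case (elim T)
    then interpret poisson_process "M T" "rate T" "N T" by simp
    have Xm: "?X T \<in> borel_measurable (M T)" by (rule scaled_functional_bounded(1)[OF f B])
    have XB: "\<bar>?X T \<omega>\<bar> \<le> max B 1" if "\<omega> \<in> space (M T)" for \<omega>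
      using scaled_functional_bounded(2)[OF f B that, of "S T" "z T" "\<kappa> T"] by simp
    have Am: "?A T \<in> borel_measurable (M T)" using path_measurable by measurable
    have AB: "\<bar>?A T \<omega>\<bar> \<le> max B 1" if "\<omega> \<in> space (M T)" for \<omega>
    proof -
      have "occ (z T) (\<kappa> T) (path \<omega>) 0 = 0" by (simp add: occ_def)
      then show ?thesis using occ_lipschitz[OF that, of 0 1 "z T" "\<kappa> T"] by simp
    qed
    have iX: "integrable (M T) (\<lambda>\<omega>. exp (- real n * ?X T \<omega>))"
    proof (rule integrable_const_bound[of _ "exp (real n * max B 1)"])
      have "real n * - ?X T \<omega> \<le> real n * max B 1" if "\<omega> \<in> space (M T)" for \<omega>
        using XB[OF that] by (intro mult_left_mono) auto
      then show "AE \<omega> in M T. norm (exp (- real n * ?X T \<omega>)) \<le> exp (real n * max B 1)" by simp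
    qed (use Xm in measurable)
    have iA: "integrable (M T) (\<lambda>\<omega>. exp (- real n * ?A T \<omega>))" by (rule occ_integrable) simp
    have iXA: "integrable (M T) (\<lambda>\<omega>. \<bar>?X T \<omega> - ?A T \<omega>\<bar>)"
    proof (rule integrable_const_bound[of _ "max B 1 + max B 1"])
      show "AE \<omega> in M T. norm \<bar>?X T \<omega> - ?A T \<omega>\<bar> \<le> max B 1 + max B 1"
      proof (rule AE_I2)
        fix \<omega> assume \<omega>: "\<omega> \<in> space (M T)"
        show "norm \<bar>?X T \<omega> - ?A T \<omega>\<bar> \<le> max B 1 + max B 1"
          unfolding real_norm_def abs_abs using XB[OF \<omega>] AB[OF \<omega>] by linarith
      qed
    qed (use Xm Am in measurable)
    have eq: "(\<integral>\<omega>. exp (- real n * ?X T \<omega>) \<partial>M T) - (\<integral>\<omega>. exp (- real n * ?A T \<omega>) \<partial>M T)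
        = (\<integral>\<omega>. exp (- real n * ?X T \<omega>) - exp (- real n * ?A T \<omega>) \<partial>M T)"
      by (rule Bochner_Integration.integral_diff[OF iX iA, symmetric])
    have "norm (\<integral>\<omega>. exp (- real n * ?X T \<omega>) - exp (- real n * ?A T \<omega>) \<partial>M T)
        \<le> (\<integral>\<omega>. norm (exp (- real n * ?X T \<omega>) - exp (- real n * ?A T \<omega>)) \<partial>M T)"
      by (rule integral_norm_bound)
    also have "\<dots> \<le> (\<integral>\<omega>. ?C * \<bar>?X T \<omega> - ?A T \<omega>\<bar> \<partial>M T)"
    proof (rule integral_mono)
      show "integrable (M T) (\<lambda>\<omega>. norm (exp (- real n * ?X T \<omega>) - exp (- real n * ?A T \<omega>)))"
        by (intro integrable_norm Bochner_Integration.integrable_diff iX iA)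
      show "integrable (M T) (\<lambda>\<omega>. ?C * \<bar>?X T \<omega> - ?A T \<omega>\<bar>)" by (intro integrable_mult_right iXA)
      show "norm (exp (- real n * ?X T \<omega>) - exp (- real n * ?A T \<omega>)) \<le> ?C * \<bar>?X T \<omega> - ?A T \<omega>\<bar>"
        if "\<omega> \<in> space (M T)" for \<omega>
        unfolding real_norm_def by (intro exp_diff_le_on_bounded XB AB that) simp
    qed
    also have "\<dots> = ?C * (\<integral>\<omega>. \<bar>?X T \<omega> - ?A T \<omega>\<bar> \<partial>M T)" by (rule integral_mult_right_zero)
    finally show ?case unfolding eq .
  qed
  from tendsto_add[OF Lim_null_comparison[OF this lim] conv]
  show "((\<lambda>T. \<integral>\<omega>. exp (- real n * ?X T \<omega>) \<partial>M T) \<longlongrightarrow> (\<integral>y. exp (- real n * y) \<partial>Y_law (- a))) F" by simp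
qed simp

section \<open>The limit theorem, with the case of nonnegative \<open>a\<close> by
  reflection\<close>

lemma piecewise_continuous_measurable:
  assumes "piecewise_continuous f"
  shows "f \<in> borel_measurable borel"
proof -
  obtain D where "finite D" "\<And>x. x \<notin> D \<Longrightarrow> isCont f x" using assms by (auto simp: piecewise_continuous_def)
  then show ?thesis
    by (intro borel_measurable_continuous_countable_exceptions[of D])
      (auto intro: countable_finite continuous_at_imp_continuous_on)
qed

lemma weak_conv_along_cong:
  assumes "weak_conv_along \<mu> \<nu> F" "\<forall>\<^sub>F i in F. \<mu> i = \<mu>' i"
  shows "weak_conv_along \<mu>' \<nu> F"
  unfolding weak_conv_along_def
proof (intro allI impI)
  fix g :: "real \<Rightarrow> real" assume "continuous_on UNIV g \<and> bounded (range g)"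
  then have "((\<lambda>i. \<integral>y. g y \<partial>(\<mu> i)) \<longlongrightarrow> (\<integral>y. g y \<partial>\<nu>)) F"
    using assms(1) by (simp add: weak_conv_along_def)
  then show "((\<lambda>i. \<integral>y. g y \<partial>(\<mu>' i)) \<longlongrightarrow> (\<integral>y. g y \<partial>\<nu>)) F"
    by (rule Lim_transform_eventually) (use assms(2) in \<open>auto elim: eventually_mono\<close>)
qed

theorem theorem2p4:
  fixes M :: "real \<Rightarrow> 'a measure"
    and N :: "real \<Rightarrow> real \<Rightarrow> 'a \<Rightarrow> nat"
    and x c lam :: "real \<Rightarrow> real"
    and f :: "real \<Rightarrow> real"
    and a \<sigma> :: real
  assumes f_bounded: "bounded (range f)"
    and f_piecewise: "piecewise_continuous f"
    and f_at_bot: "(f \<longlongrightarrow> 0) at_bot"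
    and f_at_top: "(f \<longlongrightarrow> 1) at_top"
    and sign: "\<sigma> \<in> {1, -1}"
    and c_pos: "\<And>T. T > 0 \<Longrightarrow> c T > 0"
    and lam_pos: "\<And>T. T > 0 \<Longrightarrow> lam T > 0"
    and poisson: "\<And>T. T > 0 \<Longrightarrow> poisson_process (M T) (lam T) (N T)"
    and lam_T: "filterlim (\<lambda>T. lam T * T) at_top at_top"
    and x_scaled: "((\<lambda>T. ((c T)\<^sup>2 * T / lam T) powr (-1/2) * x T) \<longlongrightarrow> a) at_top"
    and scale: "filterlim (\<lambda>T. (c T)\<^sup>2 * T / lam T) at_top at_top"
  shows
    "(a \<le> 0 \<longrightarrow>
        weak_conv_along (\<lambda>T. distr (M T) borel (eta \<sigma> (c T) (N T) (x T) f T))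
          (Y_law (- a)) at_top) \<and>
     (a \<ge> 0 \<longrightarrow>
        weak_conv_along (\<lambda>T. distr (M T) borel (eta \<sigma> (c T) (N T) (x T) f T))
          (distr (Y_law a) borel (\<lambda>y. 1 - y)) at_top)"
proof -
  \<comment> \<open>With these scales the rescaled process has jump rate \<open>lam T * T\<close>,
    which is the square of \<open>\<kappa> T\<close>, and \<open>S T * \<kappa> T = c T * T\<close>
    is the speed condition of \<open>eta_rescale\<close>.\<close>
  define K where "K T = (c T)\<^sup>2 * T / lam T" for T
  define S where "S T = sqrt (K T)" for T
  define N' where "N' T s = N T (T * s)" for T s
  define \<kappa> where "\<kappa> T = sqrt (lam T * T)" for T
  have Kpos: "0 < K T" if "0 < T" for T using c_pos[OF that] lam_pos[OF that] that by (simp add: K_def)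
  have S\<kappa>: "S T * \<kappa> T = c T * T" if "0 < T" for T
  proof -
    have "K T * (lam T * T) = (c T * T)\<^sup>2"
      using lam_pos[OF that] by (simp add: K_def power2_eq_square)
    then have "S T * \<kappa> T = sqrt ((c T * T)\<^sup>2)"
      by (simp only: S_def \<kappa>_def real_sqrt_mult[symmetric])
    then show ?thesis using c_pos[OF that] that by simp
  qed
  have T0: "\<forall>\<^sub>F T in at_top. 0 < (T :: real)" by (rule eventually_gt_at_top)
  \<comment> \<open>The sign \<open>s\<close>, the factor \<open>e\<close> of the starting point and
    the function \<open>g\<close> are left free so that the original and the reflected functional
    are both instances.\<close>
  have rep: "eta s (c T) (N T) (e * x T) g T \<omega>
      = scaled_functional g (S T) (e * x T / S T) (s * \<kappa> T) (sgn_of (N' T) \<omega>)"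
    if "0 < T" for s e g T \<omega>
    unfolding N'_def
    by (rule eta_rescale) (use that Kpos[OF that] S\<kappa>[OF that] in \<open>simp_all add: S_def mult.left_commute\<close>)
  have pp: "\<forall>\<^sub>F T in at_top. poisson_process (M T) (lam T * T) (N' T) \<and> (s * \<kappa> T)\<^sup>2 = lam T * T"
    if "s \<in> {1, -1}" for s
    using T0
  proof eventually_elim
    case (elim T)
    then show ?case
      using poisson_process_rescale[OF poisson[OF elim] elim] lam_pos[OF elim] that
      by (auto simp: N'_def[abs_def] \<kappa>_def)
  qed
  have S_top: "filterlim S at_top at_top"
    unfolding S_def K_def by (rule filterlim_compose[OF sqrt_at_top scale])
  have z_lim: "((\<lambda>T. e * x T / S T) \<longlongrightarrow> e * a) at_top" for e
  proof (rule Lim_transform_eventually[OF tendsto_mult_left[OF x_scaled]])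
    show "\<forall>\<^sub>F T in at_top. e * (((c T)\<^sup>2 * T / lam T) powr (- 1 / 2) * x T) = e * x T / S T"
      using T0
    proof eventually_elim
      case (elim T)
      have "K T powr (- (1 / 2)) = 1 / S T"
        using Kpos[OF elim] by (simp only: powr_minus powr_half_sqrt S_def inverse_eq_divide less_imp_le)
      then show ?case by (simp add: K_def)
    qed
  qed
  obtain B where B: "\<And>y. \<bar>f y\<bar> \<le> B" using f_bounded by (auto simp: bounded_iff)
  have fm: "f \<in> borel_measurable borel" by (rule piecewise_continuous_measurable[OF f_piecewise])

  have main: "weak_conv_along (\<lambda>T. distr (M T) borel (eta s (c T) (N T) (e * x T) g T)) (Y_law (- (e * a))) at_top"
    if s: "s \<in> {1, -1}" and ea: "e * a \<le> 0" and g: "g \<in> borel_measurable borel" "\<And>y. \<bar>g y\<bar> \<le> C"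
      "(g \<longlongrightarrow> 0) at_bot" "(g \<longlongrightarrow> 1) at_top" for s e g C
  proof -
    have "weak_conv_along (\<lambda>T. distr (M T) borel (\<lambda>\<omega>. scaled_functional g (S T) (e * x T / S T) (s * \<kappa> T) (sgn_of (N' T) \<omega>)))
      (Y_law (- (e * a))) at_top"
      by (rule occupation_functional_weak_conv[OF pp[OF s] lam_T S_top z_lim ea g])
    moreover have "\<forall>\<^sub>F T in at_top. distr (M T) borel (\<lambda>\<omega>. scaled_functional g (S T) (e * x T / S T) (s * \<kappa> T) (sgn_of (N' T) \<omega>))
       = distr (M T) borel (eta s (c T) (N T) (e * x T) g T)"
      using T0
    proof eventually_elim
      case (elim T)
      have "eta s (c T) (N T) (e * x T) g T = (\<lambda>\<omega>. scaled_functional g (S T) (e * x T / S T) (s * \<kappa> T) (sgn_of (N' T) \<omega>))"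
        by (rule ext) (rule rep[OF elim])
      then show ?case by (simp only:)
    qed
    ultimately show ?thesis by (rule weak_conv_along_cong)
  qed

  show ?thesis
  proof (intro conjI impI)
    assume "a \<le> 0"
    then show "weak_conv_along (\<lambda>T. distr (M T) borel (eta \<sigma> (c T) (N T) (x T) f T)) (Y_law (- a)) at_top"
      using main[OF sign, of 1 f B] fm B f_at_bot f_at_top by simp
  next
    assume a: "a \<ge> 0"
    \<comment> \<open>Negating the start and the velocity negates the whole trajectory. Composing
      \<open>f\<close> with this and subtracting from 1 restores the limits 0 and 1, and changes the
      functional into 1 minus itself.\<close>
    define f' where "f' y = 1 - f (- y)" for y
    have f'm: "f' \<in> borel_measurable borel" using fm unfolding f'_def by measurable
    have f'B: "\<bar>f' y\<bar> \<le> 1 + B" for y using B[of "- y"] unfolding f'_def by linarith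
    have f'_bot: "(f' \<longlongrightarrow> 0) at_bot"
      using tendsto_diff[OF tendsto_const[of 1] filterlim_compose[OF f_at_top filterlim_uminus_at_top_at_bot]]
      by (simp add: f'_def[abs_def])
    have f'_top: "(f' \<longlongrightarrow> 1) at_top"
      using tendsto_diff[OF tendsto_const[of 1] filterlim_compose[OF f_at_bot filterlim_uminus_at_bot_at_top]]
      by (simp add: f'_def[abs_def])
    have reflection: "eta \<sigma> (c T) (N T) (x T) f T \<omega> = 1 - eta (- \<sigma>) (c T) (N T) (- x T) f' T \<omega>"
      and etam: "eta (- \<sigma>) (c T) (N T) (- x T) f' T \<in> borel_measurable (M T)"
      if T: "0 < T" and \<omega>: "\<omega> \<in> space (M T)" for T \<omega>
    proof -
      interpret poisson_process "M T" "lam T * T" "N' T"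
        unfolding N'_def[abs_def] by (rule poisson_process_rescale[OF poisson[OF T] T])
      interpret cp: counting_path "\<lambda>s. N' T s \<omega>" by (rule counting_path[OF \<omega>])
      let ?Z = "pos (x T / S T) (\<sigma> * \<kappa> T) (sgn_of (N' T) \<omega>)"
      have Z: "pos (- x T / S T) (- \<sigma> * \<kappa> T) (sgn_of (N' T) \<omega>) t = - ?Z t" for t
        by (simp add: pos_def)
      have i: "set_integrable lborel {0..1} (\<lambda>t. f (S T * ?Z t))"
        using fm B by (intro set_integrable_bounded_Icc[where B=B]) auto
      have "eta (- \<sigma>) (c T) (N T) (- x T) f' T \<omega> = path_int (\<lambda>t. 1 - f (S T * ?Z t)) 1"
        using rep[OF T, of "- \<sigma>" "- 1" f' \<omega>] unfolding mult_minus1 Z by (simp add: f'_def)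
      also have "\<dots> = 1 - path_int (\<lambda>t. f (S T * ?Z t)) 1"
        unfolding path_int_def
        by (subst set_integral_diff(2)[OF set_integrable_const_Icc i]) (simp add: set_lebesgue_integral_def)
      also have "path_int (\<lambda>t. f (S T * ?Z t)) 1 = eta \<sigma> (c T) (N T) (x T) f T \<omega>"
        using rep[OF T, of \<sigma> 1 f \<omega>] by simp
      finally show "eta \<sigma> (c T) (N T) (x T) f T \<omega> = 1 - eta (- \<sigma>) (c T) (N T) (- x T) f' T \<omega>" by simp
      show "eta (- \<sigma>) (c T) (N T) (- x T) f' T \<in> borel_measurable (M T)"
        using scaled_functional_bounded(1)[OF f'm f'B, of "S T" "- x T / S T" "- \<sigma> * \<kappa> T"] rep[OF T, of "- \<sigma>" "- 1" f']
        by (simp add: fun_eq_iff cong: measurable_cong)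
    qed
    have w: "weak_conv_along (\<lambda>T. distr (M T) borel (eta (- \<sigma>) (c T) (N T) (- x T) f' T)) (Y_law a) at_top"
      using main[of "- \<sigma>" "- 1" f' "1 + B"] sign a f'm f'B f'_bot f'_top by auto
    show "weak_conv_along (\<lambda>T. distr (M T) borel (eta \<sigma> (c T) (N T) (x T) f T)) (distr (Y_law a) borel (\<lambda>y. 1 - y)) at_top"
      unfolding weak_conv_along_def
    proof (intro allI impI)
      fix g :: "real \<Rightarrow> real" assume g: "continuous_on UNIV g \<and> bounded (range g)"
      then have gm: "g \<in> borel_measurable borel" by (auto intro: borel_measurable_continuous_onI)
      have "continuous_on UNIV (\<lambda>y. g (1 - y))"
        by (rule continuous_on_compose2[OF conjunct1[OF g]]) (auto intro!: continuous_intros)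
      moreover have "bounded (range (\<lambda>y. g (1 - y)))"
        using g by (auto intro: bounded_subset)
      ultimately have "((\<lambda>T. \<integral>y. g (1 - y) \<partial>distr (M T) borel (eta (- \<sigma>) (c T) (N T) (- x T) f' T)) \<longlongrightarrow> (\<integral>y. g (1 - y) \<partial>Y_law a)) at_top"
        using w unfolding weak_conv_along_def by blast
      moreover have "(\<integral>y. g (1 - y) \<partial>Y_law a) = (\<integral>y. g y \<partial>distr (Y_law a) borel (\<lambda>y. 1 - y))"
        using gm by (subst integral_distr) auto
      moreover have "\<forall>\<^sub>F T in at_top. (\<integral>y. g (1 - y) \<partial>distr (M T) borel (eta (- \<sigma>) (c T) (N T) (- x T) f' T))
          = (\<integral>y. g y \<partial>distr (M T) borel (eta \<sigma> (c T) (N T) (x T) f T))"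
        using T0
      proof eventually_elim
        case (elim T)
        interpret poisson_process "M T" "lam T" "N T" by (rule poisson[OF elim])
        obtain \<omega> where \<omega>: "\<omega> \<in> space (M T)" using not_empty by auto
        have m: "eta (- \<sigma>) (c T) (N T) (- x T) f' T \<in> borel_measurable (M T)" by (rule etam[OF elim \<omega>])
        then have "(\<lambda>\<omega>. 1 - eta (- \<sigma>) (c T) (N T) (- x T) f' T \<omega>) \<in> borel_measurable (M T)" by measurable
        then have m': "eta \<sigma> (c T) (N T) (x T) f T \<in> borel_measurable (M T)"
          using reflection[OF elim] by (simp cong: measurable_cong)
        show ?case
          using m m' gm reflection[OF elim] by (simp add: integral_distr cong: Bochner_Integration.integral_cong)
      qed
      ultimately show "((\<lambda>T. \<integral>y. g y \<partial>distr (M T) borel (eta \<sigma> (c T) (N T) (x T) f T)) \<longlongrightarrow> (\<integral>y. g y \<partial>distr (Y_law a) borel (\<lambda>y. 1 - y))) at_top"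
        by (simp add: tendsto_cong)
    qed
  qed
qed

end
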